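(* Let $\Gamma$ be a tree-like trivalent graph with $n$ labeled leaves, let $L>1$ be an integer, and let $\vec r=(r_1,\dots,r_n)$ be a vector of non-negative integers which is compatible with $\Gamma$. Then the graded algebra $\mathbb{C}[P_{\Gamma}(\vec r,2L)]$ is generated in degree $1$, and the binomial ideal of relations $I_{P_{\Gamma}(\vec r,2L)}$ is generated by polynomials of degree $\leq 3$.
   Context: Graphs are finite and connected, with loops and multiple edges allowed. A trivalent graph has every vertex of valence $3$ (a trinode; a loop contributes $2$ to the valence) or of valence $1$ (a leaf). Its genus is its first Betti number. A trivalent graph $\Gamma$ of genus $g$ with $n$ leaves is tree-like if it is obtained from a trivalent tree with $g+n$ leaves by adding loops on $g$ of the leaves (attaching a loop at the leaf vertex, which thereby becomes a trinode). Polytope. For a trivalent graph $\Gamma$ with leaves labeled $1,\dots,n$, $\vec r\in\mathbb{Z}_{\ge0}^n$ and an integer $M\ge 0$, $P_\Gamma(\vec r,M)\subset\mathbb{R}^{|Edge(\Gamma)|}$ is the set of non-negative real weightings of the edges of $\Gamma$ such that: (1) at each trinode with incident edge weights $w_1,w_2,w_3$ (a loop at the trinode is listed twice) one has $|w_1-w_2|\le w_3\le w_1+w_2$; (2) at each trinode $w_1+w_2+w_3\le 2M$; (3) the weight of the edge attached to the $i$-th leaf equals $r_i$. Lattice points are taken with respect to the lattice of integer weightings with $w_1+w_2+w_3\in 2\mathbb{Z}$ at every trinode. Algebra. For such a polytope $P$, $X_P$ is its set of lattice points, $mP$ is the $m$-fold Minkowski sum $P+\dots+P$, and $\mathbb{C}[P]$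 is the graded algebra whose $m$-th graded component has as basis the lattice points of $mP$, with product given by addition of lattice points. $I_P$ is the kernel of the natural map $\mathbb{C}[X_P]\to\mathbb{C}[P]$ from the polynomial ring with one variable for each lattice point of $P$. Compatibility. $\vec r$ is compatible with $\Gamma$ if every odd $r_i$ is assigned to a leaf-edge which shares a vertex with the leaf-edge of another odd $r_j$.
   Formalization: Compatibility is read with a unique other odd r_j; this only excludes the tripod (one trinode, three leaves) with three odd weights, where the claim fails, e.g. r=(1,1,1): P has no lattice point but 2P has (2,2,2). *)

theory Defs
  imports
    Complex_Main
    "HOL-Library.Multiset"
    "HOL-Library.Poly_Mapping"
    "HOL-Library.Function_Algebras"
    "HOL-Library.Product_Plus"
    "HOL-Library.Set_Algebras"
begin

section \<open>Trivalent graphs\<close>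

text \<open>The ends of an edge form a two-element multiset, so a loop at \<open>v\<close> has ends \<open>{#v, v#}\<close>.\<close>

record ('v, 'e) mgraph =
  verts :: "'v set"
  edges :: "'e set"
  ends  :: "'e \<Rightarrow> 'v multiset"

definition connected_graph :: "('v, 'e) mgraph \<Rightarrow> bool" where
  "connected_graph G \<longleftrightarrow>
     verts G \<noteq> {} \<and>
     (\<forall>u\<in>verts G. \<forall>v\<in>verts G. (u, v) \<in> {(x, y). \<exists>e\<in>edges G. ends G e = {#x, y#}}\<^sup>*)"

definition graph :: "('v, 'e) mgraph \<Rightarrow> bool" where
  "graph G \<longleftrightarrow>
     finite (verts G) \<and> finite (edges G) \<and>
     (\<forall>e\<in>edges G. size (ends G e) = 2 \<and> set_mset (ends G e) \<subseteq> verts G) \<and>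
     connected_graph G"

text \<open>The edges at a vertex, a loop being listed twice.\<close>

definition incident :: "('v, 'e) mgraph \<Rightarrow> 'v \<Rightarrow> 'e multiset" where
  "incident G v = (\<Sum>e\<in>edges G. replicate_mset (count (ends G e) v) e)"

definition valence :: "('v, 'e) mgraph \<Rightarrow> 'v \<Rightarrow> nat" where
  "valence G v = size (incident G v)"

definition trinodes :: "('v, 'e) mgraph \<Rightarrow> 'v set" where
  "trinodes G = {v \<in> verts G. valence G v = 3}"

definition leaves :: "('v, 'e) mgraph \<Rightarrow> 'v set" where
  "leaves G = {v \<in> verts G. valence G v = 1}"

definition trivalent :: "('v, 'e) mgraph \<Rightarrow> bool" where
  "trivalent G \<longleftrightarrow> graph G \<and> verts G = trinodes G \<union> leaves G"

text \<open>First Betti number of a connected graph, by the Euler characteristic; connectedness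
  gives \<open>card (verts G) \<le> card (edges G) + 1\<close>, so the subtraction does not truncate.\<close>

definition genus :: "('v, 'e) mgraph \<Rightarrow> nat" where
  "genus G = card (edges G) + 1 - card (verts G)"

text \<open>Cycles of length 1 are loops, cycles of length 2 are pairs of parallel edges.\<close>

definition is_cycle :: "('v, 'e) mgraph \<Rightarrow> 'v list \<Rightarrow> 'e list \<Rightarrow> bool" where
  "is_cycle G vs es \<longleftrightarrow>
     es \<noteq> [] \<and> length vs = length es \<and> distinct vs \<and> distinct es \<and>
     set vs \<subseteq> verts G \<and> set es \<subseteq> edges G \<and>
     (\<forall>i<length es. ends G (es ! i) = {#vs ! i, vs ! (Suc i mod length es)#})"

definition tree :: "('v, 'e) mgraph \<Rightarrow> bool" where
  "tree T \<longleftrightarrow> graph T \<and> (\<nexists>vs es. is_cycle T vs es)"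

text \<open>\<open>S\<close> is the set of leaves of \<open>T\<close> that receive a loop, and \<open>l v\<close> is the new loop at \<open>v \<in> S\<close>.\<close>

definition tree_like :: "('v, 'e) mgraph \<Rightarrow> bool" where
  "tree_like G \<longleftrightarrow>
     trivalent G \<and>
     (\<exists>(T :: ('v, 'e) mgraph) S l.
        trivalent T \<and> tree T \<and>
        card (leaves T) = genus G + card (leaves G) \<and>
        S \<subseteq> leaves T \<and> card S = genus G \<and>
        inj_on l S \<and> l ` S \<inter> edges T = {} \<and>
        verts G = verts T \<and> edges G = edges T \<union> l ` S \<and>
        (\<forall>e\<in>edges T. ends G e = ends T e) \<and>
        (\<forall>v\<in>S. ends G (l v) = {#v, v#}))"

definition leaf_edge :: "('v, 'e) mgraph \<Rightarrow> 'v \<Rightarrow> 'e" where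
  "leaf_edge G v = (THE e. e \<in> edges G \<and> v \<in># ends G e)"

definition leaf_labeling :: "('v, 'e) mgraph \<Rightarrow> nat \<Rightarrow> (nat \<Rightarrow> 'v) \<Rightarrow> bool" where
  "leaf_labeling G n lab \<longleftrightarrow> bij_betw lab {1..n} (leaves G)"

text \<open>Every odd weight has a partner, another odd weight on an adjacent leaf edge. The partner is
  read as being unique, that is, odd weights come in pairs. On a tree-like trivalent graph this
  uniqueness only excludes the tripod (one trinode, three leaves) with three odd weights. There the
  algebra need not be generated in degree 1: for weights 1, 1, 1 and \<open>L > 1\<close> the polytope is the
  single point (1, 1, 1), which is not in the lattice, whereas its double (2, 2, 2) is.\<close>

definition compatible ::
    "('v, 'e) mgraph \<Rightarrow> nat \<Rightarrow> (nat \<Rightarrow> 'v) \<Rightarrow> (nat \<Rightarrow> nat) \<Rightarrow> bool" where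
  "compatible G n lab r \<longleftrightarrow>
     (\<forall>i\<in>{1..n}. odd (r i) \<longrightarrow>
        (\<exists>!j. j \<in> {1..n} \<and> j \<noteq> i \<and> odd (r j) \<and>
              set_mset (ends G (leaf_edge G (lab i))) \<inter>
              set_mset (ends G (leaf_edge G (lab j))) \<noteq> {}))"

section \<open>The polytope and its lattice\<close>

text \<open>Weightings of the edges are functions that vanish off the edge set. All orderings of the
  three edges at a trinode are quantified over, so the conditions do not depend on the numbering.\<close>

definition weightings :: "('v, 'e) mgraph \<Rightarrow> ('e \<Rightarrow> real) set" where
  "weightings G = {w. \<forall>e. e \<notin> edges G \<longrightarrow> w e = 0}"

definition graph_polytope ::
    "('v, 'e) mgraph \<Rightarrow> nat \<Rightarrow> (nat \<Rightarrow> 'v) \<Rightarrow> (nat \<Rightarrow> nat) \<Rightarrow> nat \<Rightarrow> ('e \<Rightarrow> real) set" where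
  "graph_polytope G n lab r M =
     {w \<in> weightings G.
        (\<forall>e\<in>edges G. 0 \<le> w e) \<and>
        (\<forall>v\<in>trinodes G. \<forall>e1 e2 e3. incident G v = {#e1, e2, e3#} \<longrightarrow>
            \<bar>w e1 - w e2\<bar> \<le> w e3 \<and> w e3 \<le> w e1 + w e2 \<and>
            w e1 + w e2 + w e3 \<le> 2 * real M) \<and>
        (\<forall>i\<in>{1..n}. w (leaf_edge G (lab i)) = real (r i))}"

definition graph_lattice :: "('v, 'e) mgraph \<Rightarrow> ('e \<Rightarrow> real) set" where
  "graph_lattice G =
     {w \<in> weightings G.
        (\<forall>e\<in>edges G. w e \<in> \<int>) \<and>
        (\<forall>v\<in>trinodes G. \<forall>e1 e2 e3. incident G v = {#e1, e2, e3#} \<longrightarrow>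
            (\<exists>k::int. w e1 + w e2 + w e3 = 2 * of_int k))}"

section \<open>The graded algebra of a polytope and its ideal of relations\<close>

text \<open>In this section \<open>P\<close> is a subset of an additive monoid and \<open>\<Lambda>\<close> its lattice. The sum
  \<open>\<Sum>i<m. P\<close> is the \<open>m\<close>-fold Minkowski sum; for \<open>m = 0\<close> it is \<open>{0}\<close>. The basis element of the
  algebra given by a lattice point \<open>v\<close> of \<open>mP\<close> is the monomial with exponent \<open>(m, v)\<close>.\<close>

definition graded_points :: "'w::comm_monoid_add set \<Rightarrow> 'w set \<Rightarrow> (nat \<times> 'w) set" where
  "graded_points \<Lambda> P = {(m, v). v \<in> (\<Sum>i<m. P) \<inter> \<Lambda>}"

definition polytope_algebra ::
    "'w::comm_monoid_add set \<Rightarrow> 'w set \<Rightarrow> ((nat \<times> 'w) \<Rightarrow>\<^sub>0 complex) set" where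
  "polytope_algebra \<Lambda> P = {f. Poly_Mapping.keys f \<subseteq> graded_points \<Lambda> P}"

definition graded_part ::
    "'w::comm_monoid_add set \<Rightarrow> 'w set \<Rightarrow> nat \<Rightarrow> ((nat \<times> 'w) \<Rightarrow>\<^sub>0 complex) set" where
  "graded_part \<Lambda> P m = {f \<in> polytope_algebra \<Lambda> P. \<forall>k\<in>Poly_Mapping.keys f. fst k = m}"

text \<open>The constants of a monoid algebra are the elements \<open>single 0 c\<close>.\<close>

definition subalgebra :: "('k::comm_monoid_add \<Rightarrow>\<^sub>0 complex) set \<Rightarrow> bool" where
  "subalgebra A \<longleftrightarrow>
     (\<forall>c. Poly_Mapping.single 0 c \<in> A) \<and>
     (\<forall>f\<in>A. \<forall>g\<in>A. f + g \<in> A \<and> f * g \<in> A)"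

definition generated_in_degree_one :: "'w::comm_monoid_add set \<Rightarrow> 'w set \<Rightarrow> bool" where
  "generated_in_degree_one \<Lambda> P \<longleftrightarrow>
     subalgebra hull (graded_part \<Lambda> P 1) = polytope_algebra \<Lambda> P"

text \<open>The polynomial ring with one variable for each element of \<open>X\<close>; monomials are the finitely
  supported exponent functions on \<open>X\<close>.\<close>

definition polynomials_on :: "'w set \<Rightarrow> (('w \<Rightarrow>\<^sub>0 nat) \<Rightarrow>\<^sub>0 complex) set" where
  "polynomials_on X = {p. \<forall>t\<in>Poly_Mapping.keys p. Poly_Mapping.keys t \<subseteq> X}"

text \<open>The algebra homomorphism that sends the variable of \<open>x\<close> to the degree-one basis element
  of \<open>x\<close>.\<close>

definition natural_map ::
    "(('w::comm_monoid_add \<Rightarrow>\<^sub>0 nat) \<Rightarrow>\<^sub>0 complex) \<Rightarrow> ((nat \<times> 'w) \<Rightarrow>\<^sub>0 complex)" where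
  "natural_map p =
     (\<Sum>t\<in>Poly_Mapping.keys p. Poly_Mapping.single 0 (Poly_Mapping.lookup p t) *
        (\<Prod>x\<in>Poly_Mapping.keys t. Poly_Mapping.single (1, x) 1 ^ Poly_Mapping.lookup t x))"

definition relation_ideal ::
    "'w::comm_monoid_add set \<Rightarrow> 'w set \<Rightarrow> (('w \<Rightarrow>\<^sub>0 nat) \<Rightarrow>\<^sub>0 complex) set" where
  "relation_ideal \<Lambda> P = {p \<in> polynomials_on (P \<inter> \<Lambda>). natural_map p = 0}"

definition ideal_in :: "'a::comm_ring_1 set \<Rightarrow> 'a set \<Rightarrow> bool" where
  "ideal_in R J \<longleftrightarrow>
     J \<subseteq> R \<and> 0 \<in> J \<and> (\<forall>f\<in>J. \<forall>g\<in>J. f + g \<in> J) \<and> (\<forall>h\<in>R. \<forall>f\<in>J. h * f \<in> J)"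

definition total_degree_le :: "nat \<Rightarrow> (('w \<Rightarrow>\<^sub>0 nat) \<Rightarrow>\<^sub>0 complex) \<Rightarrow> bool" where
  "total_degree_le d p \<longleftrightarrow>
     (\<forall>t\<in>Poly_Mapping.keys p. (\<Sum>x\<in>Poly_Mapping.keys t. Poly_Mapping.lookup t x) \<le> d)"

definition relations_generated_in_degree_le ::
    "nat \<Rightarrow> 'w::comm_monoid_add set \<Rightarrow> 'w set \<Rightarrow> bool" where
  "relations_generated_in_degree_le d \<Lambda> P \<longleftrightarrow>
     (\<exists>B. (\<forall>p\<in>B. total_degree_le d p) \<and> B \<subseteq> polynomials_on (P \<inter> \<Lambda>) \<and>
          ideal_in (polynomials_on (P \<inter> \<Lambda>)) hull B = relation_ideal \<Lambda> P)"

end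

theory Submission
  imports Defs
begin

text \<open>
  The proof cuts the graph at its nodes, settles both claims at a single node, and glues.

  \<^bold>\<open>Half-weights.\<close> By compatibility the odd leaf edges come in pairs that meet at a trinode. Parity
  then propagates from the leaves inwards: every other tree edge has an even weight in each lattice
  point (\<open>parity_of_lattice_point\<close>). Halving the weights of the tree edges, after a shift on the odd
  ones, therefore turns the lattice points of \<open>mP\<close> into all integer solutions of inequalities that
  involve one node each: \<open>x \<le> y + z\<close>, \<open>y \<le> x + z\<close>, \<open>z \<le> x + y\<close>, \<open>x + y + z \<le> 2Lm\<close> at a trinode of
  the tree without odd edges, an interval for the third edge if the other two are odd leaf edges,
  and \<open>0 \<le> x \<le> y\<close>, \<open>x + y \<le> 2Lm\<close> at a tree edge \<open>x\<close> that carries a loop \<open>y\<close>.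

  \<^bold>\<open>Balance.\<close> Call a multiset of \<open>m\<close> points with sum \<open>w\<close> balanced if on each edge \<open>e\<close> it only takes
  the values \<open>f\<close> and \<open>f + 1\<close>, where \<open>f\<close> is the integer part of \<open>w(e)/m\<close>. On a given edge the values of
  a balanced multiset are determined, with multiplicities, by \<open>m\<close> and \<open>w\<close>. Hence balanced multisets
  at neighbouring nodes can always be glued along their common edge, and since the nodes form a
  tree no further compatibility arises.

  \<^bold>\<open>Generation in degree one.\<close> It is enough to decompose at one node, where one summand in the unit
  cube above the integer parts is split off at a time (\<open>cube_peel\<close>, \<open>loop_peel\<close>). At a trinode, in
  the critical case, each of the four inequalities cuts off one vertex of this cube at most, a vertex with
  odd coordinate sum; for \<open>L > 1\<close> one of the four odd vertices survives, which makes the splitting possible. For \<open>L = 1\<close> all four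
  can disappear, and \<open>(1, 1, 1)\<close> in twice the remaining tetrahedron is then indecomposable.

  \<^bold>\<open>Relations in degree at most three.\<close> A relation says that two multisets of points have the same
  size and sum; it lies in the ideal generated in degree three if one multiset can be changed into
  the other by exchanges of at most three points at a time. If two points of a multiset differ by
  more than one on some edge, a balanced decomposition of their sum replaces them and lowers the sum
  of squares of all entries, so every multiset can be made balanced by exchanges of two points
  (\<open>exchange_to_balanced\<close>). Between balanced multisets at one node, which consist of vertices of a
  cube of dimension at most three, every relation splits conformally into relations of degree at most
  three (\<open>cube_conformal\<close>); the cubic ones are of the type \<open>110 + 101 + 011 = 000 + 111 + 111\<close>.
  Conformality means that only points of the two given multisets are used, so it does not matter which
  vertices of the cube belong to the polytope. Finally, exchanges at one node lift to the glued system,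
  and gluing itself adds only exchanges of two points (\<open>exchange_connected_amalgam\<close>); this is the
  argument for toric fibre products.
\<close>

section \<open>Exchange moves between multisets\<close>

text \<open>Multisets stand for monomials. An exchange multiplies a binomial of degree at most three with a
  monomial \<open>D\<close>, so connectedness under exchanges is membership in the ideal of such binomials.\<close>

definition exchange :: "'w::comm_monoid_add set \<Rightarrow> 'w multiset \<Rightarrow> 'w multiset \<Rightarrow> bool" where
  "exchange X M M' \<longleftrightarrow> (\<exists>A B D. M = A + D \<and> M' = B + D \<and> size A = size B \<and> size A \<le> 3 \<and>
     \<Sum>\<^sub># A = \<Sum>\<^sub># B \<and> set_mset M \<subseteq> X \<and> set_mset M' \<subseteq> X)"

definition exchange_connected :: "'w::comm_monoid_add set \<Rightarrow> bool" where
  "exchange_connected X \<longleftrightarrow> (\<forall>M M'. set_mset M \<subseteq> X \<longrightarrow> set_mset M' \<subseteq> X \<longrightarrow> size M = size M' \<longrightarrow> \<Sum>\<^sub># M = \<Sum>\<^sub># M'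
     \<longrightarrow> (exchange X)\<^sup>*\<^sup>* M M')"

lemma exchange_sym: "exchange X M M' \<Longrightarrow> exchange X M' M"
  unfolding exchange_def by metis

lemma exchanges_sym: "(exchange X)\<^sup>*\<^sup>* M M' \<Longrightarrow> (exchange X)\<^sup>*\<^sup>* M' M"
  by (rule sympD[OF symp_rtranclp]) (auto intro: sympI exchange_sym)

lemma exchanges_mono: "X \<subseteq> Y \<Longrightarrow> (exchange X)\<^sup>*\<^sup>* M M' \<Longrightarrow> (exchange Y)\<^sup>*\<^sup>* M M'"
  by (erule rtranclp_mono[THEN predicate2D, rotated]) (fastforce simp: exchange_def)

lemma exchanges_invariant:
  assumes "(exchange X)\<^sup>*\<^sup>* M M'" "set_mset M \<subseteq> X"
  shows "size M' = size M" "\<Sum>\<^sub># M' = \<Sum>\<^sub># M" "set_mset M' \<subseteq> X"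
proof -
  have "size M' = size M \<and> \<Sum>\<^sub># M' = \<Sum>\<^sub># M \<and> set_mset M' \<subseteq> X"
    using assms by (induction rule: rtranclp_induct) (auto simp: exchange_def)
  then show "size M' = size M" "\<Sum>\<^sub># M' = \<Sum>\<^sub># M" "set_mset M' \<subseteq> X" by auto
qed

lemma exchange_add: "exchange X M M' \<Longrightarrow> set_mset C \<subseteq> X \<Longrightarrow> exchange X (M + C) (M' + C)"
  unfolding exchange_def by (elim exE conjE, rule_tac x=A in exI, rule_tac x=B in exI, rule_tac x="D + C" in exI) (auto simp: ac_simps)

lemma exchanges_add:
  assumes "(exchange X)\<^sup>*\<^sup>* M M'" "set_mset C \<subseteq> X"
  shows "(exchange X)\<^sup>*\<^sup>* (M + C) (M' + C)"
  using assms(1) by induction (auto intro: rtranclp.rtrancl_into_rtrancl exchange_add[OF _ assms(2)])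

lemma exchangeI:
  "size A = size B \<Longrightarrow> size A \<le> 3 \<Longrightarrow> \<Sum>\<^sub># A = \<Sum>\<^sub># B \<Longrightarrow> set_mset A \<subseteq> X \<Longrightarrow> set_mset B \<subseteq> X \<Longrightarrow> set_mset D \<subseteq> X 
  \<Longrightarrow> exchange X (A + D) (B + D)"
  unfolding exchange_def by (rule exI[of _ A], rule exI[of _ B], rule exI[of _ D]) auto

text \<open>Exchanging \<open>A\<close> for \<open>B\<close> makes the two multisets agree in \<open>B\<close>, which can then be cancelled. All
  points that occur on the way belong to \<open>M\<close> or \<open>M'\<close>.\<close>

lemma exchange_connected_if_conformal:
  fixes X :: "'w::cancel_comm_monoid_add set"
  assumes conf: "\<And>M M'. set_mset M \<subseteq> X \<Longrightarrow> set_mset M' \<subseteq> X \<Longrightarrow> size M = size M' \<Longrightarrow> \<Sum>\<^sub># M = \<Sum>\<^sub># M' \<Longrightarrow> M \<noteq> {#} 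
    \<Longrightarrow> \<exists>A B. A \<subseteq># M \<and> B \<subseteq># M' \<and> A \<noteq> {#} \<and> size A = size B \<and> size A \<le> 3 \<and> \<Sum>\<^sub># A = \<Sum>\<^sub># B"
  shows "exchange_connected X"
  unfolding exchange_connected_def
proof (intro allI impI)
  fix M M' :: "'w multiset"
  assume "set_mset M \<subseteq> X" "set_mset M' \<subseteq> X" "size M = size M'" "\<Sum>\<^sub># M = \<Sum>\<^sub># M'"
  then show "(exchange X)\<^sup>*\<^sup>* M M'"
  proof (induction "size M" arbitrary: M M' rule: less_induct)
    case less
    show ?case
    proof (cases "M = {#}")
      case True then show ?thesis using less.prems by auto
    next
      case False
      then obtain A B where AB: "A \<subseteq># M" "B \<subseteq># M'" "A \<noteq> {#}" "size A = size B" "size A \<le> 3" "\<Sum>\<^sub># A = \<Sum>\<^sub># B"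
        using conf less.prems by metis
      obtain C where C: "M = A + C" using AB by (auto simp: mset_subset_eq_exists_conv)
      obtain D where D: "M' = B + D" using AB by (auto simp: mset_subset_eq_exists_conv)
      have "size C < size M" "size C = size D" "\<Sum>\<^sub># C = \<Sum>\<^sub># D"
        using C D AB less.prems by (auto simp: nonempty_has_size)
      then have "(exchange X)\<^sup>*\<^sup>* C D" using less C D by auto
      then have "(exchange X)\<^sup>*\<^sup>* (C + B) (D + B)" using less.prems D by (intro exchanges_add) auto
      moreover have "exchange X M (C + B)"
        using exchangeI[of A B X C] AB less.prems C D by (auto simp: ac_simps)
      ultimately show ?thesis using D by (auto simp: ac_simps intro: converse_rtranclp_into_rtranclp)
    qed
  qed
qed

lemma sum_mset_apply: "(\<Sum>\<^sub># M) e = (\<Sum>x\<in>#M. x e)"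
  by (induction M) auto

section \<open>Relations between the vertices of a cube\<close>

text \<open>A vertex \<open>ijk\<close> of the cube carries the number \<open>d\<close> of times by which it occurs more often in one
  multiset than in another one with the same size and sum; equivalently, \<open>d\<close> sums to zero over each
  facet. The conclusion runs through the primitive relations of the cube that have \<open>000\<close> on their
  positive side: three squares, three pairs of long diagonals, five cubics. It says that one of them is
  contained in \<open>d\<close> with matching signs, that is, the Graver basis of the cube has degree three.\<close>

lemma cube_graver:
  fixes d000 d001 d010 d011 d100 d101 d110 d111 :: int
  assumes "d000 + d001 + d010 + d011 = 0" "d100 + d101 + d110 + d111 = 0"
    "d000 + d001 + d100 + d101 = 0" "d000 + d010 + d100 + d110 = 0"
    and pos: "d000 > 0"
  shows "(d011 > 0 \<and> d001 < 0 \<and> d010 < 0) \<or> (d101 > 0 \<and> d001 < 0 \<and> d100 < 0) \<or> (d110 > 0 \<and> d010 < 0 \<and> d100 < 0) 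
    \<or> (d111 > 0 \<and> d100 < 0 \<and> d011 < 0) \<or> (d111 > 0 \<and> d010 < 0 \<and> d101 < 0) \<or> (d111 > 0 \<and> d001 < 0 \<and> d110 < 0)
    \<or> (d111 > 1 \<and> d110 < 0 \<and> d101 < 0 \<and> d011 < 0) \<or> (d000 > 1 \<and> d111 > 0 \<and> d100 < 0 \<and> d010 < 0 \<and> d001 < 0)
    \<or> (d110 > 0 \<and> d101 > 0 \<and> d100 < -1 \<and> d011 < 0)
    \<or> (d110 > 0 \<and> d011 > 0 \<and> d010 < -1 \<and> d101 < 0)
    \<or> (d011 > 0 \<and> d101 > 0 \<and> d001 < -1 \<and> d110 < 0)"
  using assms by (smt (verit))

lemma count_sum_bool3:
  fixes N :: "(bool \<times> bool \<times> bool) multiset"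
  shows "size (filter_mset P N) = (if P (True,True,True) then count N (True,True,True) else 0) 
   + (if P (True,True,False) then count N (True,True,False) else 0)
   + (if P (True,False,True) then count N (True,False,True) else 0)
   + (if P (True,False,False) then count N (True,False,False) else 0)
   + (if P (False,True,True) then count N (False,True,True) else 0)
   + (if P (False,True,False) then count N (False,True,False) else 0)
   + (if P (False,False,True) then count N (False,False,True) else 0)
   + (if P (False,False,False) then count N (False,False,False) else 0)"
proof (induction N)
  case (add x N)
  obtain a b c where "x = (a, b, c)" by (cases x)
  then show ?case using add by (cases a; cases b; cases c) auto
qed auto

definition same_marginals :: "(bool \<times> bool \<times> bool) multiset \<Rightarrow> (bool \<times> bool \<times> bool) multiset \<Rightarrow> bool" where
  "same_marginals A B \<longleftrightarrow> size A = size B \<and> size (filter_mset fst A) = size (filter_mset fst B) \<and>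
     size (filter_mset (\<lambda>p. fst (snd p)) A) = size (filter_mset (\<lambda>p. fst (snd p)) B) \<and>
     size (filter_mset (\<lambda>p. snd (snd p)) A) = size (filter_mset (\<lambda>p. snd (snd p)) B)"

lemma distinct_subset_mset:
  "x \<in># N \<Longrightarrow> y \<in># N \<Longrightarrow> x \<noteq> y \<Longrightarrow> {#x, y#} \<subseteq># N"
  "x \<in># N \<Longrightarrow> y \<in># N \<Longrightarrow> z \<in># N \<Longrightarrow> x \<noteq> y \<Longrightarrow> x \<noteq> z \<Longrightarrow> y \<noteq> z \<Longrightarrow> {#x, y, z#} \<subseteq># N"
  "count N x \<ge> 2 \<Longrightarrow> y \<in># N \<Longrightarrow> x \<noteq> y \<Longrightarrow> {#x, x, y#} \<subseteq># N"
  by (auto simp: insert_subset_eq_iff in_diff_count simp flip: count_greater_zero_iff)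

text \<open>Unless the multisets share a vertex, reflect the cube so that a vertex with positive excess becomes
  the origin of \<open>cube_graver\<close>.\<close>

lemma cube_conformal:
  assumes NN: "same_marginals N N'" and ne: "N \<noteq> {#}"
  shows "\<exists>A B. A \<subseteq># N \<and> B \<subseteq># N' \<and> A \<noteq> {#} \<and> size A \<le> 3 \<and> same_marginals A B"
proof (cases "\<exists>p. p \<in># N \<and> p \<in># N'")
  case True
  then obtain p where "p \<in># N" "p \<in># N'" by auto
  then show ?thesis by (intro exI[of _ "{#p#}"]) (auto simp: same_marginals_def)
next
  case False
  define d where "d p = int (count N p) - int (count N' p)" for p
  have dpos: "count N p \<ge> k" if "d p \<ge> int k" for p k using that by (simp add: d_def)
  have dneg: "count N' p \<ge> k" if "d p \<le> - int k" for p k using that by (simp add: d_def)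
  obtain a b c where p: "(a, b, c) \<in># N" using ne by (metis multiset_nonemptyE prod_cases3)
  have "count N (a, b, c) > 0" "(a, b, c) \<notin># N'" using p False by auto
  then have d0: "d (a, b, c) > 0" by (simp add: d_def not_in_iff)
  note e = NN[unfolded same_marginals_def, THEN conjunct1] NN[unfolded same_marginals_def, THEN conjunct2, THEN conjunct1]
    NN[unfolded same_marginals_def, THEN conjunct2, THEN conjunct2, THEN conjunct1] 
    NN[unfolded same_marginals_def, THEN conjunct2, THEN conjunct2, THEN conjunct2]
  have e0: "size (filter_mset (\<lambda>_. True) N) = size (filter_mset (\<lambda>_. True) N')" using e(1) by simp
  note e' = e0[unfolded count_sum_bool3] e(2-4)[unfolded count_sum_bool3]
  have facets: "d (a, b, c) + d (a, b, \<not> c) + d (a, \<not> b, c) + d (a, \<not> b, \<not> c) = 0"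
    "d (\<not> a, b, c) + d (\<not> a, b, \<not> c) + d (\<not> a, \<not> b, c) + d (\<not> a, \<not> b, \<not> c) = 0"
    "d (a, b, c) + d (a, b, \<not> c) + d (\<not> a, b, c) + d (\<not> a, b, \<not> c) = 0"
    "d (a, b, c) + d (a, \<not> b, c) + d (\<not> a, b, c) + d (\<not> a, \<not> b, c) = 0"
    using e' by (cases a; cases b; cases c; simp add: d_def)+
  have quad: ?thesis if "d x > 0" "d y > 0" "d u < 0" "d v < 0" "x \<noteq> y" "u \<noteq> v" "same_marginals {#x, y#} {#u, v#}" for x y u v
  proof -
    have "{#x, y#} \<subseteq># N" "{#u, v#} \<subseteq># N'" 
      using dpos[of 1 x] dpos[of 1 y] dneg[of u 1] dneg[of v 1] that by (auto intro!: distinct_subset_mset)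
    then show ?thesis using that by (intro exI[of _ "{#x, y#}"] exI[of _ "{#u, v#}"]) auto
  qed
  have cubp: ?thesis if "d x > 1" "d y > 0" "d u < 0" "d v < 0" "d w < 0" "x \<noteq> y" "u \<noteq> v" "u \<noteq> w" "v \<noteq> w" 
    "same_marginals {#x, x, y#} {#u, v, w#}" for x y u v w
  proof -
    have "{#x, x, y#} \<subseteq># N" "{#u, v, w#} \<subseteq># N'" 
      using dpos[of 2 x] dpos[of 1 y] dneg[of u 1] dneg[of v 1] dneg[of w 1] that by (auto intro!: distinct_subset_mset)
    then show ?thesis using that by (intro exI[of _ "{#x, x, y#}"] exI[of _ "{#u, v, w#}"]) auto
  qed
  have cubn: ?thesis if "d x < -1" "d y < 0" "d u > 0" "d v > 0" "d w > 0" "x \<noteq> y" "u \<noteq> v" "u \<noteq> w" "v \<noteq> w" 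
    "same_marginals {#u, v, w#} {#x, x, y#}" for x y u v w
  proof -
    have "{#x, x, y#} \<subseteq># N'" "{#u, v, w#} \<subseteq># N" 
      using dneg[of x 2] dneg[of y 1] dpos[of 1 u] dpos[of 1 v] dpos[of 1 w] that by (auto intro!: distinct_subset_mset)
    then show ?thesis using that by (intro exI[of _ "{#u, v, w#}"] exI[of _ "{#x, x, y#}"]) auto
  qed
  note sm = same_marginals_def
  \<comment> \<open>The primitive relations in the order of \<open>cube_graver\<close>, reflected so that 000 becomes \<open>(a, b, c)\<close>.\<close>
  from cube_graver[OF facets d0] show ?thesis
    apply (elim disjE conjE)
    subgoal by (rule quad[of "(a,b,c)" "(a,\<not>b,\<not>c)" "(a,b,\<not>c)" "(a,\<not>b,c)"]; (cases a; cases b; cases c; use d0 in \<open>simp add: sm\<close>))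
    subgoal by (rule quad[of "(a,b,c)" "(\<not>a,b,\<not>c)" "(a,b,\<not>c)" "(\<not>a,b,c)"]; (cases a; cases b; cases c; use d0 in \<open>simp add: sm\<close>))
    subgoal by (rule quad[of "(a,b,c)" "(\<not>a,\<not>b,c)" "(a,\<not>b,c)" "(\<not>a,b,c)"]; (cases a; cases b; cases c; use d0 in \<open>simp add: sm\<close>))
    subgoal by (rule quad[of "(a,b,c)" "(\<not>a,\<not>b,\<not>c)" "(\<not>a,b,c)" "(a,\<not>b,\<not>c)"]; (cases a; cases b; cases c; use d0 in \<open>simp add: sm\<close>))
    subgoal by (rule quad[of "(a,b,c)" "(\<not>a,\<not>b,\<not>c)" "(a,\<not>b,c)" "(\<not>a,b,\<not>c)"]; (cases a; cases b; cases c; use d0 in \<open>simp add: sm\<close>))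
    subgoal by (rule quad[of "(a,b,c)" "(\<not>a,\<not>b,\<not>c)" "(a,b,\<not>c)" "(\<not>a,\<not>b,c)"]; (cases a; cases b; cases c; use d0 in \<open>simp add: sm\<close>))
    subgoal by (rule cubp[of "(\<not>a,\<not>b,\<not>c)" "(a,b,c)" "(\<not>a,\<not>b,c)" "(\<not>a,b,\<not>c)" "(a,\<not>b,\<not>c)"]; (cases a; cases b; cases c; use d0 in \<open>simp add: sm\<close>))
    subgoal by (rule cubp[of "(a,b,c)" "(\<not>a,\<not>b,\<not>c)" "(\<not>a,b,c)" "(a,\<not>b,c)" "(a,b,\<not>c)"]; (cases a; cases b; cases c; use d0 in \<open>simp add: sm\<close>))
    subgoal by (rule cubn[of "(\<not>a,b,c)" "(a,\<not>b,\<not>c)" "(a,b,c)" "(\<not>a,\<not>b,c)" "(\<not>a,b,\<not>c)"]; (cases a; cases b; cases c; use d0 in \<open>simp add: sm\<close>))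
    subgoal by (rule cubn[of "(a,\<not>b,c)" "(\<not>a,b,\<not>c)" "(a,b,c)" "(\<not>a,\<not>b,c)" "(a,\<not>b,\<not>c)"]; (cases a; cases b; cases c; use d0 in \<open>simp add: sm\<close>))
    subgoal by (rule cubn[of "(a,b,\<not>c)" "(\<not>a,\<not>b,c)" "(a,b,c)" "(a,\<not>b,\<not>c)" "(\<not>a,b,\<not>c)"]; (cases a; cases b; cases c; use d0 in \<open>simp add: sm\<close>))
    done
qed

text \<open>The edges \<open>e1\<close>, \<open>e2\<close>, \<open>e3\<close> may coincide. A node with one or two edges is then read as a diagonal
  of the cube, and the result holds for every set \<open>X\<close> of vertices because \<open>cube_conformal\<close> stays within
  the given multisets.\<close>

lemma box_exchange_connected:
  fixes X :: "('e \<Rightarrow> int) set"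
  assumes supp: "\<And>z e. z \<in> X \<Longrightarrow> e \<notin> {e1, e2, e3} \<Longrightarrow> z e = 0"
    and box: "\<And>z e. z \<in> X \<Longrightarrow> e \<in> {e1, e2, e3} \<Longrightarrow> z e \<in> {f e, f e + 1}"
  shows "exchange_connected X"
proof (rule exchange_connected_if_conformal)
  define g where "g z = (z e1 \<noteq> f e1, z e2 \<noteq> f e2, z e3 \<noteq> f e3)" for z :: "'e \<Rightarrow> int"
  have count: "(\<Sum>\<^sub># M) e = int (size M) * f e + int (size (filter_mset P (image_mset g M)))"
    if "\<forall>z\<in>#M. z e = f e + (if P (g z) then 1 else 0)" for M e P
    using that by (induction M) (simp_all add: algebra_simps)
  have sums: "(\<Sum>\<^sub># M) e1 = int (size M) * f e1 + int (size (filter_mset fst (image_mset g M)))"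
    "(\<Sum>\<^sub># M) e2 = int (size M) * f e2 + int (size (filter_mset (\<lambda>p. fst (snd p)) (image_mset g M)))"
    "(\<Sum>\<^sub># M) e3 = int (size M) * f e3 + int (size (filter_mset (\<lambda>p. snd (snd p)) (image_mset g M)))"
    if M: "set_mset M \<subseteq> X" for M
  proof -
    show "(\<Sum>\<^sub># M) e1 = int (size M) * f e1 + int (size (filter_mset fst (image_mset g M)))"
      by (rule count) (use M box[of _ e1] in \<open>auto simp: g_def\<close>)
    show "(\<Sum>\<^sub># M) e2 = int (size M) * f e2 + int (size (filter_mset (\<lambda>p. fst (snd p)) (image_mset g M)))"
      by (rule count) (use M box[of _ e2] in \<open>auto simp: g_def\<close>)
    show "(\<Sum>\<^sub># M) e3 = int (size M) * f e3 + int (size (filter_mset (\<lambda>p. snd (snd p)) (image_mset g M)))"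
      by (rule count) (use M box[of _ e3] in \<open>auto simp: g_def\<close>)
  qed
  have off: "(\<Sum>\<^sub># M) e = 0" if "set_mset M \<subseteq> X" "e \<notin> {e1, e2, e3}" for M e
    using that(1) by (induction M) (simp_all add: supp[OF _ that(2)])
  fix M M' :: "('e \<Rightarrow> int) multiset"
  assume M: "set_mset M \<subseteq> X" "set_mset M' \<subseteq> X" "size M = size M'" "\<Sum>\<^sub># M = \<Sum>\<^sub># M'" "M \<noteq> {#}"
  have "same_marginals (image_mset g M) (image_mset g M')"
    using sums[OF M(1)] sums[OF M(2)] M(3,4) unfolding same_marginals_def by simp
  from cube_conformal[OF this] M(5) obtain A B where AB: "A \<subseteq># image_mset g M" "B \<subseteq># image_mset g M'"
    "A \<noteq> {#}" "size A \<le> 3" "same_marginals A B" by auto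
  obtain A' where A': "A' \<subseteq># M" "A = image_mset g A'"
    using AB(1) by (metis image_mset_eq_plusD mset_subset_eq_exists_conv)
  obtain B' where B': "B' \<subseteq># M'" "B = image_mset g B'"
    using AB(2) by (metis image_mset_eq_plusD mset_subset_eq_exists_conv)
  have AX: "set_mset A' \<subseteq> X" "set_mset B' \<subseteq> X" using set_mset_mono[OF A'(1)] set_mset_mono[OF B'(1)] M(1,2) by auto
  have "(\<Sum>\<^sub># A') e = (\<Sum>\<^sub># B') e" for e
  proof (cases "e \<in> {e1, e2, e3}")
    case True
    moreover have "(\<Sum>\<^sub># A') e1 = (\<Sum>\<^sub># B') e1" "(\<Sum>\<^sub># A') e2 = (\<Sum>\<^sub># B') e2" "(\<Sum>\<^sub># A') e3 = (\<Sum>\<^sub># B') e3"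
      using AB(5) unfolding sums[OF AX(1)] sums[OF AX(2)] same_marginals_def A'(2) B'(2) by simp_all
    ultimately show ?thesis by blast
  next
    case False
    then show ?thesis using off[OF AX(1)] off[OF AX(2)] by simp
  qed
  then have "\<Sum>\<^sub># A' = \<Sum>\<^sub># B'" by auto
  moreover have "size A' = size B'" using AB(5) A' B' by (simp add: same_marginals_def)
  ultimately show "\<exists>A B. A \<subseteq># M \<and> B \<subseteq># M' \<and> A \<noteq> {#} \<and> size A = size B \<and> size A \<le> 3 \<and> \<Sum>\<^sub># A = \<Sum>\<^sub># B"
    using A' B' AB by (intro exI[of _ A'] exI[of _ B']) auto
qed

section \<open>Gluing two systems along one edge\<close>

definition restr :: "'e set \<Rightarrow> ('e \<Rightarrow> int) \<Rightarrow> 'e \<Rightarrow> int" where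
  "restr F z = (\<lambda>e. if e \<in> F then z e else 0)"

definition boxed :: "('e \<Rightarrow> int) \<Rightarrow> 'e set \<Rightarrow> ('e \<Rightarrow> int) set" where
  "boxed f F = {z. (\<forall>e. e \<notin> F \<longrightarrow> z e = 0) \<and> (\<forall>e\<in>F. z e \<in> {f e, f e + 1})}"

text \<open>The fibre product of two systems of partial functions over their common edges.\<close>

definition amalgam :: "'e set \<Rightarrow> ('e \<Rightarrow> int) set \<Rightarrow> 'e set \<Rightarrow> ('e \<Rightarrow> int) set \<Rightarrow> ('e \<Rightarrow> int) set" where
  "amalgam F1 X1 F2 X2 = {z. (\<forall>e. e \<notin> F1 \<union> F2 \<longrightarrow> z e = 0) \<and> restr F1 z \<in> X1 \<and> restr F2 z \<in> X2}"

lemma restr_restr [simp]: "restr F (restr F' z) = restr (F \<inter> F') z"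
  by (auto simp: restr_def)

lemma sum_restr: "(\<Sum>\<^sub># (image_mset (restr F) M)) e = (if e \<in> F then (\<Sum>\<^sub># M) e else 0)"
  by (induction M) (auto simp: restr_def)

lemma two_valued_mset_eq:
  fixes A B :: "int multiset"
  assumes "set_mset A \<subseteq> {c, c + 1}" "set_mset B \<subseteq> {c, c + 1}" "size A = size B" "\<Sum>\<^sub># A = \<Sum>\<^sub># B"
  shows "A = B"
proof -
  have *: "\<Sum>\<^sub># A = int (size A) * c + int (count A (c + 1)) \<and> size A = count A c + count A (c + 1)"
    if "set_mset A \<subseteq> {c, c + 1}" for A
    using that by (induction A) (auto simp: algebra_simps)
  have "count A (c + 1) = count B (c + 1)" "count A c = count B c"
    using *[OF assms(1)] *[OF assms(2)] assms(3,4) by auto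
  moreover have "count A x = 0" "count B x = 0" if "x \<notin> {c, c + 1}" for x
    using that assms(1,2) by (auto simp: count_eq_zero_iff)
  ultimately show ?thesis by (intro multiset_eqI) (metis insertE singletonD)
qed

text \<open>The use of balance: a multiset with only two consecutive values is determined by its size and sum,
  so two balanced halves agree on their common edge, multiplicities included.\<close>

lemma shared_mset_eq:
  assumes F: "F \<subseteq> {e0}" and AB: "\<And>z e. z \<in># A + B \<Longrightarrow> e \<in> F \<Longrightarrow> z e \<in> {f e, f e + 1}"
    and size: "size A = size B" and sum: "\<And>e. e \<in> F \<Longrightarrow> (\<Sum>\<^sub># A) e = (\<Sum>\<^sub># B) e"
  shows "image_mset (restr F) A = image_mset (restr F) B"
proof (cases "e0 \<in> F")
  case False
  then have "F = {}" using F by auto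
  then have "restr F = (\<lambda>z e. 0)" by (intro ext) (simp add: restr_def)
  then show ?thesis using size by (simp add: image_mset_const_eq)
next
  case True
  then have F': "F = {e0}" using F by auto
  have r: "restr F = (\<lambda>v e. if e = e0 then v else 0) \<circ> (\<lambda>z. z e0)" 
    by (intro ext) (simp add: restr_def F')
  have "image_mset (\<lambda>z. z e0) A = image_mset (\<lambda>z. z e0) B"
    using AB[of _ e0] size sum[of e0] True by (intro two_valued_mset_eq[of _ "f e0"]) (auto simp: sum_mset_apply)
  then show ?thesis unfolding r by (metis multiset.map_comp)
qed

lemma merge_msets:
  assumes M1: "set_mset M1 \<subseteq> boxed f F1" and M2: "set_mset M2 \<subseteq> boxed f F2"
    and eq: "image_mset (restr (F1 \<inter> F2)) M1 = image_mset (restr (F1 \<inter> F2)) M2"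
  obtains M where "image_mset (restr F1) M = M1" "image_mset (restr F2) M = M2" "\<And>z e. z \<in># M \<Longrightarrow> e \<notin> F1 \<union> F2 \<Longrightarrow> z e = 0"
proof -
  have "rel_mset (=) (image_mset (restr (F1 \<inter> F2)) M1) (image_mset (restr (F1 \<inter> F2)) M2)"
    using eq by (simp add: multiset.rel_eq)
  then have "rel_mset (\<lambda>x y. restr (F1 \<inter> F2) x = restr (F1 \<inter> F2) y) M1 M2"
    by (simp add: multiset.rel_map)
  then obtain P where P: "\<And>x y. (x, y) \<in># P \<Longrightarrow> restr (F1 \<inter> F2) x = restr (F1 \<inter> F2) y" 
    "image_mset fst P = M1" "image_mset snd P = M2"
    unfolding multiset.in_rel by blast
  define h where "h p = (\<lambda>e. if e \<in> F1 then fst p e else snd p e)" for p :: "('a \<Rightarrow> int) \<times> ('a \<Rightarrow> int)"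
  have h: "restr F1 (h p) = fst p \<and> restr F2 (h p) = snd p \<and> (\<forall>e. e \<notin> F1 \<union> F2 \<longrightarrow> h p e = 0)" if "p \<in># P" for p
  proof -
    have "fst p \<in> boxed f F1" "snd p \<in> boxed f F2" using that P M1 M2 by auto
    then have z: "e \<notin> F1 \<Longrightarrow> fst p e = 0" "e \<notin> F2 \<Longrightarrow> snd p e = 0" for e by (auto simp: boxed_def)
    have eq: "fst p e = snd p e" if "e \<in> F1 \<inter> F2" for e
    proof -
      have "restr (F1 \<inter> F2) (fst p) e = restr (F1 \<inter> F2) (snd p) e" using P(1)[of "fst p" "snd p"] \<open>p \<in># P\<close> by simp
      then show ?thesis using that by (simp add: restr_def)
    qed
    have "restr F1 (h p) e = fst p e" "restr F2 (h p) e = snd p e" "e \<notin> F1 \<union> F2 \<Longrightarrow> h p e = 0" for e 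
      using z[of e] eq[of e] by (auto simp: restr_def h_def)
    then show ?thesis by (intro conjI ext allI impI) auto
  qed
  show ?thesis
  proof (rule that[of "image_mset h P"])
    show "image_mset (restr F1) (image_mset h P) = M1" 
      unfolding P(2)[symmetric] using h by (auto simp: multiset.map_comp intro!: image_mset_cong)
    show "image_mset (restr F2) (image_mset h P) = M2" 
      unfolding P(3)[symmetric] using h by (auto simp: multiset.map_comp intro!: image_mset_cong)
    show "\<And>z e. z \<in># image_mset h P \<Longrightarrow> e \<notin> F1 \<union> F2 \<Longrightarrow> z e = 0" using h by auto
  qed
qed


text \<open>An exchange of first halves preserves the multiset of values on the common edge. The second halves
  of the points given up can therefore be attached to the new first halves.\<close>

lemma lift_exchange:
  assumes X1: "X1 \<subseteq> boxed f F1" and X2: "X2 \<subseteq> boxed f F2" and F: "F1 \<inter> F2 \<subseteq> {e0}"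
    and M: "set_mset M \<subseteq> amalgam F1 X1 F2 X2" and ex: "exchange X1 (image_mset (restr F1) M) N'"
  obtains M' where "exchange (amalgam F1 X1 F2 X2) M M'" "image_mset (restr F1) M' = N'" 
    "image_mset (restr F2) M' = image_mset (restr F2) M"
proof -
  let ?J = "amalgam F1 X1 F2 X2"
  obtain A B D where N: "image_mset (restr F1) M = A + D" "N' = B + D" "size A = size B" "size A \<le> 3" "\<Sum>\<^sub># A = \<Sum>\<^sub># B"
    "set_mset (A + D) \<subseteq> X1" "set_mset N' \<subseteq> X1"
    using ex unfolding exchange_def by metis
  obtain A' D' where A': "M = A' + D'" "A = image_mset (restr F1) A'" "D = image_mset (restr F1) D'"
    using image_mset_eq_plusD[OF N(1)] by auto
  let ?A2 = "image_mset (restr F2) A'"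
  have A2: "set_mset ?A2 \<subseteq> X2" using M A'(1) by (auto simp: amalgam_def)
  have "image_mset (restr (F1 \<inter> F2)) B = image_mset (restr (F1 \<inter> F2)) A"
    using N X1 by (intro shared_mset_eq[OF F, of _ _ f]) (auto simp: boxed_def)
  also have "\<dots> = image_mset (restr (F1 \<inter> F2)) ?A2"
    unfolding A'(2) by (simp add: multiset.map_comp comp_def Int_ac)
  finally have eq: "image_mset (restr (F1 \<inter> F2)) B = image_mset (restr (F1 \<inter> F2)) ?A2" .
  obtain B' where B': "image_mset (restr F1) B' = B" "image_mset (restr F2) B' = ?A2" "\<And>z e. z \<in># B' \<Longrightarrow> e \<notin> F1 \<union> F2 \<Longrightarrow> z e = 0"
  proof (rule merge_msets[OF _ _ eq])
    show "set_mset B \<subseteq> boxed f F1" "set_mset ?A2 \<subseteq> boxed f F2" using N X1 X2 A2 by auto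
  qed blast
  have B'J: "set_mset B' \<subseteq> ?J"
  proof
    fix z assume z: "z \<in># B'"
    then have "restr F1 z \<in># image_mset (restr F1) B'" "restr F2 z \<in># image_mset (restr F2) B'" by auto
    then have "restr F1 z \<in># B" "restr F2 z \<in># ?A2" using B'(1,2) by simp_all
    then show "z \<in> ?J" using B'(3)[OF z] N(6) N(7) A2 unfolding N(2) amalgam_def by fastforce
  qed
  have A'J: "set_mset A' \<subseteq> ?J" "set_mset D' \<subseteq> ?J" using M A' by auto
  have "(\<Sum>\<^sub># A') e = (\<Sum>\<^sub># B') e" for e
  proof -
    consider "e \<in> F1" | "e \<in> F2" | "e \<notin> F1 \<union> F2" by auto
    then show ?thesis
    proof cases
      case 1 
      then show ?thesis using sum_restr[of F1 A' e] sum_restr[of F1 B' e] N(5) A'(2) B'(1) by simp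
    next
      case 2
      then show ?thesis using sum_restr[of F2 A' e] sum_restr[of F2 B' e] B'(2) by simp
    next
      case 3
      have "(\<Sum>\<^sub># C) e = 0" if "set_mset C \<subseteq> ?J" for C 
        using that 3 by (induction C) (auto simp: amalgam_def)
      then show ?thesis using A'J B'J by simp
    qed
  qed
  moreover have "size A' = size B'" using N(3) A'(2) B'(1) by (metis size_image_mset)
  ultimately have "exchange ?J (A' + D') (B' + D')"
    using N(4) A'(2) A'J B'J by (intro exchangeI) auto
  then show ?thesis using that[of "B' + D'"] A' B'(1,2) N(2) by simp
qed

lemma lift_exchanges:
  assumes X1: "X1 \<subseteq> boxed f F1" and X2: "X2 \<subseteq> boxed f F2" and F: "F1 \<inter> F2 \<subseteq> {e0}"
    and M: "set_mset M \<subseteq> amalgam F1 X1 F2 X2" and ex: "(exchange X1)\<^sup>*\<^sup>* (image_mset (restr F1) M) N'"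
  shows "\<exists>M'. (exchange (amalgam F1 X1 F2 X2))\<^sup>*\<^sup>* M M' \<and> image_mset (restr F1) M' = N' \<and>
    image_mset (restr F2) M' = image_mset (restr F2) M"
  using ex
proof induction
  case base
  then show ?case by blast
next
  case (step N N')
  then obtain M' where M': "(exchange (amalgam F1 X1 F2 X2))\<^sup>*\<^sup>* M M'" "image_mset (restr F1) M' = N"
    "image_mset (restr F2) M' = image_mset (restr F2) M" by blast
  have "set_mset M' \<subseteq> amalgam F1 X1 F2 X2" using exchanges_invariant(3)[OF M'(1) M] .
  then obtain M'' where "exchange (amalgam F1 X1 F2 X2) M' M''" "image_mset (restr F1) M'' = N'" 
    "image_mset (restr F2) M'' = image_mset (restr F2) M'"
    using lift_exchange[OF X1 X2 F, of M' N'] step(2) M'(2) by blast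
  then show ?case using M' by (intro exI[of _ M'']) (auto intro: rtranclp.rtrancl_into_rtrancl)
qed

lemma amalgam_commute: "amalgam F1 X1 F2 X2 = amalgam F2 X2 F1 X1"
  by (auto simp: amalgam_def)

lemma amalgam_eqI:
  assumes "z \<in> amalgam F1 X1 F2 X2" "z' \<in> amalgam F1 X1 F2 X2" "restr F1 z = restr F1 z'" "restr F2 z = restr F2 z'"
  shows "z = z'"
proof
  fix e
  consider "e \<in> F1" | "e \<in> F2" | "e \<notin> F1 \<union> F2" by auto
  then show "z e = z' e"
  proof cases
    case 1 then show ?thesis using fun_cong[OF assms(3), of e] by (simp add: restr_def)
  next
    case 2 then show ?thesis using fun_cong[OF assms(4), of e] by (simp add: restr_def)
  next
    case 3 then show ?thesis using assms(1,2) by (simp add: amalgam_def)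
  qed
qed

text \<open>Multisets with the same halves differ only in how the halves are combined. Two points that agree
  on the common edge may swap their second halves, which is an exchange of two points; one swap
  produces any prescribed point of \<open>M'\<close>.\<close>

lemma swap_halves:
  fixes X1 X2 :: "('e \<Rightarrow> int) set"
  assumes "set_mset M \<subseteq> amalgam F1 X1 F2 X2" "set_mset M' \<subseteq> amalgam F1 X1 F2 X2"
    "image_mset (restr F1) M = image_mset (restr F1) M'" "image_mset (restr F2) M = image_mset (restr F2) M'"
  shows "(exchange (amalgam F1 X1 F2 X2))\<^sup>*\<^sup>* M M'"
  using assms
proof (induction "size M'" arbitrary: M M')
  case 0
  then show ?case by simp
next
  case (Suc n)
  let ?J = "amalgam F1 X1 F2 X2"
  obtain z C where C: "M' = add_mset z C" using Suc(2) by (metis size_eq_Suc_imp_eq_union)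
  have step: ?case if "M = add_mset z D" for D
  proof -
    have "(exchange ?J)\<^sup>*\<^sup>* D C" using Suc C that by auto
    then have "(exchange ?J)\<^sup>*\<^sup>* (D + {#z#}) (C + {#z#})" using Suc.prems C by (intro exchanges_add) auto
    then show ?thesis using C that by simp
  qed
  show ?case
  proof (cases "z \<in># M")
    case True
    then show ?thesis using step by (metis insert_DiffM)
  next
    case False
    have "restr F1 z \<in># image_mset (restr F1) M" "restr F2 z \<in># image_mset (restr F2) M"
      using Suc.prems(3,4) C by auto
    then obtain a b where ab: "a \<in># M" "restr F1 a = restr F1 z" "b \<in># M" "restr F2 b = restr F2 z" by auto
    have zJ: "z \<in> ?J" and aJ: "a \<in> ?J" and bJ: "b \<in> ?J" using Suc.prems C ab by auto
    have "a \<noteq> b" using ab False amalgam_eqI[OF aJ zJ] by auto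
    then have "{#a, b#} \<subseteq># M" using ab by (intro distinct_subset_mset)
    then obtain D where D: "M = {#a, b#} + D" by (auto simp: mset_subset_eq_exists_conv)
    \<comment> \<open>The halves of \<open>a\<close> and \<open>b\<close> that \<open>z\<close> leaves over.\<close>
    define w where "w e = (if e \<in> F1 then b e else a e)" for e
    have pt: "e \<in> F1 \<Longrightarrow> a e = z e" "e \<in> F2 \<Longrightarrow> b e = z e" for e 
      using fun_cong[OF ab(2), of e] fun_cong[OF ab(4), of e] by (auto simp: restr_def)
    have w: "restr F1 w = restr F1 b" "restr F2 w = restr F2 a"
      by (intro ext; use pt in \<open>simp add: restr_def w_def\<close>)+
    have "w e = 0" if "e \<notin> F1 \<union> F2" for e using that aJ by (simp add: amalgam_def w_def)
    then have wJ: "w \<in> ?J" using aJ bJ unfolding amalgam_def mem_Collect_eq w by blast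
    have sum: "\<Sum>\<^sub># {#a, b#} = \<Sum>\<^sub># {#z, w#}"
    proof
      fix e show "(\<Sum>\<^sub># {#a, b#}) e = (\<Sum>\<^sub># {#z, w#}) e"
      proof -
        have "e \<notin> F1 \<Longrightarrow> e \<notin> F2 \<Longrightarrow> a e = 0 \<and> b e = 0 \<and> z e = 0" using aJ bJ zJ by (simp add: amalgam_def)
        then show ?thesis using pt[of e] by (cases "e \<in> F1"; cases "e \<in> F2") (simp_all add: w_def)
      qed
    qed
    have DJ: "set_mset D \<subseteq> ?J" using Suc.prems D by auto
    have ex: "exchange ?J M ({#z, w#} + D)"
      unfolding D using aJ bJ zJ wJ DJ sum by (intro exchangeI) auto
    have "(exchange ?J)\<^sup>*\<^sup>* (add_mset w D) C"
    proof (rule Suc(1))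
      show "n = size C" using Suc(2) C by simp
      show "set_mset (add_mset w D) \<subseteq> ?J" "set_mset C \<subseteq> ?J" using DJ wJ Suc.prems C by auto
      show "image_mset (restr F1) (add_mset w D) = image_mset (restr F1) C"
        using Suc.prems(3) D C ab(2) w(1) by simp
      show "image_mset (restr F2) (add_mset w D) = image_mset (restr F2) C"
        using Suc.prems(4) D C ab(4) w(2) by (simp add: add_mset_commute)
    qed
    then have "(exchange ?J)\<^sup>*\<^sup>* (add_mset w D + {#z#}) (C + {#z#})" using zJ by (intro exchanges_add) auto
    then have "(exchange ?J)\<^sup>*\<^sup>* ({#z, w#} + D) M'" using C by simp
    with ex show ?thesis by (rule converse_rtranclp_into_rtranclp)
  qed
qed

lemma exchange_connected_amalgam:
  assumes X1: "X1 \<subseteq> boxed f F1" and X2: "X2 \<subseteq> boxed f F2" and F: "F1 \<inter> F2 \<subseteq> {e0}"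
    and c1: "exchange_connected X1" and c2: "exchange_connected X2"
  shows "exchange_connected (amalgam F1 X1 F2 X2)"
  unfolding exchange_connected_def
proof (intro allI impI)
  let ?J = "amalgam F1 X1 F2 X2"
  fix M M' assume M: "set_mset M \<subseteq> ?J" "set_mset M' \<subseteq> ?J" "size M = size M'" "\<Sum>\<^sub># M = \<Sum>\<^sub># M'"
  have sub: "set_mset (image_mset (restr F1) M) \<subseteq> X1" "set_mset (image_mset (restr F2) M) \<subseteq> X2" if "set_mset M \<subseteq> ?J" for M
    using that by (auto simp: amalgam_def)
  have sums: "\<Sum>\<^sub># (image_mset (restr F) M) = \<Sum>\<^sub># (image_mset (restr F) M')" if "\<Sum>\<^sub># M = \<Sum>\<^sub># M'" for F and M M' :: "('a \<Rightarrow> int) multiset"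
    using that by (intro ext) (simp add: sum_restr)
  have "(exchange X1)\<^sup>*\<^sup>* (image_mset (restr F1) M) (image_mset (restr F1) M')"
    using c1[unfolded exchange_connected_def, rule_format, OF sub(1)[OF M(1)] sub(1)[OF M(2)] _ sums[OF M(4)]] M(3) by simp
  from lift_exchanges[OF X1 X2 F M(1) this]
  obtain N where N: "(exchange ?J)\<^sup>*\<^sup>* M N" "image_mset (restr F1) N = image_mset (restr F1) M'" by blast
  note iN = exchanges_invariant[OF N(1) M(1)]
  have "(exchange X2)\<^sup>*\<^sup>* (image_mset (restr F2) N) (image_mset (restr F2) M')"
    using c2[unfolded exchange_connected_def, rule_format, OF sub(2)[OF iN(3)] sub(2)[OF M(2)] _ sums[OF iN(2)[unfolded M(4)]]] M(3) iN(1) by simp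
  moreover have "F2 \<inter> F1 \<subseteq> {e0}" using F by auto
  ultimately obtain N' where N': "(exchange ?J)\<^sup>*\<^sup>* N N'" "image_mset (restr F2) N' = image_mset (restr F2) M'"
     "image_mset (restr F1) N' = image_mset (restr F1) N"
    using lift_exchanges[OF X2 X1, of e0 N] iN(3) unfolding amalgam_commute[of F2] by blast
  have "(exchange ?J)\<^sup>*\<^sup>* N' M'"
    using exchanges_invariant(3)[OF N'(1) iN(3)] M N N' by (intro swap_halves) auto
  then show "(exchange ?J)\<^sup>*\<^sup>* M M'" using N(1) N'(1) by auto
qed

section \<open>Peeling off one summand at a node\<close>

text \<open>The four inequalities bound the distance from the odd vertices \<open>100\<close>, \<open>010\<close>, \<open>001\<close>, \<open>111\<close>; the flags tell
  which of these vertices are cut off. With all four flags the lemma fails for \<open>t = (1, 1, 1)\<close> and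
  \<open>m = 2\<close>.\<close>

lemma cube_peel_even:
  fixes t1 t2 t3 m :: int
  assumes m: "m \<ge> 1" and t: "0 \<le> t1" "t1 \<le> m" "0 \<le> t2" "t2 \<le> m" "0 \<le> t3" "t3 \<le> m"
    and c: "B1 \<longrightarrow> t1 \<le> t2 + t3" "B2 \<longrightarrow> t2 \<le> t1 + t3" "B3 \<longrightarrow> t3 \<le> t1 + t2" "B0 \<longrightarrow> t1 + t2 + t3 \<le> 2 * m"
    and B: "\<not> (B0 \<and> B1 \<and> B2 \<and> B3)"
  shows "\<exists>s1 s2 s3. s1 \<in> {0,1} \<and> s2 \<in> {0,1} \<and> s3 \<in> {0,1} \<and>
     0 \<le> t1 - s1 \<and> t1 - s1 \<le> m - 1 \<and> 0 \<le> t2 - s2 \<and> t2 - s2 \<le> m - 1 \<and> 0 \<le> t3 - s3 \<and> t3 - s3 \<le> m - 1 \<and>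
     (B1 \<longrightarrow> s1 \<le> s2 + s3 \<and> t1 - s1 \<le> (t2 - s2) + (t3 - s3)) \<and> 
     (B2 \<longrightarrow> s2 \<le> s1 + s3 \<and> t2 - s2 \<le> (t1 - s1) + (t3 - s3)) \<and> 
     (B3 \<longrightarrow> s3 \<le> s1 + s2 \<and> t3 - s3 \<le> (t1 - s1) + (t2 - s2)) \<and> 
     (B0 \<longrightarrow> s1 + s2 + s3 \<le> 2 \<and> (t1 - s1) + (t2 - s2) + (t3 - s3) \<le> 2 * (m - 1))"
    (is "\<exists>s1 s2 s3. ?P s1 s2 s3")
proof -
  have "?P 0 0 0 \<or> ?P 1 0 0 \<or> ?P 0 1 0 \<or> ?P 0 0 1 \<or> ?P 1 1 0 \<or> ?P 1 0 1 \<or> ?P 0 1 1 \<or> ?P 1 1 1"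
    using assms by (smt (verit) insertCI)
  then show ?thesis by blast
qed

text \<open>Here the remaining vertices are \<open>011\<close> and its neighbours, or with \<open>B0\<close> just \<open>010\<close> and \<open>001\<close>.\<close>

lemma cube_peel_odd:
  fixes t1 t2 t3 m :: int
  assumes m: "m \<ge> 1" and t: "0 \<le> t1" "t1 \<le> m" "0 \<le> t2" "t2 \<le> m" "0 \<le> t3" "t3 \<le> m"
    and c: "t1 + m \<le> t2 + t3" "B0 \<longrightarrow> t1 + t2 + t3 \<le> m"
  shows "\<exists>s1 s2 s3. s1 \<in> {0,1} \<and> s2 \<in> {0,1} \<and> s3 \<in> {0,1} \<and>
     0 \<le> t1 - s1 \<and> t1 - s1 \<le> m - 1 \<and> 0 \<le> t2 - s2 \<and> t2 - s2 \<le> m - 1 \<and> 0 \<le> t3 - s3 \<and> t3 - s3 \<le> m - 1 \<and>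
     s1 + 1 \<le> s2 + s3 \<and> (t1 - s1) + (m - 1) \<le> (t2 - s2) + (t3 - s3) \<and> 
     (B0 \<longrightarrow> s1 + s2 + s3 \<le> 1 \<and> (t1 - s1) + (t2 - s2) + (t3 - s3) \<le> m - 1)"
    (is "\<exists>s1 s2 s3. ?P s1 s2 s3")
proof -
  consider "t1 > 0" | "t1 = 0" "t2 + t3 > m" | "t1 = 0" "t2 + t3 = m" "t2 > 0" | "t1 = 0" "t2 = 0" "t3 = m"
    using assms by linarith
  then have "?P 1 1 1 \<or> ?P 0 1 1 \<or> ?P 0 1 0 \<or> ?P 0 0 1"
    by cases (use assms in auto)
  then show ?thesis by blast
qed

lemma cube_peel_corner:
  fixes t1 t2 t3 m :: int
  assumes m: "m \<ge> 1" and t: "0 \<le> t1" "0 \<le> t2" "0 \<le> t3" "t1 + t2 + t3 \<le> m"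
  shows "\<exists>s1 s2 s3. s1 \<in> {0,1} \<and> s2 \<in> {0,1} \<and> s3 \<in> {0,1} \<and>
     0 \<le> t1 - s1 \<and> t1 - s1 \<le> m - 1 \<and> 0 \<le> t2 - s2 \<and> t2 - s2 \<le> m - 1 \<and> 0 \<le> t3 - s3 \<and> t3 - s3 \<le> m - 1 \<and>
     s1 + s2 + s3 \<le> 1 \<and> (t1 - s1) + (t2 - s2) + (t3 - s3) \<le> m - 1"
    (is "\<exists>s1 s2 s3. ?P s1 s2 s3")
proof -
  consider "t1 > 0" | "t2 > 0" | "t3 > 0" | "t1 = 0" "t2 = 0" "t3 = 0"
    using t by linarith
  then have "?P 1 0 0 \<or> ?P 0 1 0 \<or> ?P 0 0 1 \<or> ?P 0 0 0"
    by cases (use assms in auto)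
  then show ?thesis by blast
qed

text \<open>Splitting one summand off a lattice point at a trinode. The point is \<open>m f + t\<close> with integer parts
  \<open>f\<close>; the summand is \<open>f + s\<close>, and \<open>c0\<close>, \<open>c1\<close>, \<open>c2\<close>, \<open>c3\<close> are what the four inequalities at level one
  leave for \<open>s\<close>. They have the same parity. If they are even, each inequality
  cuts off at most an odd vertex, unless it leaves a single vertex; if they are odd, at most two of them
  matter. The sum of the four is \<open>2L\<close>, so \<open>L > 1\<close> enters as the last hypothesis and excludes that all
  four odd vertices are cut off.\<close>

lemma cube_peel:
  fixes t1 t2 t3 m c0 c1 c2 c3 g1 g2 g3 h :: int
  assumes m: "m \<ge> 1" and t: "0 \<le> t1" "t1 \<le> m" "0 \<le> t2" "t2 \<le> m" "0 \<le> t3" "t3 \<le> m"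
    and c: "t1 - t2 - t3 \<le> m * c1" "t2 - t1 - t3 \<le> m * c2" "t3 - t1 - t2 \<le> m * c3" "t1 + t2 + t3 \<le> m * c0"
    and odd_indicator: "c1 + c2 = 2 * g3" "c1 + c3 = 2 * g2" "c2 + c3 = 2 * g1" "c0 + c1 = 2 * h"
    and nn: "g1 \<ge> 0" "g2 \<ge> 0" "g3 \<ge> 0" "c0 + c1 \<ge> 0" "c0 + c2 \<ge> 0" "c0 + c3 \<ge> 0" 
    and L: "c0 + c1 + c2 + c3 \<ge> 4"
  shows "\<exists>s1 s2 s3. (s1 \<in> {0,1} \<and> s2 \<in> {0,1} \<and> s3 \<in> {0,1} \<and>
     0 \<le> t1 - s1 \<and> t1 - s1 \<le> m - 1 \<and> 0 \<le> t2 - s2 \<and> t2 - s2 \<le> m - 1 \<and> 0 \<le> t3 - s3 \<and> t3 - s3 \<le> m - 1) \<and>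
     (s1 - s2 - s3 \<le> c1 \<and> s2 - s1 - s3 \<le> c2 \<and> s3 - s1 - s2 \<le> c3 \<and> s1 + s2 + s3 \<le> c0 \<and>
     (t1-s1) - (t2-s2) - (t3-s3) \<le> (m-1) * c1 \<and> (t2-s2) - (t1-s1) - (t3-s3) \<le> (m-1) * c2 \<and> 
     (t3-s3) - (t1-s1) - (t2-s2) \<le> (m-1) * c3 \<and> (t1-s1) + (t2-s2) + (t3-s3) \<le> (m-1) * c0)"
    (is "\<exists>s1 s2 s3. ?B s1 s2 s3 \<and> ?C s1 s2 s3")
proof -
  have mc1: "(m-1) * c \<ge> (m-1) * k" if "c \<ge> k" for c k :: int using that m by (simp add: mult_left_mono)
  define q where "q c = (m-1) * c" for c
  have q1: "q c \<ge> m - 1" if "c \<ge> 1" for c using mc1[OF that] by (simp add: q_def)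
  have q3: "q c \<ge> 3 * m - 3" if "c \<ge> 3" for c using mc1[OF that] by (simp add: q_def)
  have low: "k \<ge> -2" if "x \<le> m * k" "x \<ge> -2 * m" for x k :: int
  proof (rule ccontr)
    assume "\<not> ?thesis" then have "m * k \<le> m * (-3)" using m by (intro mult_left_mono) auto
    then show False using that m by linarith
  qed
  have lows: "c1 \<ge> -2" "c2 \<ge> -2" "c3 \<ge> -2"
    using low[OF c(1)] low[OF c(2)] low[OF c(3)] t by linarith+
  have "c0 \<ge> 0"
  proof (rule ccontr)
    assume "\<not> ?thesis" then have "m * c0 \<le> m * (-1)" using m by (intro mult_left_mono) auto
    then show False using t c m by linarith
  qed
  consider (z) "c0 = 0" | (e1) "c1 = -2" | (e2) "c2 = -2" | (e3) "c3 = -2" | (o1) "c1 = -1" | (o2) "c2 = -1" | (o3) "c3 = -1"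
    | (corner) "c0 = 1" "c1 \<ge> 0" "c2 \<ge> 0" "c3 \<ge> 0" | (even) "c0 \<ge> 2" "c1 \<ge> 0" "c2 \<ge> 0" "c3 \<ge> 0" 
    using lows \<open>c0 \<ge> 0\<close> by linarith
  then show ?thesis
  proof cases
    case z
    then have "t1 = 0" "t2 = 0" "t3 = 0" using t c by auto
    then show ?thesis using z nn m mc1[of 0] by (intro exI[of _ 0]) auto
  next
    case e1
    then have "t1 = 0" "t2 = m" "t3 = m" "c2 \<ge> 2" "c3 \<ge> 2" "c0 \<ge> 2" using t c odd_indicator nn m by auto
    then have "?B 0 1 1 \<and> ?C 0 1 1" using e1 m mc1[of 2 c2] mc1[of 2 c3] mc1[of 2 c0] by simp
    then show ?thesis by blast
  next
    case e2
    then have "t2 = 0" "t1 = m" "t3 = m" "c1 \<ge> 2" "c3 \<ge> 2" "c0 \<ge> 2" using t c odd_indicator nn m by auto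
    then have "?B 1 0 1 \<and> ?C 1 0 1" using e2 m mc1[of 2 c1] mc1[of 2 c3] mc1[of 2 c0] by simp
    then show ?thesis by blast
  next
    case e3
    then have "t3 = 0" "t1 = m" "t2 = m" "c1 \<ge> 2" "c2 \<ge> 2" "c0 \<ge> 2" using t c odd_indicator nn m by auto
    then have "?B 1 1 0 \<and> ?C 1 1 0" using e3 m mc1[of 2 c1] mc1[of 2 c2] mc1[of 2 c0] by simp
    then show ?thesis by blast
  next
    case o1
    note c1 = o1
    have o: "c2 \<ge> 1" "c3 \<ge> 1" "c0 \<ge> 1" using nn odd_indicator c1 by linarith+
    moreover have "c0 \<noteq> 2" using c1 odd_indicator(4) by presburger
    ultimately have o0: "c0 = 1 \<or> c0 \<ge> 3" by linarith
    have "\<exists>s1 s2 s3. s1 \<in> {0,1} \<and> s2 \<in> {0,1} \<and> s3 \<in> {0,1} \<and>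
      0 \<le> t1 - s1 \<and> t1 - s1 \<le> m - 1 \<and> 0 \<le> t2 - s2 \<and> t2 - s2 \<le> m - 1 \<and> 0 \<le> t3 - s3 \<and> t3 - s3 \<le> m - 1 \<and>
      s1 + 1 \<le> s2 + s3 \<and> (t1 - s1) + (m - 1) \<le> (t2 - s2) + (t3 - s3) \<and> 
      (c0 = 1 \<longrightarrow> s1 + s2 + s3 \<le> 1 \<and> (t1 - s1) + (t2 - s2) + (t3 - s3) \<le> m - 1)"
      using c t m c1 by (intro cube_peel_odd) auto
    then obtain s1 s2 s3 where s: "?B s1 s2 s3" "s1 + 1 \<le> s2 + s3"
       "(t1 - s1) + (m - 1) \<le> (t2 - s2) + (t3 - s3)"
       "c0 = 1 \<longrightarrow> s1 + s2 + s3 \<le> 1 \<and> (t1 - s1) + (t2 - s2) + (t3 - s3) \<le> m - 1" by blast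
    have b: "0 \<le> s1" "s1 \<le> 1" "0 \<le> s2" "s2 \<le> 1" "0 \<le> s3" "s3 \<le> 1" 
      "0 \<le> t1 - s1" "t1 - s1 \<le> m - 1" "0 \<le> t2 - s2" "t2 - s2 \<le> m - 1" "0 \<le> t3 - s3" "t3 - s3 \<le> m - 1"
      using s(1) by auto
    have e: "q c1 = -(m-1)" using c1 by (simp add: q_def)
    have "s1 + s2 + s3 \<le> c0 \<and> (t1-s1) + (t2-s2) + (t3-s3) \<le> (m-1) * c0" using o0
    proof
      assume "c0 = 1" then show ?thesis using s(4) by simp
    next
      assume c3: "c0 \<ge> 3" then show ?thesis using q3[OF c3] b unfolding q_def[symmetric] by - (intro conjI; linarith)
    qed
    then have "?C s1 s2 s3" using b s(2,3) q1[OF o(1)] q1[OF o(2)] o e c1 unfolding q_def[symmetric] by - (elim conjE, intro conjI; linarith)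
    with s(1) show ?thesis by blast
  next
    case o2
    note c2 = o2
    have o: "c1 \<ge> 1" "c3 \<ge> 1" "c0 \<ge> 1" using nn odd_indicator c2 by linarith+
    moreover have "c0 \<noteq> 2" using c2 odd_indicator(1) odd_indicator(4) by presburger
    ultimately have o0: "c0 = 1 \<or> c0 \<ge> 3" by linarith
    have "\<exists>s2 s1 s3. s2 \<in> {0,1} \<and> s1 \<in> {0,1} \<and> s3 \<in> {0,1} \<and>
      0 \<le> t2 - s2 \<and> t2 - s2 \<le> m - 1 \<and> 0 \<le> t1 - s1 \<and> t1 - s1 \<le> m - 1 \<and> 0 \<le> t3 - s3 \<and> t3 - s3 \<le> m - 1 \<and>
      s2 + 1 \<le> s1 + s3 \<and> (t2 - s2) + (m - 1) \<le> (t1 - s1) + (t3 - s3) \<and> 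
      (c0 = 1 \<longrightarrow> s2 + s1 + s3 \<le> 1 \<and> (t2 - s2) + (t1 - s1) + (t3 - s3) \<le> m - 1)"
      using c t m c2 by (intro cube_peel_odd) auto
    then obtain s1 s2 s3 where s: "?B s1 s2 s3" "s2 + 1 \<le> s1 + s3"
       "(t2 - s2) + (m - 1) \<le> (t1 - s1) + (t3 - s3)"
       "c0 = 1 \<longrightarrow> s2 + s1 + s3 \<le> 1 \<and> (t2 - s2) + (t1 - s1) + (t3 - s3) \<le> m - 1" by blast
    have b: "0 \<le> s1" "s1 \<le> 1" "0 \<le> s2" "s2 \<le> 1" "0 \<le> s3" "s3 \<le> 1" 
      "0 \<le> t1 - s1" "t1 - s1 \<le> m - 1" "0 \<le> t2 - s2" "t2 - s2 \<le> m - 1" "0 \<le> t3 - s3" "t3 - s3 \<le> m - 1"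
      using s(1) by auto
    have e: "q c2 = -(m-1)" using c2 by (simp add: q_def)
    have "s1 + s2 + s3 \<le> c0 \<and> (t1-s1) + (t2-s2) + (t3-s3) \<le> (m-1) * c0" using o0
    proof
      assume "c0 = 1" then show ?thesis using s(4) by simp
    next
      assume c3: "c0 \<ge> 3" then show ?thesis using q3[OF c3] b unfolding q_def[symmetric] by - (intro conjI; linarith)
    qed
    then have "?C s1 s2 s3" using b s(2,3) q1[OF o(1)] q1[OF o(2)] o e c2 unfolding q_def[symmetric] by - (elim conjE, intro conjI; linarith)
    with s(1) show ?thesis by blast
  next
    case o3
    note c3 = o3
    have o: "c1 \<ge> 1" "c2 \<ge> 1" "c0 \<ge> 1" using nn odd_indicator c3 by linarith+
    moreover have "c0 \<noteq> 2" using c3 odd_indicator(2) odd_indicator(4) by presburger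
    ultimately have o0: "c0 = 1 \<or> c0 \<ge> 3" by linarith
    have "\<exists>s3 s1 s2. s3 \<in> {0,1} \<and> s1 \<in> {0,1} \<and> s2 \<in> {0,1} \<and>
      0 \<le> t3 - s3 \<and> t3 - s3 \<le> m - 1 \<and> 0 \<le> t1 - s1 \<and> t1 - s1 \<le> m - 1 \<and> 0 \<le> t2 - s2 \<and> t2 - s2 \<le> m - 1 \<and>
      s3 + 1 \<le> s1 + s2 \<and> (t3 - s3) + (m - 1) \<le> (t1 - s1) + (t2 - s2) \<and> 
      (c0 = 1 \<longrightarrow> s3 + s1 + s2 \<le> 1 \<and> (t3 - s3) + (t1 - s1) + (t2 - s2) \<le> m - 1)"
      using c t m c3 by (intro cube_peel_odd) auto
    then obtain s1 s2 s3 where s: "?B s1 s2 s3" "s3 + 1 \<le> s1 + s2"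
       "(t3 - s3) + (m - 1) \<le> (t1 - s1) + (t2 - s2)"
       "c0 = 1 \<longrightarrow> s3 + s1 + s2 \<le> 1 \<and> (t3 - s3) + (t1 - s1) + (t2 - s2) \<le> m - 1" by blast
    have b: "0 \<le> s1" "s1 \<le> 1" "0 \<le> s2" "s2 \<le> 1" "0 \<le> s3" "s3 \<le> 1" 
      "0 \<le> t1 - s1" "t1 - s1 \<le> m - 1" "0 \<le> t2 - s2" "t2 - s2 \<le> m - 1" "0 \<le> t3 - s3" "t3 - s3 \<le> m - 1"
      using s(1) by auto
    have e: "q c3 = -(m-1)" using c3 by (simp add: q_def)
    have "s1 + s2 + s3 \<le> c0 \<and> (t1-s1) + (t2-s2) + (t3-s3) \<le> (m-1) * c0" using o0
    proof
      assume "c0 = 1" then show ?thesis using s(4) by simp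
    next
      assume c3: "c0 \<ge> 3" then show ?thesis using q3[OF c3] b unfolding q_def[symmetric] by - (intro conjI; linarith)
    qed
    then have "?C s1 s2 s3" using b s(2,3) q1[OF o(1)] q1[OF o(2)] o e c3 unfolding q_def[symmetric] by - (elim conjE, intro conjI; linarith)
    with s(1) show ?thesis by blast
  next
    case corner
    have "c1 \<noteq> 0" using corner(1) odd_indicator(4) by presburger
    moreover have "c2 \<noteq> 0" using corner(1) odd_indicator(1,4) by presburger
    moreover have "c3 \<noteq> 0" using corner(1) odd_indicator(2,4) by presburger
    ultimately have o: "c1 \<ge> 1" "c2 \<ge> 1" "c3 \<ge> 1" using corner by linarith+
    obtain s1 s2 s3 where s: "?B s1 s2 s3" "s1 + s2 + s3 \<le> 1" "(t1 - s1) + (t2 - s2) + (t3 - s3) \<le> m - 1"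
      using cube_peel_corner[of m t1 t2 t3] c t m corner by auto
    have b: "0 \<le> s1" "s1 \<le> 1" "0 \<le> s2" "s2 \<le> 1" "0 \<le> s3" "s3 \<le> 1" 
      "0 \<le> t1 - s1" "t1 - s1 \<le> m - 1" "0 \<le> t2 - s2" "t2 - s2 \<le> m - 1" "0 \<le> t3 - s3" "t3 - s3 \<le> m - 1"
      using s(1) by auto
    have e: "q c0 = m-1" using corner by (simp add: q_def)
    have "?C s1 s2 s3" using b s(2,3) o q1[OF o(1)] q1[OF o(2)] q1[OF o(3)] e corner(1) unfolding q_def[symmetric] by - (intro conjI; linarith)
    with s(1) show ?thesis by blast
  next
    case even
    have o: "c0 = 2 \<or> c0 \<ge> 3" "c1 = 0 \<or> c1 \<ge> 1" "c2 = 0 \<or> c2 \<ge> 1" "c3 = 0 \<or> c3 \<ge> 1" using even by auto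
    have B: "\<not> (c0 = 2 \<and> c1 = 0 \<and> c2 = 0 \<and> c3 = 0)" using L by auto
    have c': "c1 = 0 \<longrightarrow> t1 \<le> t2 + t3" "c2 = 0 \<longrightarrow> t2 \<le> t1 + t3" "c3 = 0 \<longrightarrow> t3 \<le> t1 + t2"
      "c0 = 2 \<longrightarrow> t1 + t2 + t3 \<le> 2 * m" using c by auto
    obtain s1 s2 s3 where s: "?B s1 s2 s3" 
      "c1 = 0 \<longrightarrow> s1 \<le> s2 + s3 \<and> t1 - s1 \<le> (t2 - s2) + (t3 - s3)"
      "c2 = 0 \<longrightarrow> s2 \<le> s1 + s3 \<and> t2 - s2 \<le> (t1 - s1) + (t3 - s3)" 
      "c3 = 0 \<longrightarrow> s3 \<le> s1 + s2 \<and> t3 - s3 \<le> (t1 - s1) + (t2 - s2)" 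
      "c0 = 2 \<longrightarrow> s1 + s2 + s3 \<le> 2 \<and> (t1 - s1) + (t2 - s2) + (t3 - s3) \<le> 2 * (m - 1)"
      using cube_peel_even[OF m t c' B] by blast
    have b: "0 \<le> s1" "s1 \<le> 1" "0 \<le> s2" "s2 \<le> 1" "0 \<le> s3" "s3 \<le> 1" 
      "0 \<le> t1 - s1" "t1 - s1 \<le> m - 1" "0 \<le> t2 - s2" "t2 - s2 \<le> m - 1" "0 \<le> t3 - s3" "t3 - s3 \<le> m - 1"
      using s(1) by auto
    have C1: "s1 - s2 - s3 \<le> c1 \<and> (t1-s1) - (t2-s2) - (t3-s3) \<le> q c1" using o(2)
    proof
      assume "c1 = 0" then show ?thesis using s(2) by (simp add: q_def)
    next
      assume "c1 \<ge> 1" then show ?thesis using q1[of c1] b by simp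
    qed
    have C2: "s2 - s1 - s3 \<le> c2 \<and> (t2-s2) - (t1-s1) - (t3-s3) \<le> q c2" using o(3)
    proof
      assume "c2 = 0" then show ?thesis using s(3) by (simp add: q_def)
    next
      assume "c2 \<ge> 1" then show ?thesis using q1[of c2] b by simp
    qed
    have C3: "s3 - s1 - s2 \<le> c3 \<and> (t3-s3) - (t1-s1) - (t2-s2) \<le> q c3" using o(4)
    proof
      assume "c3 = 0" then show ?thesis using s(4) by (simp add: q_def)
    next
      assume "c3 \<ge> 1" then show ?thesis using q1[of c3] b by simp
    qed
    have C0: "s1 + s2 + s3 \<le> c0 \<and> (t1-s1) + (t2-s2) + (t3-s3) \<le> q c0" using o(1)
    proof
      assume "c0 = 2" then show ?thesis using s(5) by (simp add: q_def)
    next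
      assume "c0 \<ge> 3" then show ?thesis using q3[of c0] b by simp
    qed
    show ?thesis using s(1) C0 C1 C2 C3 unfolding q_def by blast
  qed
qed

text \<open>The analogue at a loop, for the half-weight \<open>t1\<close> of the tree edge and the weight \<open>t2\<close> of the loop.
  Since \<open>c\<close> and \<open>d\<close> have the same parity, the two inequalities never cut off \<open>10\<close> and \<open>11\<close> only;
  in that case \<open>(1, 1)\<close> in twice the remaining segment would be indecomposable.\<close>

lemma loop_peel:
  fixes t1 t2 m c d h :: int
  assumes m: "m \<ge> 1" and t: "0 \<le> t1" "t1 \<le> m" "0 \<le> t2" "t2 \<le> m"
    and c: "t1 - t2 \<le> m * c" "t1 + t2 \<le> m * d"
    and odd_indicator: "c + d = 2 * h"
  shows "\<exists>s1 s2. s1 \<in> {0,1} \<and> s2 \<in> {0,1} \<and> 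
     0 \<le> t1 - s1 \<and> t1 - s1 \<le> m - 1 \<and> 0 \<le> t2 - s2 \<and> t2 - s2 \<le> m - 1 \<and> 
     s1 - s2 \<le> c \<and> s1 + s2 \<le> d \<and> (t1-s1) - (t2-s2) \<le> (m-1) * c \<and> (t1-s1) + (t2-s2) \<le> (m-1) * d"
proof -
  have mc: "m * c \<ge> m" if "c \<ge> 1" for c :: int using that m by simp
  have mc1: "(m-1) * c \<ge> (m-1) * k" if "c \<ge> k" for c k :: int using that m by (simp add: mult_left_mono)
  have "c \<ge> -1"
  proof (rule ccontr)
    assume "\<not> ?thesis" then have "m * c \<le> m * (-2)" using m by (intro mult_left_mono) auto
    then show False using t c m by linarith
  qed
  have "d \<ge> 0"
  proof (rule ccontr)
    assume "\<not> ?thesis" then have "m * d \<le> m * (-1)" using m by (intro mult_left_mono) auto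
    then show False using t c m by linarith
  qed
  consider "c = -1" | "c = 0" | "c \<ge> 1" using \<open>c \<ge> -1\<close> by linarith
  then show ?thesis
  proof cases
    case 1
    then have "t1 = 0" "t2 = m" using t c m by auto
    moreover have "d \<ge> 1" using 1 odd_indicator \<open>d \<ge> 0\<close> by presburger
    ultimately
show ?thesis using 1 mc1[of 1 d] m by (intro exI[of _ 0] exI[of _ 1]) auto
  next
    case 2
    have "d = 0 \<or> d \<ge> 2" using \<open>d \<ge> 0\<close> odd_indicator 2 by presburger
    then consider "d = 0" | "d \<ge> 2" by blast
    then show ?thesis
    proof cases
      case 1 then show ?thesis using 2 t c m by (intro exI[of _ 0] exI[of _ 0]) auto
    next
      case d: 2
      show ?thesis
      proof (cases "t1 = 0")
        case True
        then show ?thesis using 2 t c m d mc1[of 2 d] by (intro exI[of _ 0] exI[of _ "if t2 = 0 then 0 else 1"]) auto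
      next
        case False
        then show ?thesis using 2 t c m d mc1[of 2 d] by (intro exI[of _ 1] exI[of _ 1]) auto
      qed
    qed
  next
    case 3
    have A: "(m-1) * c \<ge> m - 1" using mc1[OF 3] by simp
    consider "d = 0" | "d = 1" | "d \<ge> 2" using \<open>d \<ge> 0\<close> by linarith
    then show ?thesis
    proof cases
      case 1 then show ?thesis using 3 A t c m by (intro exI[of _ 0] exI[of _ 0]) auto
    next
      case 2 
      then show ?thesis using 3 A t c m 
        by (intro exI[of _ "if t1 = 0 then 0 else 1"] exI[of _ "if t1 = 0 \<and> t2 \<noteq> 0 then 1 else 0"]) auto
    next
      case d: 3
      show ?thesis using 3 A t c m d mc1[of 2 d]
        by (intro exI[of _ "if t1 = 0 then 0 else 1"] exI[of _ "if t2 = 0 then 0 else 1"]) auto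
    qed
  qed
qed

section \<open>Local constraints along a tree\<close>

text \<open>An order in which nodes can be glued: each new node meets the earlier ones in at most one edge.\<close>

inductive tree_built :: "('v \<Rightarrow> 'e set) \<Rightarrow> 'v set \<Rightarrow> bool" for star where
  empty: "tree_built star {}"
| insert: "tree_built star U \<Longrightarrow> v \<notin> U \<Longrightarrow> \<Union>(star ` U) \<inter> star v \<subseteq> {e} \<Longrightarrow> tree_built star (insert v U)"

text \<open>The integer parts \<open>f\<close> are kept fixed while summands are split off. The remainder may reach the upper
  end \<open>f + 1\<close> on average, so it is described by inequalities and not by its own integer parts.\<close>

lemma peel_imp_decomposition:
  assumes peel: "\<And>m z. m \<ge> 1 \<Longrightarrow> Q m z \<Longrightarrow> (\<And>e. e \<in> F \<Longrightarrow> int m * f e \<le> z e \<and> z e \<le> int m * (f e + 1)) \<Longrightarrow>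
      \<exists>u\<in>boxed f F. Q 1 u \<and> Q (m - 1) (z - u) \<and> (\<forall>e\<in>F. int (m - 1) * f e \<le> z e - u e \<and> z e - u e \<le> int (m - 1) * (f e + 1))"
    and "Q m z" "\<And>e. e \<in> F \<Longrightarrow> int m * f e \<le> z e \<and> z e \<le> int m * (f e + 1)"
  shows "\<exists>M. size M = m \<and> set_mset M \<subseteq> {y \<in> boxed f F. Q 1 y} \<and> \<Sum>\<^sub># M = restr F z"
  using assms(2,3)
proof (induction m arbitrary: z)
  case 0
  then have "restr F z = 0" by (intro ext) (simp add: restr_def order_antisym)
  then show ?case by (simp add: zero_fun_def)
next
  case (Suc m)
  obtain u where u: "u \<in> boxed f F" "Q 1 u" "Q m (z - u)" 
    "\<And>e. e \<in> F \<Longrightarrow> int m * f e \<le> (z - u) e \<and> (z - u) e \<le> int m * (f e + 1)"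
    using peel[of "Suc m" z] Suc.prems by auto
  obtain M where M: "size M = m" "set_mset M \<subseteq> {y \<in> boxed f F. Q 1 y}" "\<Sum>\<^sub># M = restr F (z - u)"
    using Suc.IH[OF u(3,4)] by blast
  have "u + restr F (z - u) = restr F z"
    using u(1) by (intro ext) (simp add: restr_def boxed_def)
  then show ?case using M u by (intro exI[of _ "add_mset u M"]) simp
qed

text \<open>A node constrains only the edges of its star, and solutions of levels \<open>a\<close> and \<open>b\<close> add up to solutions
  of level \<open>a + b\<close>, as for a family of dilated polytopes. The last assumption is balanced generation in
  degree one at a single node.\<close>

locale constraints =
  fixes V :: "'v set" and star :: "'v \<Rightarrow> 'e set" and admissible :: "'v \<Rightarrow> nat \<Rightarrow> ('e \<Rightarrow> int) \<Rightarrow> bool"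
  assumes local: "\<And>v m z z'. v \<in> V \<Longrightarrow> (\<And>e. e \<in> star v \<Longrightarrow> z e = z' e) \<Longrightarrow> admissible v m z \<Longrightarrow> admissible v m z'"
    and add: "\<And>v a b y z. v \<in> V \<Longrightarrow> admissible v a y \<Longrightarrow> admissible v b z \<Longrightarrow> admissible v (a + b) (y + z)"
    and three: "\<And>v. v \<in> V \<Longrightarrow> \<exists>e1 e2 e3. star v = {e1, e2, e3}"
    and decomp: "\<And>v m z. v \<in> V \<Longrightarrow> m > 0 \<Longrightarrow> admissible v m z \<Longrightarrow>
      \<exists>M. size M = m \<and> set_mset M \<subseteq> {y \<in> boxed (\<lambda>e. z e div int m) (star v). admissible v 1 y} \<and> \<Sum>\<^sub># M = restr (star v) z"
begin

definition level :: "'v set \<Rightarrow> nat \<Rightarrow> ('e \<Rightarrow> int) set" where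
  "level U m = {z. (\<forall>e. e \<notin> \<Union>(star ` U) \<longrightarrow> z e = 0) \<and> (\<forall>v\<in>U. admissible v m z)}"

definition balanced_level :: "('e \<Rightarrow> int) \<Rightarrow> 'v set \<Rightarrow> ('e \<Rightarrow> int) set" where
  "balanced_level f U = level U 1 \<inter> boxed f (\<Union>(star ` U))"

definition node :: "('e \<Rightarrow> int) \<Rightarrow> 'v \<Rightarrow> ('e \<Rightarrow> int) set" where
  "node f v = {y \<in> boxed f (star v). admissible v 1 y}"

lemma admissible_restr: "v \<in> V \<Longrightarrow> star v \<subseteq> F \<Longrightarrow> admissible v m (restr F z) \<longleftrightarrow> admissible v m z"
  using local[of v z "restr F z"] local[of v "restr F z" z] by (auto simp: restr_def subset_iff)

lemma balanced_level_insert: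
  assumes "insert v U \<subseteq> V"
  shows "balanced_level f (insert v U) = amalgam (\<Union>(star ` U)) (balanced_level f U) (star v) (node f v)"
proof -
  have box: "restr F z \<in> boxed f F \<longleftrightarrow> (\<forall>e\<in>F. z e \<in> {f e, f e + 1})" for F z
    by (simp add: boxed_def restr_def)
  have "(\<forall>u\<in>U. admissible u 1 (restr (\<Union>(star ` U)) z)) \<longleftrightarrow> (\<forall>u\<in>U. admissible u 1 z)" for z
    using assms by (intro ball_cong refl admissible_restr) auto
  moreover have "admissible v 1 (restr (star v) z) \<longleftrightarrow> admissible v 1 z" for z using assms by (intro admissible_restr) auto
  ultimately show ?thesis
    unfolding balanced_level_def level_def amalgam_def node_def mem_Collect_eq Int_iff box
    by (intro set_eqI) (auto simp: boxed_def restr_def)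
qed

lemma balanced_level_boxed: "balanced_level f U \<subseteq> boxed f (\<Union>(star ` U))" and node_boxed: "node f v \<subseteq> boxed f (star v)"
  by (auto simp: balanced_level_def node_def)

lemma balanced_level_connected:
  "tree_built star U \<Longrightarrow> U \<subseteq> V \<Longrightarrow> exchange_connected (balanced_level f U)"
proof (induction rule: tree_built.induct)
  case empty
  have "balanced_level f {} \<subseteq> {0}" by (auto simp: balanced_level_def level_def)
  then show ?case
    by (intro box_exchange_connected[where f = "\<lambda>_. 0"]) auto
next
  case (insert U v e)
  obtain e1 e2 e3 where e: "star v = {e1, e2, e3}" using three[of v] insert.prems by blast
  have "exchange_connected (node f v)"
  proof (rule box_exchange_connected)
    show "z e = 0" if "z \<in> node f v" "e \<notin> {e1, e2, e3}" for z e
      using that unfolding e[symmetric] node_def boxed_def by auto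
    show "z e \<in> {f e, f e + 1}" if "z \<in> node f v" "e \<in> {e1, e2, e3}" for z e
      using that unfolding e[symmetric] node_def boxed_def by auto
  qed
  then show ?case
    unfolding balanced_level_insert[OF insert.prems]
    using insert by (intro exchange_connected_amalgam[OF balanced_level_boxed node_boxed insert.hyps(3)]) auto
qed

text \<open>Balanced decompositions at the nodes agree on common edges by \<open>shared_mset_eq\<close>, so they glue.\<close>

lemma balanced_decomposition:
  "tree_built star U \<Longrightarrow> U \<subseteq> V \<Longrightarrow> m > 0 \<Longrightarrow> z \<in> level U m \<Longrightarrow>
    \<exists>M. size M = m \<and> set_mset M \<subseteq> balanced_level (\<lambda>e. z e div int m) U \<and> \<Sum>\<^sub># M = z"
proof (induction arbitrary: z rule: tree_built.induct)
  case empty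
  have "z = 0" using empty by (auto simp: level_def)
  moreover have "0 \<in> balanced_level (\<lambda>e. z e div int m) {}" by (simp add: balanced_level_def level_def boxed_def)
  moreover have "\<Sum>\<^sub># (replicate_mset m (0 :: 'e \<Rightarrow> int)) = 0" by (induction m) auto
  ultimately show ?case by (intro exI[of _ "replicate_mset m 0"]) auto
next
  case (insert U v e)
  define f where "f = (\<lambda>e. z e div int m)"
  let ?F = "\<Union>(star ` U)"
  have vV: "v \<in> V" and UV: "U \<subseteq> V" using insert.prems by auto
  have "restr ?F z \<in> level U m"
  proof -
    have "admissible u m (restr ?F z)" if "u \<in> U" for u
      using that insert.prems(3) UV admissible_restr[of u ?F m z] by (auto simp: level_def)
    then show ?thesis by (auto simp: level_def restr_def)
  qed
  then obtain M1' where M1': "size M1' = m" "set_mset M1' \<subseteq> balanced_level (\<lambda>e. restr ?F z e div int m) U" "\<Sum>\<^sub># M1' = restr ?F z"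
    using insert.IH[OF UV insert.prems(2)] by blast
  have "balanced_level (\<lambda>e. restr ?F z e div int m) U = balanced_level f U"
    unfolding balanced_level_def boxed_def f_def by (auto simp: restr_def)
  then have M1: "set_mset M1' \<subseteq> balanced_level f U" using M1' by simp
  obtain M2' where M2': "size M2' = m" "set_mset M2' \<subseteq> node f v" "\<Sum>\<^sub># M2' = restr (star v) z"
    using decomp[OF vV insert.prems(2), of z] insert.prems unfolding level_def node_def f_def by auto
  have eq: "image_mset (restr (?F \<inter> star v)) M1' = image_mset (restr (?F \<inter> star v)) M2'"
  proof (rule shared_mset_eq[OF insert.hyps(3), where f = f])
    show "y e \<in> {f e, f e + 1}" if "y \<in># M1' + M2'" "e \<in> ?F \<inter> star v" for y e
    proof -
      have "y \<in> boxed f ?F \<or> y \<in> boxed f (star v)"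
        using that(1) M1 M2'(2) balanced_level_boxed[of f U] node_boxed[of f v] by auto
      then show ?thesis using that(2) by (auto simp: boxed_def)
    qed
    show "size M1' = size M2'" using M1' M2' by simp
    show "(\<Sum>\<^sub># M1') e = (\<Sum>\<^sub># M2') e" if "e \<in> ?F \<inter> star v" for e
      using that unfolding M1'(3) M2'(3) by (simp add: restr_def)
  qed
  obtain M where M: "image_mset (restr ?F) M = M1'" "image_mset (restr (star v)) M = M2'" 
    "\<And>y e. y \<in># M \<Longrightarrow> e \<notin> ?F \<union> star v \<Longrightarrow> y e = 0"
  proof (rule merge_msets[OF _ _ eq])
    show "set_mset M1' \<subseteq> boxed f ?F" using M1 balanced_level_boxed by blast
    show "set_mset M2' \<subseteq> boxed f (star v)" using M2' node_boxed by blast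
  qed blast
  have "size M = m" using M(1) M1'(1) by (metis size_image_mset)
  moreover have "set_mset M \<subseteq> balanced_level f (insert v U)"
    unfolding balanced_level_insert[OF insert.prems(1)]
  proof
    fix y assume y: "y \<in># M"
    then have "restr ?F y \<in># image_mset (restr ?F) M" "restr (star v) y \<in># image_mset (restr (star v)) M" by auto
    then have "restr ?F y \<in> balanced_level f U" "restr (star v) y \<in> node f v" unfolding M(1,2) using M1 M2'(2) by auto
    then show "y \<in> amalgam ?F (balanced_level f U) (star v) (node f v)" using M(3)[OF y] by (auto simp: amalgam_def)
  qed
  moreover have "(\<Sum>\<^sub># M) e = z e" for e
  proof -
    consider "e \<in> ?F" | "e \<in> star v" | "e \<notin> ?F \<union> star v" by auto
    then show ?thesis
    proof cases
      case 1 then show ?thesis using sum_restr[of ?F M e] unfolding M(1) M1'(3) by (simp add: restr_def)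
    next
      case 2 then show ?thesis using sum_restr[of "star v" M e] unfolding M(2) M2'(3) by (simp add: restr_def)
    next
      case 3
      have "(\<Sum>\<^sub># M) e = 0" unfolding sum_mset_apply using M(3)[OF _ 3] by (simp add: sum_mset.neutral)
      then show ?thesis using 3 insert.prems(3) by (simp add: level_def)
    qed
  qed
  ultimately show ?case unfolding f_def by (intro exI[of _ M]) auto
qed


end

text \<open>Since \<open>2(x\<^sup>2 + y\<^sup>2) = (x + y)\<^sup>2 + (x - y)\<^sup>2\<close>, only the differences count, and these have the
  same parity.\<close>

lemma sum_squares_balance:
  fixes a b c d :: int
  assumes "a + b = c + d" "\<bar>c - d\<bar> \<le> 1"
  shows "c^2 + d^2 \<le> a^2 + b^2" "\<bar>a - b\<bar> > 1 \<Longrightarrow> c^2 + d^2 < a^2 + b^2"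
proof -
  have sq: "2 * (x^2 + y^2) = (x + y)^2 + (x - y)^2" for x y :: int by algebra
  have "c - d = -1 \<or> c - d = 0 \<or> c - d = 1" using assms(2) by linarith
  then have cd: "(c - d)^2 = \<bar>c - d\<bar>" by auto
  have ab: "\<bar>k\<bar> \<le> k^2" for k :: int
  proof (cases "k = 0")
    case False
    then have "1 * \<bar>k\<bar> \<le> \<bar>k\<bar> * \<bar>k\<bar>" by (intro mult_right_mono) auto
    then show ?thesis by (simp add: power2_eq_square)
  qed simp
  have "\<bar>c - d\<bar> \<le> \<bar>a - b\<bar>"
  proof (cases "a = b")
    case True
    then have "c - d = 2 * (a - d)" using assms(1) by simp
    then show ?thesis using assms(2) True by presburger
  next
    case False
    then show ?thesis using assms(2) by linarith
  qed
  then have le: "(c - d)^2 \<le> (a - b)^2" using cd ab[of "a - b"] by linarith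
  have "2 * (c^2 + d^2) - 2 * (a^2 + b^2) = (c - d)^2 - (a - b)^2"
    unfolding sq using assms(1) by simp
  note diff = this
  have r: "u \<le> v" "p < q \<Longrightarrow> u < v" if "2 * u - 2 * v = p - q" "p \<le> q" for u v p q :: int
    using that by linarith+
  show "c^2 + d^2 \<le> a^2 + b^2" by (rule r(1)[OF diff le])
  assume "\<bar>a - b\<bar> > 1"
  then have "(c - d)^2 < (a - b)^2" using cd ab[of "a - b"] assms(2) by linarith
  then show "c^2 + d^2 < a^2 + b^2" 
    by (rule r(2)[OF diff le])
qed

text \<open>All values lie between the minimum and its successor, and the minimum is the integer part of the
  mean because it is attained.\<close>

lemma average_box:
  fixes g :: "'a \<Rightarrow> int"
  assumes ne: "M \<noteq> {#}" and bal: "\<And>x y. x \<in># M \<Longrightarrow> y \<in># M \<Longrightarrow> \<bar>g x - g y\<bar> \<le> 1"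
    and x: "x \<in># M"
  shows "g x \<in> {(\<Sum>x\<in>#M. g x) div int (size M), (\<Sum>x\<in>#M. g x) div int (size M) + 1}"
proof -
  obtain a where a: "a \<in># M" "\<And>y. y \<in># M \<Longrightarrow> g a \<le> g y"
  proof -
    have "finite (g ` set_mset M)" "g ` set_mset M \<noteq> {}" using ne by auto
    then show ?thesis using that Min_in[of "g ` set_mset M"] Min_le[of "g ` set_mset M"] by (metis (no_types, lifting) imageE image_eqI)
  qed
  obtain C where C: "M = add_mset a C" using a(1) by (metis insert_DiffM)
  have up: "g y \<le> g a + 1" if "y \<in># M" for y using bal[OF that a(1)] by linarith
  have bounds: "int (size D) * g a \<le> (\<Sum>x\<in>#D. g x) \<and> (\<Sum>x\<in>#D. g x) \<le> int (size D) * (g a + 1)" 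
    if "set_mset D \<subseteq> set_mset M" for D
    using that
  proof (induction D)
    case (add y D)
    then show ?case using a(2)[of y] up[of y] by (simp add: algebra_simps)
  qed simp
  have "(\<Sum>x\<in>#M. g x) div int (size M) = g a"
  proof (rule int_div_pos_eq[where r = "(\<Sum>x\<in>#M. g x) - int (size M) * g a"])
    show "(\<Sum>x\<in>#M. g x) - int (size M) * g a < int (size M)"
    proof -
      have "set_mset C \<subseteq> set_mset M" using C by auto
      then show ?thesis using bounds[of C] C by (simp add: algebra_simps)
    qed
  qed (use bounds[of M] in auto)
  then show ?thesis using up[OF x] a(2)[OF x] by auto
qed

context constraints
begin

lemma level_add: "U \<subseteq> V \<Longrightarrow> y \<in> level U a \<Longrightarrow> z \<in> level U b \<Longrightarrow> y + z \<in> level U (a + b)"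
  by (auto simp: level_def intro: add)

text \<open>The sum of the squares of all entries drops whenever two points that differ by more than one
  on some edge are replaced by a balanced decomposition of their sum.\<close>

lemma exchange_to_balanced:
  assumes tree: "tree_built star V" and fin: "finite V" and M: "set_mset M \<subseteq> level V 1"
  shows "\<exists>M'. (exchange (level V 1))\<^sup>*\<^sup>* M M' \<and> (\<forall>x y e. x \<in># M' \<longrightarrow> y \<in># M' \<longrightarrow> \<bar>x e - y e\<bar> \<le> 1)"
  using M
proof (induction "nat (\<Sum>x\<in>#M. \<Sum>e\<in>\<Union>(star ` V). (x e)^2)" arbitrary: M rule: less_induct)
  case less
  let ?F = "\<Union>(star ` V)"
  let ?E = "\<lambda>x :: 'e \<Rightarrow> int. \<Sum>e\<in>?F. (x e)^2"
  have finF: "finite ?F" using fin three by (metis finite.simps finite_UN)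
  show ?case
  proof (cases "\<forall>x y e. x \<in># M \<longrightarrow> y \<in># M \<longrightarrow> \<bar>x e - y e\<bar> \<le> 1")
    case True
    then show ?thesis by blast
  next
    case False
    then obtain x y e0 where xy: "x \<in># M" "y \<in># M" "\<bar>x e0 - y e0\<bar> > 1" by (meson not_le)
    then have "x \<noteq> y" by auto
    then obtain D where D: "M = {#x, y#} + D" 
      using distinct_subset_mset(1)[OF xy(1,2)] by (auto simp: mset_subset_eq_exists_conv)
    have lev: "x \<in> level V 1" "y \<in> level V 1" "set_mset D \<subseteq> level V 1" using less.prems D by auto
    have "x + y \<in> level V 2" using level_add[OF subset_refl lev(1,2)] by (simp add: numeral_2_eq_2)
    from balanced_decomposition[OF tree subset_refl _ this]
    obtain N where N: "size N = 2" "set_mset N \<subseteq> balanced_level (\<lambda>e. (x + y) e div int 2) V" "\<Sum>\<^sub># N = x + y" by auto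
    obtain a C where aC: "N = add_mset a C" using N(1) by (metis numeral_2_eq_2 size_eq_Suc_imp_eq_union)
    then obtain b where "C = {#b#}" using N(1) size_1_singleton_mset[of C] by auto
    with aC have ab: "N = {#a, b#}" by simp
    have abl: "a \<in> level V 1" "b \<in> level V 1" using N(2) ab by (auto simp: balanced_level_def)
    have s: "x e + y e = a e + b e" for e using fun_cong[OF N(3), of e] ab by simp
    have bal: "\<bar>a e - b e\<bar> \<le> 1" for e
    proof -
      define g where "g = (\<lambda>e. (x + y) e div int 2)"
      have "a \<in> boxed g ?F" "b \<in> boxed g ?F" using N(2) ab unfolding g_def balanced_level_def by auto
      then have z: "e \<notin> ?F \<Longrightarrow> a e = 0 \<and> b e = 0" 
        and g: "e \<in> ?F \<Longrightarrow> a e \<in> {g e, g e + 1} \<and> b e \<in> {g e, g e + 1}" 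
        unfolding boxed_def mem_Collect_eq by blast+
      show ?thesis using z g by (cases "e \<in> ?F") auto
    qed
    have e0: "e0 \<in> ?F"
    proof (rule ccontr)
      assume "e0 \<notin> ?F"
      then have "x e0 = 0" "y e0 = 0" using lev(1,2) unfolding level_def mem_Collect_eq by blast+
      then show False using xy(3) by simp
    qed
    have "?E a + ?E b = (\<Sum>e\<in>?F. (a e)^2 + (b e)^2)" by (simp add: sum.distrib)
    also have "\<dots> < (\<Sum>e\<in>?F. (x e)^2 + (y e)^2)"
      using finF e0 sum_squares_balance[OF s bal] xy(3) by (intro sum_strict_mono_ex1) auto
    also have "\<dots> = ?E x + ?E y" by (simp add: sum.distrib)
    finally have lt: "?E a + ?E b < ?E x + ?E y" .
    have nn: "(\<Sum>x\<in>#C. ?E x) \<ge> 0" for C by (induction C) (auto simp: sum_nonneg)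
    let ?M = "{#a, b#} + D"
    have "nat (\<Sum>x\<in>#?M. ?E x) < nat (\<Sum>x\<in>#M. ?E x)"
      using lt nn[of ?M] unfolding D by simp
    then obtain M' where M': "(exchange (level V 1))\<^sup>*\<^sup>* ?M M'" "\<forall>x y e. x \<in># M' \<longrightarrow> y \<in># M' \<longrightarrow> \<bar>x e - y e\<bar> \<le> 1"
      using less.hyps[of ?M] abl lev by auto
    have "exchange (level V 1) M ?M" unfolding D using abl lev N(3) ab by (intro exchangeI) auto
    then show ?thesis using M' by (meson converse_rtranclp_into_rtranclp)
  qed
qed

text \<open>Both multisets are first made balanced. As they have the same size and sum, they end up in the same
  unit box, where \<open>balanced_level_connected\<close> applies.\<close>

theorem level_connected:
  assumes tree: "tree_built star V" and fin: "finite V"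
  shows "exchange_connected (level V 1)"
  unfolding exchange_connected_def
proof (intro allI impI)
  let ?X = "level V 1"
  fix M M' assume M: "set_mset M \<subseteq> ?X" "set_mset M' \<subseteq> ?X" "size M = size M'" "\<Sum>\<^sub># M = \<Sum>\<^sub># M'"
  define f where "f e = (\<Sum>\<^sub># M) e div int (size M)" for e
  have bal: "\<exists>N. (exchange ?X)\<^sup>*\<^sup>* C N \<and> set_mset N \<subseteq> balanced_level f V" 
    if C: "set_mset C \<subseteq> ?X" "size C = size M" "\<Sum>\<^sub># C = \<Sum>\<^sub># M" for C
  proof -
    obtain N where N: "(exchange ?X)\<^sup>*\<^sup>* C N" "\<And>x y e. x \<in># N \<Longrightarrow> y \<in># N \<Longrightarrow> \<bar>x e - y e\<bar> \<le> 1"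
      using exchange_to_balanced[OF tree fin C(1)] by blast
    note iN = exchanges_invariant[OF N(1) C(1), unfolded C(2,3)]
    have "x \<in> balanced_level f V" if "x \<in># N" for x
    proof -
      have "x e \<in> {f e, f e + 1}" for e
        unfolding f_def iN(1,2)[symmetric] sum_mset_apply
        by (rule average_box[where g = "\<lambda>x. x e"]) (use that N(2) in auto)
      moreover have "x \<in> ?X" using iN(3) that by auto
      ultimately show ?thesis by (auto simp: balanced_level_def boxed_def level_def)
    qed
    then show ?thesis using N(1) by blast
  qed
  obtain N where N: "(exchange ?X)\<^sup>*\<^sup>* M N" "set_mset N \<subseteq> balanced_level f V" using bal[OF M(1)] by auto
  obtain N' where N': "(exchange ?X)\<^sup>*\<^sup>* M' N'" "set_mset N' \<subseteq> balanced_level f V" using bal[OF M(2)] M by auto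
  have "size N = size N'" "\<Sum>\<^sub># N = \<Sum>\<^sub># N'"
    using exchanges_invariant[OF N(1) M(1)] exchanges_invariant[OF N'(1) M(2)] M by auto
  then have "(exchange (balanced_level f V))\<^sup>*\<^sup>* N N'"
    using balanced_level_connected[OF tree subset_refl] N(2) N'(2) unfolding exchange_connected_def by blast
  then have "(exchange ?X)\<^sup>*\<^sup>* N N'" by (rule exchanges_mono[rotated]) (auto simp: balanced_level_def)
  then show "(exchange ?X)\<^sup>*\<^sup>* M M'" using N(1) exchanges_sym[OF N'(1)] by auto
qed

end

section \<open>Balanced decompositions at a node\<close>

lemma int_div_bounds:
  fixes m x :: int
  assumes "m > 0" shows "m * (x div m) \<le> x" "x \<le> m * (x div m + 1)"
proof -
  have "m * (x div m) + x mod m = x" by (rule mult_div_mod_eq)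
  moreover have "0 \<le> x mod m" "x mod m < m" using assms by simp_all
  moreover have "m * (x div m + 1) = m * (x div m) + m" by (simp add: distrib_left)
  ultimately show "m * (x div m) \<le> x" "x \<le> m * (x div m + 1)" by linarith+
qed

lemma div_ge_bound:
  fixes m x lo :: int
  assumes "m > 0" "m * lo \<le> x" shows "lo \<le> x div m"
  using zdiv_mono1[OF assms(2,1)] assms(1) by simp

lemma div_le_bound:
  fixes m x hi :: int
  assumes "m > 0" "x \<le> m * hi" shows "x div m \<le> hi"
  using zdiv_mono1[OF assms(2,1)] assms(1) by simp

text \<open>Integer bounds on the mean hold for each summand of a balanced decomposition: a summand above \<open>hi\<close>
  would force all others to be at least \<open>hi\<close>. With \<open>lo = hi\<close> this keeps prescribed leaf weights.\<close>

lemma rounding_bounds: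
  assumes M: "size M = m" "set_mset M \<subseteq> boxed (\<lambda>e. z e div int m) F" "\<Sum>\<^sub># M = restr F z"
    and m: "m > 0" and e: "e \<in> F" and y: "y \<in># M" and z: "int m * lo \<le> z e" "z e \<le> int m * hi"
  shows "lo \<le> y e" "y e \<le> hi"
proof -
  let ?f = "z e div int m"
  have val: "x e \<in> {?f, ?f + 1}" if "x \<in># M" for x using that M(2) e by (auto simp: boxed_def)
  show "lo \<le> y e" using val[OF y] div_ge_bound[OF _ z(1)] m by auto
  show "y e \<le> hi"
  proof (rule ccontr)
    assume "\<not> ?thesis"
    then have hi: "hi \<le> ?f" "y e \<ge> hi + 1" using val[OF y] by auto
    obtain C where C: "M = add_mset y C" using y by (metis insert_DiffM)
    have "\<forall>D. set_mset D \<subseteq> set_mset M \<longrightarrow> (\<Sum>x\<in>#D. x e) \<ge> int (size D) * hi"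
    proof (intro allI impI)
      fix D assume that: "set_mset D \<subseteq> set_mset M"
      then show "(\<Sum>x\<in>#D. x e) \<ge> int (size D) * hi"
      proof (induction D)
        case (add x D)
        then have "x e \<ge> hi" using val[of x] hi by auto
        then show ?case using add by (simp add: algebra_simps)
      qed simp
    qed
    moreover have "set_mset C \<subseteq> set_mset M" using C by auto
    ultimately have "(\<Sum>x\<in>#C. x e) \<ge> int (size C) * hi" by blast
    then have "(\<Sum>x\<in>#M. x e) \<ge> int m * hi + 1" using hi(2) C M(1) by (auto simp: algebra_simps)
    moreover have "(\<Sum>x\<in>#M. x e) = z e" using fun_cong[OF M(3), of e] e by (simp add: sum_mset_apply restr_def)
    ultimately show False using z(2) by linarith
  qed
qed

lemma box_start:
  "m > 0 \<Longrightarrow> int m * (z e div int m) \<le> z e \<and> z e \<le> int m * (z e div int m + 1)"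
  using int_div_bounds[of "int m" "z e"] by simp

lemma free_decomposition:
  assumes m: "m > 0"
  shows "\<exists>M. size M = m \<and> set_mset M \<subseteq> boxed (\<lambda>e. z e div int m) F \<and> \<Sum>\<^sub># M = restr F z"
proof -
  define f where "f = (\<lambda>e. z e div int m)"
  have "\<exists>M. size M = m \<and> set_mset M \<subseteq> {y \<in> boxed f F. True} \<and> \<Sum>\<^sub># M = restr F z"
  proof (rule peel_imp_decomposition[where Q = "\<lambda>_ _. True"])
    fix k :: nat and x :: "'a \<Rightarrow> int"
    assume k: "k \<ge> 1" and box: "\<And>e. e \<in> F \<Longrightarrow> int k * f e \<le> x e \<and> x e \<le> int k * (f e + 1)"
    define u where "u e = (if e \<in> F then if x e = int k * f e then f e else f e + 1 else 0)" for e
    have "int (k - 1) * f e \<le> x e - u e \<and> x e - u e \<le> int (k - 1) * (f e + 1)" if "e \<in> F" for e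
    proof -
      have "int (k - 1) * f e = int k * f e - f e" "int (k - 1) * (f e + 1) = int k * (f e + 1) - (f e + 1)"
        using k by (simp_all add: of_nat_diff left_diff_distrib)
      moreover have "int k * (f e + 1) = int k * f e + int k" by (simp add: distrib_left)
      moreover have "u e = f e \<and> x e = int k * f e \<or> u e = f e + 1 \<and> x e \<noteq> int k * f e" using that by (simp add: u_def)
      ultimately show ?thesis using box[OF that] k by (elim disjE conjE) (intro conjI; linarith)+
    qed
    moreover have "u \<in> boxed f F" by (auto simp: boxed_def u_def)
    ultimately show "\<exists>u\<in>boxed f F. True \<and> True \<and> (\<forall>e\<in>F. int (k - 1) * f e \<le> x e - u e \<and> x e - u e \<le> int (k - 1) * (f e + 1))"
      by blast
  next
    show "int m * f e \<le> z e \<and> z e \<le> int m * (f e + 1)" for e unfolding f_def using box_start[OF m] .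
  qed simp
  then show ?thesis unfolding f_def by simp
qed

definition triangle :: "int \<Rightarrow> int \<Rightarrow> int \<Rightarrow> int \<Rightarrow> bool" where
  "triangle K x y z \<longleftrightarrow> x \<le> y + z \<and> y \<le> x + z \<and> z \<le> x + y \<and> x + y + z \<le> K"

text \<open>With integer parts \<open>f\<close> the slacks of \<open>cube_peel\<close> are \<open>f b + f c - f a\<close> and so on, and
  \<open>2L - f a - f b - f c\<close> for the perimeter; they add up to \<open>2L\<close>.\<close>

lemma triangle_decomposition:
  fixes z :: "'e \<Rightarrow> int"
  assumes abc: "a \<noteq> b" "a \<noteq> c" "b \<noteq> c" and m: "m > 0" and L: "L \<ge> 2"
    and tri: "triangle (2 * L * int m) (z a) (z b) (z c)"
  shows "\<exists>M. size M = m \<and> set_mset M \<subseteq> {y \<in> boxed (\<lambda>e. z e div int m) {a, b, c}. triangle (2 * L) (y a) (y b) (y c)}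
     \<and> \<Sum>\<^sub># M = restr {a, b, c} z"
proof -
  define f where "f = (\<lambda>e. z e div int m)"
  have fb: "0 \<le> f e \<and> f e \<le> L" if "e \<in> {a, b, c}" for e
  proof -
    have "int m * 0 \<le> z e" "z e \<le> int m * L" using that tri by (auto simp: triangle_def algebra_simps)
    then show ?thesis unfolding f_def using div_ge_bound[of "int m" 0 "z e"] div_le_bound[of "int m" "z e" L] m by simp
  qed
  have "\<exists>M. size M = m \<and> set_mset M \<subseteq> {y \<in> boxed f {a, b, c}. triangle (2 * L * int 1) (y a) (y b) (y c)} \<and> \<Sum>\<^sub># M = restr {a, b, c} z"
  proof (rule peel_imp_decomposition[where Q = "\<lambda>k y. triangle (2 * L * int k) (y a) (y b) (y c)"])
    show "triangle (2 * L * int m) (z a) (z b) (z c)" by (rule tri)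
    show "int m * f e \<le> z e \<and> z e \<le> int m * (f e + 1)" for e unfolding f_def using box_start[OF m] .
  next
    fix k :: nat and x :: "'e \<Rightarrow> int"
    assume k: "k \<ge> 1" and x: "triangle (2 * L * int k) (x a) (x b) (x c)"
      and box: "\<And>e. e \<in> {a, b, c} \<Longrightarrow> int k * f e \<le> x e \<and> x e \<le> int k * (f e + 1)"
    define t where "t e = x e - int k * f e" for e
    have t: "0 \<le> t e" "t e \<le> int k" if "e \<in> {a, b, c}" for e using box[OF that] by (auto simp: t_def algebra_simps)
    let ?c1 = "f b + f c - f a" and ?c2 = "f a + f c - f b" and ?c3 = "f a + f b - f c" and ?c0 = "2 * L - f a - f b - f c"
    have cs: "t a - t b - t c \<le> int k * ?c1" "t b - t a - t c \<le> int k * ?c2" "t c - t a - t b \<le> int k * ?c3"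
      "t a + t b + t c \<le> int k * ?c0"
      using x unfolding t_def triangle_def by (simp_all add: algebra_simps)
    obtain s1 s2 s3 where s: "s1 \<in> {0, 1}" "s2 \<in> {0, 1}" "s3 \<in> {0, 1}"
      "0 \<le> t a - s1" "t a - s1 \<le> int k - 1" "0 \<le> t b - s2" "t b - s2 \<le> int k - 1" "0 \<le> t c - s3" "t c - s3 \<le> int k - 1"
      "s1 - s2 - s3 \<le> ?c1" "s2 - s1 - s3 \<le> ?c2" "s3 - s1 - s2 \<le> ?c3" "s1 + s2 + s3 \<le> ?c0"
      "(t a-s1) - (t b-s2) - (t c-s3) \<le> (int k-1) * ?c1" "(t b-s2) - (t a-s1) - (t c-s3) \<le> (int k-1) * ?c2"
      "(t c-s3) - (t a-s1) - (t b-s2) \<le> (int k-1) * ?c3" "(t a-s1) + (t b-s2) + (t c-s3) \<le> (int k-1) * ?c0"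
    proof -
      have k1: "1 \<le> int k" using k by simp
      have fn: "0 \<le> f a" "0 \<le> f b" "0 \<le> f c" using fb by auto
      have nn: "0 \<le> ?c0 + ?c1" "0 \<le> ?c0 + ?c2" "0 \<le> ?c0 + ?c3" using fb[of a] fb[of b] fb[of c] by auto
      have odd_indicator: "?c1 + ?c2 = 2 * f c" "?c1 + ?c3 = 2 * f b" "?c2 + ?c3 = 2 * f a" "?c0 + ?c1 = 2 * (L - f a)" by simp_all
      have L4: "4 \<le> ?c0 + ?c1 + ?c2 + ?c3" using L by simp
      have ins: "a \<in> {a, b, c}" "b \<in> {a, b, c}" "c \<in> {a, b, c}" by auto
      show ?thesis
        using cube_peel[OF k1 t(1)[OF ins(1)] t(2)[OF ins(1)] t(1)[OF ins(2)] t(2)[OF ins(2)] t(1)[OF ins(3)] t(2)[OF ins(3)] 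
          cs odd_indicator fn nn L4]
        by (elim exE conjE) (rule that; assumption)
    qed
    define u where "u e = (if e = a then f a + s1 else if e = b then f b + s2 else if e = c then f c + s3 else 0)" for e
    have u: "u a = f a + s1" "u b = f b + s2" "u c = f c + s3" using abc by (auto simp: u_def)
    have "u \<in> boxed f {a, b, c}" using s(1-3) u by (auto simp: boxed_def u_def)
    moreover have "triangle (2 * L * int 1) (u a) (u b) (u c)"
      using s(10-13) unfolding u triangle_def by simp
    moreover have "triangle (2 * L * int (k - 1)) ((x - u) a) ((x - u) b) ((x - u) c)"
      using s(14-17) k unfolding triangle_def t_def by (simp add: u of_nat_diff algebra_simps)
    moreover have "\<forall>e\<in>{a, b, c}. int (k - 1) * f e \<le> x e - u e \<and> x e - u e \<le> int (k - 1) * (f e + 1)"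
      using s(4-9) k unfolding t_def by (simp add: u of_nat_diff algebra_simps)
    ultimately show "\<exists>u\<in>boxed f {a, b, c}. triangle (2 * L * int 1) (u a) (u b) (u c) \<and>
      triangle (2 * L * int (k - 1)) ((x - u) a) ((x - u) b) ((x - u) c) \<and>
      (\<forall>e\<in>{a, b, c}. int (k - 1) * f e \<le> x e - u e \<and> x e - u e \<le> int (k - 1) * (f e + 1))" by blast
  qed
  then show ?thesis unfolding f_def by simp
qed

lemma loop_decomposition:
  fixes z :: "'e \<Rightarrow> int"
  assumes ab: "a \<noteq> b" and m: "m > 0" and z: "0 \<le> z a" "z a \<le> z b" "z a + z b \<le> 2 * L * int m"
  shows "\<exists>M. size M = m \<and> set_mset M \<subseteq> {y \<in> boxed (\<lambda>e. z e div int m) {a, b}. 0 \<le> y a \<and> y a \<le> y b \<and> y a + y b \<le> 2 * L}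
     \<and> \<Sum>\<^sub># M = restr {a, b} z"
proof -
  define f where "f = (\<lambda>e. z e div int m)"
  have fa: "0 \<le> f a" unfolding f_def using div_ge_bound[of "int m" 0 "z a"] m z by simp
  have "\<exists>M. size M = m \<and> set_mset M \<subseteq> {y \<in> boxed f {a, b}. y a \<le> y b \<and> y a + y b \<le> 2 * L * int 1} \<and> \<Sum>\<^sub># M = restr {a, b} z"
  proof (rule peel_imp_decomposition[where Q = "\<lambda>k y. y a \<le> y b \<and> y a + y b \<le> 2 * L * int k"])
    show "z a \<le> z b \<and> z a + z b \<le> 2 * L * int m" using z by simp
    show "int m * f e \<le> z e \<and> z e \<le> int m * (f e + 1)" for e unfolding f_def using box_start[OF m] .
  next
    fix k :: nat and x :: "'e \<Rightarrow> int"
    assume k: "k \<ge> 1" and x: "x a \<le> x b \<and> x a + x b \<le> 2 * L * int k"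
      and box: "\<And>e. e \<in> {a, b} \<Longrightarrow> int k * f e \<le> x e \<and> x e \<le> int k * (f e + 1)"
    define t where "t e = x e - int k * f e" for e
    have t: "0 \<le> t e" "t e \<le> int k" if "e \<in> {a, b}" for e using box[OF that] by (auto simp: t_def algebra_simps)
    let ?c = "f b - f a" and ?d = "2 * L - f a - f b"
    have cs: "t a - t b \<le> int k * ?c" "t a + t b \<le> int k * ?d"
      using x unfolding t_def by (simp_all add: algebra_simps)
    obtain s1 s2 where s: "s1 \<in> {0, 1}" "s2 \<in> {0, 1}"
      "0 \<le> t a - s1" "t a - s1 \<le> int k - 1" "0 \<le> t b - s2" "t b - s2 \<le> int k - 1"
      "s1 - s2 \<le> ?c" "s1 + s2 \<le> ?d" "(t a-s1) - (t b-s2) \<le> (int k-1) * ?c" "(t a-s1) + (t b-s2) \<le> (int k-1) * ?d"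
    proof -
      have k1: "1 \<le> int k" using k by simp
      have odd_indicator: "?c + ?d = 2 * (L - f a)" by simp
      have ins: "a \<in> {a, b}" "b \<in> {a, b}" by auto
      show ?thesis
        using loop_peel[OF k1 t(1)[OF ins(1)] t(2)[OF ins(1)] t(1)[OF ins(2)] t(2)[OF ins(2)] cs odd_indicator]
        by (elim exE conjE) (rule that; assumption)
    qed
    define u where "u e = (if e = a then f a + s1 else if e = b then f b + s2 else 0)" for e
    have u: "u a = f a + s1" "u b = f b + s2" using ab by (auto simp: u_def)
    have "u \<in> boxed f {a, b}" using s(1,2) u by (auto simp: boxed_def u_def)
    moreover have "u a \<le> u b \<and> u a + u b \<le> 2 * L * int 1" using s(7,8) unfolding u by simp
    moreover have "(x - u) a \<le> (x - u) b \<and> (x - u) a + (x - u) b \<le> 2 * L * int (k - 1)"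
      using s(9,10) k unfolding t_def by (simp add: u of_nat_diff algebra_simps)
    moreover have "\<forall>e\<in>{a, b}. int (k - 1) * f e \<le> x e - u e \<and> x e - u e \<le> int (k - 1) * (f e + 1)"
      using s(3-6) k unfolding t_def by (simp add: u of_nat_diff algebra_simps)
    ultimately show "\<exists>u\<in>boxed f {a, b}. (u a \<le> u b \<and> u a + u b \<le> 2 * L * int 1) \<and>
      ((x - u) a \<le> (x - u) b \<and> (x - u) a + (x - u) b \<le> 2 * L * int (k - 1)) \<and>
      (\<forall>e\<in>{a, b}. int (k - 1) * f e \<le> x e - u e \<and> x e - u e \<le> int (k - 1) * (f e + 1))" by blast
  qed
  then obtain M where M: "size M = m" "set_mset M \<subseteq> {y \<in> boxed f {a, b}. y a \<le> y b \<and> y a + y b \<le> 2 * L}" "\<Sum>\<^sub># M = restr {a, b} z"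
    by auto
  have "0 \<le> y a" if "y \<in># M" for y
  proof -
    have "y a \<in> {f a, f a + 1}" using M(2) that by (auto simp: boxed_def)
    then show ?thesis using fa by auto
  qed
  then show ?thesis using M unfolding f_def by (intro exI[of _ M]) auto
qed

section \<open>From multisets to algebras\<close>

lemma poly_mapping_sum_single:
  "p = (\<Sum>t\<in>Poly_Mapping.keys p. Poly_Mapping.single t (Poly_Mapping.lookup p t))"
proof (rule poly_mapping_eqI)
  fix t
  show "Poly_Mapping.lookup p t = Poly_Mapping.lookup (\<Sum>t\<in>Poly_Mapping.keys p. Poly_Mapping.single t (Poly_Mapping.lookup p t)) t"
    by (simp add: lookup_sum lookup_single when_def in_keys_iff)
qed

text \<open>Exponent functions and multisets of variables are two descriptions of a monomial; \<open>exponents\<close> and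
  \<open>monomial_of\<close> translate between them.\<close>

definition exponents :: "('w \<Rightarrow>\<^sub>0 nat) \<Rightarrow> 'w multiset" where
  "exponents t = Abs_multiset (Poly_Mapping.lookup t)"

lemma count_exponents [simp]: "count (exponents t) = Poly_Mapping.lookup t"
proof -
  have "finite {x. 0 < Poly_Mapping.lookup t x}" using finite_lookup[of t] by simp
  then show ?thesis unfolding exponents_def by (rule Abs_multiset_inverse[OF CollectI])
qed

lemma set_exponents [simp]: "set_mset (exponents t) = Poly_Mapping.keys t"
  by (auto simp: in_keys_iff simp flip: count_greater_zero_iff)

lemma exponents_add: "exponents (s + t) = exponents s + exponents t"
  by (rule multiset_eqI) (simp add: lookup_add)

lemma exponents_inject: "exponents s = exponents t \<Longrightarrow> s = t"
  by (metis count_exponents poly_mapping_eq_iff)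

definition monomial_of :: "'w multiset \<Rightarrow> 'w \<Rightarrow>\<^sub>0 nat" where
  "monomial_of M = Abs_poly_mapping (count M)"

lemma lookup_monomial_of [simp]: "Poly_Mapping.lookup (monomial_of M) = count M"
proof -
  have "finite {x. count M x \<noteq> 0}" using finite_set_mset[of M] unfolding set_mset_def by simp
  then show ?thesis unfolding monomial_of_def by simp
qed

lemma exponents_monomial_of [simp]: "exponents (monomial_of M) = M"
  by (rule multiset_eqI) simp

lemma monomial_of_exponents [simp]: "monomial_of (exponents t) = t"
  by (rule exponents_inject) simp

lemma monomial_of_add: "monomial_of (A + B) = monomial_of A + monomial_of B"
  by (rule exponents_inject) (simp add: exponents_add)

lemma keys_monomial_of [simp]: "Poly_Mapping.keys (monomial_of M) = set_mset M"
  by (metis exponents_monomial_of set_exponents)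

definition weight :: "('w::comm_monoid_add \<Rightarrow>\<^sub>0 nat) \<Rightarrow> nat \<times> 'w" where
  "weight t = (size (exponents t), \<Sum>\<^sub># (exponents t))"

lemma weight_add: "weight (s + t) = weight s + weight t"
  by (simp add: weight_def exponents_add)

lemma prod_mset_single:
  "(\<Prod>x\<in>#M. Poly_Mapping.single (1, x) (1 :: complex)) = Poly_Mapping.single (size M, \<Sum>\<^sub># M) 1"
  by (induction M) (simp_all add: mult_single zero_prod_def[symmetric] flip: single_one)

text \<open>The natural map sends a monomial to the basis element of its weight, that is, of its degree and the
  sum of its variables.\<close>

lemma natural_map_eq:
  fixes p :: "('w::comm_monoid_add \<Rightarrow>\<^sub>0 nat) \<Rightarrow>\<^sub>0 complex"
  shows "natural_map p = (\<Sum>t\<in>Poly_Mapping.keys p. Poly_Mapping.single (weight t) (Poly_Mapping.lookup p t))"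
  unfolding natural_map_def
proof (rule sum.cong[OF refl])
  fix t :: "'w \<Rightarrow>\<^sub>0 nat"
  have "(\<Prod>x\<in>Poly_Mapping.keys t. Poly_Mapping.single (1, x) (1 :: complex) ^ Poly_Mapping.lookup t x) = (\<Prod>x\<in>#exponents t. Poly_Mapping.single (1, x) 1)"
    by (simp add: image_prod_mset_multiplicity)
  also have "\<dots> = Poly_Mapping.single (weight t) 1" unfolding prod_mset_single weight_def ..
  finally show "Poly_Mapping.single 0 (Poly_Mapping.lookup p t) * (\<Prod>x\<in>Poly_Mapping.keys t. Poly_Mapping.single (1, x) 1 ^ Poly_Mapping.lookup t x)
    = Poly_Mapping.single (weight t) (Poly_Mapping.lookup p t)"
    by (simp add: mult_single)
qed

lemma natural_map_superset:
  assumes "finite A" "Poly_Mapping.keys p \<subseteq> A"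
  shows "natural_map p = (\<Sum>t\<in>A. Poly_Mapping.single (weight t) (Poly_Mapping.lookup p t))"
  unfolding natural_map_eq using assms by (intro sum.mono_neutral_left) (auto simp: in_keys_iff)

lemma natural_map_single: "natural_map (Poly_Mapping.single t c) = Poly_Mapping.single (weight t) c"
  using natural_map_superset[of "{t}" "Poly_Mapping.single t c"] by (simp split: if_splits)

lemma natural_map_add: "natural_map (p + q) = natural_map p + natural_map q"
proof -
  let ?A = "Poly_Mapping.keys p \<union> Poly_Mapping.keys q"
  have "natural_map (p + q) = (\<Sum>t\<in>?A. Poly_Mapping.single (weight t) (Poly_Mapping.lookup (p + q) t))"
    using keys_add[of p q] by (intro natural_map_superset) auto
  also have "\<dots> = natural_map p + natural_map q"
    by (subst (1 2) natural_map_superset[of ?A]) (auto simp: lookup_add single_add sum.distrib)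
  finally show ?thesis .
qed

lemma natural_map_sum: "natural_map (sum f A) = (\<Sum>a\<in>A. natural_map (f a))"
proof (induction A rule: infinite_finite_induct)
  case (insert a A)
  then show ?case by (simp add: natural_map_add)
qed (auto simp: natural_map_eq)

lemma natural_map_diff: "natural_map (p - q) = natural_map p - natural_map q"
  using natural_map_add[of "p - q" q] by (simp add: algebra_simps)

lemma natural_map_single_mult: "natural_map (Poly_Mapping.single s c * f) = Poly_Mapping.single (weight s) c * natural_map f"
proof -
  have "Poly_Mapping.single s c * f = (\<Sum>t\<in>Poly_Mapping.keys f. Poly_Mapping.single (s + t) (c * Poly_Mapping.lookup f t))"
    by (subst (1) poly_mapping_sum_single[of f]) (simp add: sum_distrib_left mult_single)
  then show ?thesis
    by (simp add: natural_map_sum natural_map_single natural_map_eq[of f] sum_distrib_left mult_single weight_add)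
qed

lemma natural_map_mult_zero:
  assumes "natural_map f = 0" shows "natural_map (h * f) = 0"
proof -
  have "h * f = (\<Sum>t\<in>Poly_Mapping.keys h. Poly_Mapping.single t (Poly_Mapping.lookup h t) * f)"
    by (subst (1) poly_mapping_sum_single[of h]) (simp add: sum_distrib_right)
  then show ?thesis using assms by (simp add: natural_map_sum natural_map_single_mult)
qed

lemma polynomials_on_closed:
  "0 \<in> polynomials_on X"
  "p \<in> polynomials_on X \<Longrightarrow> q \<in> polynomials_on X \<Longrightarrow> p + q \<in> polynomials_on X"
  "p \<in> polynomials_on X \<Longrightarrow> q \<in> polynomials_on X \<Longrightarrow> p * q \<in> polynomials_on X"
  "Poly_Mapping.keys t \<subseteq> X \<Longrightarrow> Poly_Mapping.single t c \<in> polynomials_on X"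
proof -
  show "0 \<in> polynomials_on X" by (simp add: polynomials_on_def)
  show "p \<in> polynomials_on X \<Longrightarrow> q \<in> polynomials_on X \<Longrightarrow> p + q \<in> polynomials_on X"
    using keys_add[of p q] unfolding polynomials_on_def by blast
  show "p * q \<in> polynomials_on X" if "p \<in> polynomials_on X" "q \<in> polynomials_on X"
    unfolding polynomials_on_def mem_Collect_eq
  proof
    fix t assume "t \<in> Poly_Mapping.keys (p * q)"
    then obtain a b where "t = a + b" "a \<in> Poly_Mapping.keys p" "b \<in> Poly_Mapping.keys q" using keys_mult[of p q] by blast
    then show "Poly_Mapping.keys t \<subseteq> X" using that keys_add[of a b] unfolding polynomials_on_def by blast
  qed
  show "Poly_Mapping.keys t \<subseteq> X \<Longrightarrow> Poly_Mapping.single t c \<in> polynomials_on X"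
    by (auto simp: polynomials_on_def split: if_splits)
qed

lemma ideal_in_relation_ideal: "ideal_in (polynomials_on (P \<inter> \<Lambda>)) (relation_ideal \<Lambda> P)"
  unfolding ideal_in_def relation_ideal_def
  using polynomials_on_closed[where X = "P \<inter> \<Lambda>"] 
  by (auto simp: natural_map_add natural_map_mult_zero natural_map_eq[of 0])

lemma ideal_in_sum:
  assumes "ideal_in R J" "\<And>a. a \<in> A \<Longrightarrow> f a \<in> J"
  shows "sum f A \<in> J"
  using assms(2)
proof (induction A rule: infinite_finite_induct)
  case (insert a A)
  then show ?case using assms(1) by (simp add: ideal_in_def)
qed (use assms(1) in \<open>auto simp: ideal_in_def\<close>)

definition exchange_binomials :: "'w::comm_monoid_add set \<Rightarrow> (('w \<Rightarrow>\<^sub>0 nat) \<Rightarrow>\<^sub>0 complex) set" where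
  "exchange_binomials X = {Poly_Mapping.single (monomial_of A) 1 - Poly_Mapping.single (monomial_of B) 1 | A B.
     set_mset A \<subseteq> X \<and> set_mset B \<subseteq> X \<and> size A = size B \<and> size A \<le> 3 \<and> \<Sum>\<^sub># A = \<Sum>\<^sub># B}"

lemma exchange_in_ideal:
  assumes J: "ideal_in (polynomials_on X) J" "exchange_binomials X \<subseteq> J" and ex: "exchange X M M'"
  shows "Poly_Mapping.single (monomial_of M) 1 - Poly_Mapping.single (monomial_of M') 1 \<in> J"
proof -
  obtain A B D where D: "M = A + D" "M' = B + D" "size A = size B" "size A \<le> 3" "\<Sum>\<^sub># A = \<Sum>\<^sub># B"
    "set_mset M \<subseteq> X" "set_mset M' \<subseteq> X" using ex unfolding exchange_def by metis
  let ?b = "Poly_Mapping.single (monomial_of A) 1 - Poly_Mapping.single (monomial_of B) 1 :: ('a \<Rightarrow>\<^sub>0 nat) \<Rightarrow>\<^sub>0 complex"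
  let ?d = "Poly_Mapping.single (monomial_of D) 1 :: ('a \<Rightarrow>\<^sub>0 nat) \<Rightarrow>\<^sub>0 complex"
  have "set_mset A \<subseteq> X" "set_mset B \<subseteq> X" using D by auto
  then have "?b \<in> exchange_binomials X" using D(3-5) unfolding exchange_binomials_def by blast
  then have "?b \<in> J" using J(2) by blast
  moreover have "?d \<in> polynomials_on X" using D by (intro polynomials_on_closed) auto
  ultimately have "?d * ?b \<in> J" using J(1) unfolding ideal_in_def by blast
  moreover have "?d * ?b = Poly_Mapping.single (monomial_of M) 1 - Poly_Mapping.single (monomial_of M') 1"
    unfolding D by (simp add: algebra_simps mult_single monomial_of_add)
  ultimately show ?thesis by simp
qed

lemma exchanges_in_ideal:
  assumes J: "ideal_in (polynomials_on X) J" "exchange_binomials X \<subseteq> J" and ex: "(exchange X)\<^sup>*\<^sup>* M M'"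
  shows "Poly_Mapping.single (monomial_of M) 1 - Poly_Mapping.single (monomial_of M') 1 \<in> J"
  using ex
proof induction
  case base
  then show ?case using J(1) by (simp add: ideal_in_def)
next
  case (step N N')
  have "(Poly_Mapping.single (monomial_of M) 1 - Poly_Mapping.single (monomial_of N) 1) + 
    (Poly_Mapping.single (monomial_of N) 1 - Poly_Mapping.single (monomial_of N') 1) \<in> J"
    using J(1) step.IH exchange_in_ideal[OF J step.hyps(2)] unfolding ideal_in_def by blast
  then show ?case by simp
qed

text \<open>Modulo \<open>J\<close> each monomial may be replaced by a fixed representative of its weight. The coefficients
  of \<open>p\<close> at monomials of one weight add up to a coefficient of \<open>natural_map p\<close>, hence to zero, and nothing
  remains of \<open>p\<close>.\<close>

lemma relation_ideal_subset:
  assumes conn: "exchange_connected (P \<inter> \<Lambda>)"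
    and J: "ideal_in (polynomials_on (P \<inter> \<Lambda>)) J" "exchange_binomials (P \<inter> \<Lambda>) \<subseteq> J"
  shows "relation_ideal \<Lambda> P \<subseteq> J"
proof
  let ?X = "P \<inter> \<Lambda>"
  fix p assume "p \<in> relation_ideal \<Lambda> P"
  then have p: "p \<in> polynomials_on ?X" "natural_map p = 0" by (auto simp: relation_ideal_def)
  let ?K = "Poly_Mapping.keys p" and ?c = "Poly_Mapping.lookup p"
  \<comment> \<open>The representative is itself a monomial of \<open>p\<close>, so its variables are points of \<open>P\<close>.\<close>
  define \<rho> where "\<rho> t = (SOME s. s \<in> ?K \<and> weight s = weight t)" for t
  have \<rho>: "\<rho> t \<in> ?K \<and> weight (\<rho> t) = weight t" if "t \<in> ?K" for t
    unfolding \<rho>_def by (rule someI[of _ t]) (use that in auto)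
  have \<rho>_cong: "\<rho> s = \<rho> t" if "weight s = weight t" for s t unfolding \<rho>_def that ..
  have zero: "(\<Sum>t\<in>?K. Poly_Mapping.single (\<rho> t) (?c t)) = 0"
  proof (rule poly_mapping_eqI)
    fix s
    have "Poly_Mapping.lookup (\<Sum>t\<in>?K. Poly_Mapping.single (\<rho> t) (?c t)) s = (\<Sum>t\<in>?K. if \<rho> t = s then ?c t else 0)"
      by (simp add: lookup_sum lookup_single when_def)
    also have "\<dots> = 0"
    proof (cases "\<exists>t\<in>?K. \<rho> t = s")
      case True
      then obtain t0 where t0: "t0 \<in> ?K" "\<rho> t0 = s" by auto
      have iff: "\<rho> t = s \<longleftrightarrow> weight t = weight t0" if "t \<in> ?K" for t
        using \<rho>[OF that] \<rho>[OF t0(1)] \<rho>_cong[of t t0] t0(2) by metis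
      have "(\<Sum>t\<in>?K. if \<rho> t = s then ?c t else 0) = (\<Sum>t\<in>?K. if weight t = weight t0 then ?c t else 0)"
        by (intro sum.cong refl) (use iff in auto)
      also have "\<dots> = Poly_Mapping.lookup (natural_map p) (weight t0)"
        unfolding natural_map_eq by (simp add: lookup_sum lookup_single when_def)
      finally show ?thesis using p(2) by simp
    next
      case False
      then show ?thesis by (intro sum.neutral) auto
    qed
    finally show "Poly_Mapping.lookup (\<Sum>t\<in>?K. Poly_Mapping.single (\<rho> t) (?c t)) s = Poly_Mapping.lookup 0 s" by simp
  qed
  have "p = (\<Sum>t\<in>?K. Poly_Mapping.single t (?c t)) - (\<Sum>t\<in>?K. Poly_Mapping.single (\<rho> t) (?c t))"
    unfolding zero using poly_mapping_sum_single[of p] by simp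
  also have "\<dots> = (\<Sum>t\<in>?K. Poly_Mapping.single 0 (?c t) * (Poly_Mapping.single t 1 - Poly_Mapping.single (\<rho> t) 1))"
    by (simp add: sum_subtractf[symmetric] algebra_simps mult_single)
  also have "\<dots> \<in> J"
  proof (rule ideal_in_sum[OF J(1)])
    fix t assume t: "t \<in> ?K"
    have sub: "Poly_Mapping.keys t \<subseteq> ?X" "Poly_Mapping.keys (\<rho> t) \<subseteq> ?X" using p(1) t \<rho>[OF t] by (auto simp: polynomials_on_def)
    have "weight t = weight (\<rho> t)" using \<rho>[OF t] by simp
    then have "(exchange ?X)\<^sup>*\<^sup>* (exponents t) (exponents (\<rho> t))"
      using conn sub unfolding exchange_connected_def weight_def by simp
    from exchanges_in_ideal[OF J this] 
    have "Poly_Mapping.single t 1 - Poly_Mapping.single (\<rho> t) 1 \<in> J" by simp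
    moreover have "Poly_Mapping.single 0 (?c t) \<in> polynomials_on ?X" by (intro polynomials_on_closed) simp
    ultimately show "Poly_Mapping.single 0 (?c t) * (Poly_Mapping.single t 1 - Poly_Mapping.single (\<rho> t) 1) \<in> J"
      using J(1) unfolding ideal_in_def by blast
  qed
  finally show "p \<in> J" .
qed

theorem relations_generated_if_connected:
  assumes conn: "exchange_connected (P \<inter> \<Lambda>)"
  shows "relations_generated_in_degree_le 3 \<Lambda> P"
  unfolding relations_generated_in_degree_le_def
proof (intro exI conjI ballI)
  let ?X = "P \<inter> \<Lambda>" and ?B = "exchange_binomials (P \<inter> \<Lambda>)"
  show "total_degree_le 3 p" if p: "p \<in> ?B" for p
    unfolding total_degree_le_def
  proof
    fix t assume t: "t \<in> Poly_Mapping.keys p"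
    obtain A B where AB: "p = Poly_Mapping.single (monomial_of A) 1 - Poly_Mapping.single (monomial_of B) 1"
      "size A = size B" "size A \<le> 3" using p unfolding exchange_binomials_def by blast
    have "t = monomial_of A \<or> t = monomial_of B" 
      using t unfolding AB(1) by (auto simp: in_keys_iff lookup_minus lookup_single when_def split: if_splits)
    then show "(\<Sum>x\<in>Poly_Mapping.keys t. Poly_Mapping.lookup t x) \<le> 3"
      using AB by (auto simp: size_multiset_overloaded_eq)
  qed
  show BR: "?B \<subseteq> polynomials_on ?X"
  proof
    fix p assume "p \<in> ?B"
    then obtain A B where "p = Poly_Mapping.single (monomial_of A) 1 + Poly_Mapping.single (monomial_of B) (-1)"
      "set_mset A \<subseteq> ?X" "set_mset B \<subseteq> ?X" unfolding exchange_binomials_def by (auto simp: single_uminus)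
    then show "p \<in> polynomials_on ?X" by (auto intro!: polynomials_on_closed)
  qed
  have "?B \<subseteq> relation_ideal \<Lambda> P"
  proof
    fix p assume p: "p \<in> ?B"
    then have "natural_map p = 0"
      unfolding exchange_binomials_def by (auto simp: natural_map_diff natural_map_single weight_def)
    then show "p \<in> relation_ideal \<Lambda> P" using p BR by (auto simp: relation_ideal_def)
  qed
  then have "ideal_in (polynomials_on ?X) hull ?B \<subseteq> relation_ideal \<Lambda> P"
    by (intro hull_minimal ideal_in_relation_ideal)
  moreover have "relation_ideal \<Lambda> P \<subseteq> ideal_in (polynomials_on ?X) hull ?B"
    unfolding hull_def using relation_ideal_subset[OF conn] by blast
  ultimately show "ideal_in (polynomials_on ?X) hull ?B = relation_ideal \<Lambda> P" by blast
qed

lemma graded_points_iff: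
  "(m, v) \<in> graded_points \<Lambda> P \<longleftrightarrow> (\<exists>p. (\<forall>i<m. p i \<in> P) \<and> v = sum p {..<m}) \<and> v \<in> \<Lambda>"
  unfolding graded_points_def by (auto simp: set_sum_alt)

lemma graded_points_add:
  assumes add: "\<And>x y. x \<in> \<Lambda> \<Longrightarrow> y \<in> \<Lambda> \<Longrightarrow> x + y \<in> \<Lambda>"
    and k: "k \<in> graded_points \<Lambda> P" "l \<in> graded_points \<Lambda> P"
  shows "k + l \<in> graded_points \<Lambda> P"
proof -
  obtain a x b y where kl: "k = (a, x)" "l = (b, y)" by (cases k; cases l)
  obtain p q where p: "\<forall>i<a. p i \<in> P" "x = sum p {..<a}" "x \<in> \<Lambda>" and q: "\<forall>i<b. q i \<in> P" "y = sum q {..<b}" "y \<in> \<Lambda>"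
    using k unfolding kl graded_points_iff by auto
  define r where "r i = (if i < a then p i else q (i - a))" for i
  have "sum r {..<a + b} = sum r {..<a} + sum r {a..<a + b}"
    by (metis atLeast0LessThan le0 le_add1 sum.atLeastLessThan_concat)
  also have "sum r {a..<a + b} = sum q {..<b}"
    using sum.shift_bounds_nat_ivl[of r 0 a b] by (simp add: r_def atLeast0LessThan add.commute)
  also have "sum r {..<a} = sum p {..<a}" by (simp add: r_def)
  finally have "sum r {..<a + b} = x + y" using p q by simp
  moreover have "\<forall>i<a + b. r i \<in> P" using p q by (auto simp: r_def)
  ultimately show ?thesis using add[OF p(3) q(3)] unfolding kl add_Pair graded_points_iff by auto
qed

theorem generated_if_decomposable:
  assumes add: "\<And>x y. x \<in> \<Lambda> \<Longrightarrow> y \<in> \<Lambda> \<Longrightarrow> x + y \<in> \<Lambda>" and zero: "0 \<in> \<Lambda>"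
    and dec: "\<And>m v. (m, v) \<in> graded_points \<Lambda> P \<Longrightarrow> \<exists>M. size M = m \<and> set_mset M \<subseteq> P \<inter> \<Lambda> \<and> \<Sum>\<^sub># M = v"
  shows "generated_in_degree_one \<Lambda> P"
  unfolding generated_in_degree_one_def
proof (rule hull_unique)
  let ?A = "polytope_algebra \<Lambda> P"
  show "graded_part \<Lambda> P 1 \<subseteq> ?A" by (auto simp: graded_part_def)
  have z: "0 \<in> graded_points \<Lambda> P" using zero by (simp add: zero_prod_def graded_points_iff)
  show "subalgebra ?A"
    unfolding subalgebra_def
  proof (intro conjI allI ballI)
    show "Poly_Mapping.single 0 c \<in> ?A" for c using z by (simp add: polytope_algebra_def)
    fix f g assume fg: "f \<in> ?A" "g \<in> ?A"
    show "f + g \<in> ?A" using fg keys_add[of f g] unfolding polytope_algebra_def by blast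
    show "f * g \<in> ?A" using fg keys_mult[of f g] graded_points_add[OF add] unfolding polytope_algebra_def by blast
  qed
  fix B assume B: "graded_part \<Lambda> P 1 \<subseteq> B" "subalgebra B"
  have "Poly_Mapping.single 0 0 \<in> B" using B(2) unfolding subalgebra_def by blast
  then have zB: "0 \<in> B" by simp
  have sumB: "sum f S \<in> B" if "\<And>s. s \<in> S \<Longrightarrow> f s \<in> B" for S and f :: "nat \<times> 'a \<Rightarrow> _"
    using that by (induction S rule: infinite_finite_induct) (use B(2) zB in \<open>auto simp: subalgebra_def\<close>)
  have mono: "Poly_Mapping.single (size M, \<Sum>\<^sub># M) 1 \<in> B" if "set_mset M \<subseteq> P \<inter> \<Lambda>" for M
    using that
  proof (induction M)
    case empty
    have "Poly_Mapping.single 0 1 \<in> B" using B(2) unfolding subalgebra_def by blast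
    then show ?case by (simp add: zero_prod_def)
  next
    case (add x M)
    have "(1, x) \<in> graded_points \<Lambda> P" using add.prems by (auto simp: graded_points_iff intro!: exI[of _ "\<lambda>_. x"])
    then have "Poly_Mapping.single (1, x) 1 \<in> B" using B(1) by (auto simp: graded_part_def polytope_algebra_def)
    moreover have "Poly_Mapping.single (size M, \<Sum>\<^sub># M) 1 \<in> B" using add by auto
    ultimately have "Poly_Mapping.single (1, x) 1 * Poly_Mapping.single (size M, \<Sum>\<^sub># M) 1 \<in> B"
      using B(2) unfolding subalgebra_def by blast
    then show ?case by (simp add: mult_single)
  qed
  show "?A \<subseteq> B"
  proof
    fix f assume f: "f \<in> ?A"
    have "Poly_Mapping.single k (Poly_Mapping.lookup f k) \<in> B" if k: "k \<in> Poly_Mapping.keys f" for k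
    proof -
      have "k \<in> graded_points \<Lambda> P" using f k by (auto simp: polytope_algebra_def)
      then obtain M where M: "size M = fst k" "set_mset M \<subseteq> P \<inter> \<Lambda>" "\<Sum>\<^sub># M = snd k"
        using dec[of "fst k" "snd k"] by auto
      have "Poly_Mapping.single 0 (Poly_Mapping.lookup f k) * Poly_Mapping.single k 1 \<in> B"
        using mono[OF M(2)] B(2) unfolding subalgebra_def M(1,3) by simp
      then show ?thesis by (simp add: mult_single)
    qed
    then have "(\<Sum>k\<in>Poly_Mapping.keys f. Poly_Mapping.single k (Poly_Mapping.lookup f k)) \<in> B" by (rule sumB)
    then show "f \<in> B" by (simp flip: poly_mapping_sum_single)
  qed
qed

section \<open>Trees built vertex by vertex\<close>

text \<open>A connected set of vertices together with the edges through which its vertices were reached.\<close>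

inductive grown :: "('v, 'e) mgraph \<Rightarrow> 'v set \<Rightarrow> 'e set \<Rightarrow> bool" for T where
  single: "v \<in> verts T \<Longrightarrow> grown T {v} {}"
| step: "grown T U F \<Longrightarrow> u \<in> U \<Longrightarrow> v \<in> verts T \<Longrightarrow> v \<notin> U \<Longrightarrow> e \<in> edges T \<Longrightarrow> ends T e = {#u, v#} \<Longrightarrow>
    grown T (insert v U) (insert e F)"

lemma grown_inside: "grown T U F \<Longrightarrow> e \<in> F \<Longrightarrow> set_mset (ends T e) \<subseteq> U"
  by (induction rule: grown.induct) auto

lemma grown_card: "grown T U F \<Longrightarrow> finite U \<and> finite F \<and> card U = card F + 1 \<and> U \<subseteq> verts T \<and> F \<subseteq> edges T \<and> U \<noteq> {}"
proof (induction rule: grown.induct)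
  case (step U F u v e)
  have "e \<notin> F" using grown_inside[OF step.hyps(1), of e] step.hyps(4,6) by auto
  then show ?case using step by auto
qed auto

lemma crossing_edge:
  assumes "graph T" "U \<subseteq> verts T" "U \<noteq> {}" "U \<noteq> verts T"
  shows "\<exists>u\<in>U. \<exists>v\<in>verts T - U. \<exists>e\<in>edges T. ends T e = {#u, v#}"
proof -
  let ?R = "{(x, y). \<exists>e\<in>edges T. ends T e = {#x, y#}}"
  obtain a b where ab: "a \<in> U" "b \<in> verts T" "b \<notin> U" using assms by blast
  have "(a, b) \<in> ?R\<^sup>*" using assms(1,2) ab unfolding graph_def connected_graph_def by blast
  then have "b \<notin> U \<longrightarrow> (\<exists>x y. x \<in> U \<and> y \<notin> U \<and> (x, y) \<in> ?R)"
    by (induction rule: rtrancl_induct) (use ab(1) in blast)+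
  then obtain x y e where xy: "x \<in> U" "y \<notin> U" "e \<in> edges T" "ends T e = {#x, y#}" using ab(3) by blast
  then have "y \<in> verts T" using assms(1) unfolding graph_def by fastforce
  then show ?thesis using xy by blast
qed

lemma grown_extend:
  assumes "graph T" "grown T U F"
  shows "\<exists>F'. grown T (verts T) F' \<and> F \<subseteq> F' \<and> (\<forall>e\<in>F' - F. \<not> set_mset (ends T e) \<subseteq> U)"
  using assms(2)
proof (induction "card (verts T - U)" arbitrary: U F rule: less_induct)
  case less
  note U = grown_card[OF less.prems]
  show ?case
  proof (cases "U = verts T")
    case True
    then show ?thesis using less.prems by (intro exI[of _ F]) simp
  next
    case False
    have "U \<subseteq> verts T" "U \<noteq> {}" using U by simp_all
    from crossing_edge[OF assms(1) this False] 
    obtain u v e where e: "u \<in> U" "v \<in> verts T - U" "e \<in> edges T" "ends T e = {#u, v#}" by blast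
    have g: "grown T (insert v U) (insert e F)" using less.prems e by (intro grown.step) auto
    have "finite (verts T)" using assms(1) by (simp add: graph_def)
    then have "card (verts T - insert v U) < card (verts T - U)" using e(2) by (intro psubset_card_mono) auto
    from less.hyps[OF this g] obtain F' where F': "grown T (verts T) F'" "insert e F \<subseteq> F'"
      "\<forall>e'\<in>F' - insert e F. \<not> set_mset (ends T e') \<subseteq> insert v U" by blast
    have "\<not> set_mset (ends T e') \<subseteq> U" if "e' \<in> F' - F" for e'
      using F'(3) that e by (cases "e' = e") auto
    then show ?thesis using F' by blast
  qed
qed

text \<open>Reaching all vertices takes one edge less than there are vertices, so all edges are used in the end.
  Those added after \<open>U\<close> was reached have an end outside \<open>U\<close>.\<close>

lemma grown_all_edges:
  assumes T: "graph T" "card (edges T) + 1 \<le> card (verts T)" and g: "grown T U F"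
    and e: "e \<in> edges T" "set_mset (ends T e) \<subseteq> U"
  shows "e \<in> F"
proof -
  obtain F' where F': "grown T (verts T) F'" "F \<subseteq> F'" "\<forall>e\<in>F' - F. \<not> set_mset (ends T e) \<subseteq> U"
    using grown_extend[OF T(1) g] by blast
  have "F' = edges T" using grown_card[OF F'(1)] T unfolding graph_def by (intro card_seteq) auto
  then show ?thesis using F'(3) e by blast
qed

lemma acyclic_no_loop:
  assumes T: "graph T" "card (edges T) + 1 \<le> card (verts T)" and e: "e \<in> edges T"
  shows "ends T e \<noteq> {#v, v#}"
proof
  assume ends: "ends T e = {#v, v#}"
  then have "v \<in> verts T" using e T(1) unfolding graph_def by fastforce
  from grown_all_edges[OF T grown.single[OF this] e] ends show False by simp
qed

text \<open>A new vertex is joined to the set reached so far only by the edge that led to it, by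
  \<open>grown_all_edges\<close>. Edges in a single star, such as loops, never count.\<close>

lemma tree_built_acyclic:
  fixes star :: "'v \<Rightarrow> 'e set"
  assumes T: "graph T" "card (edges T) + 1 \<le> card (verts T)"
    and star: "\<And>u v e. u \<noteq> v \<Longrightarrow> e \<in> star u \<Longrightarrow> e \<in> star v \<Longrightarrow> e \<in> edges T \<and> ends T e = {#u, v#}"
  shows "tree_built star (verts T)"
proof -
  have *: "tree_built star U" if "grown T U F" for U F
    using that
  proof (induction rule: grown.induct)
    case (single v)
    have "tree_built star (insert v {})" by (rule tree_built.insert[OF tree_built.empty]) auto
    then show ?case by simp
  next
    case (step U F u v e)
    have g: "grown T (insert v U) (insert e F)" by (rule grown.step[OF step.hyps])
    have "\<Union>(star ` U) \<inter> star v \<subseteq> {e}"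
    proof
      fix x assume "x \<in> \<Union>(star ` U) \<inter> star v"
      then obtain w where w: "w \<in> U" "x \<in> star w" "x \<in> star v" by auto
      then have x: "x \<in> edges T" "ends T x = {#w, v#}" using star[of w v x] step.hyps(4) by auto
      have "x \<in> insert e F" using w(1) x by (intro grown_all_edges[OF T g]) auto
      moreover have "x \<notin> F" using grown_inside[OF step.hyps(1), of x] x(2) step.hyps(4) by auto
      ultimately show "x \<in> {e}" by simp
    qed
    then show ?case using step by (intro tree_built.insert)
  qed
  obtain v where "v \<in> verts T" using T(1) unfolding graph_def connected_graph_def by auto
  from grown_extend[OF T(1) grown.single[OF this]] show ?thesis using * by blast
qed

text \<open>A property that each node passes on to an edge from all its other edges spreads over the tree, if it
  holds for the edges that belong to a single star. The node added last has at most one edge in common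
  with the others, so the induction strips nodes from the outside.\<close>

lemma tree_built_propagate:
  assumes "tree_built star U"
    and "\<And>v e. v \<in> U \<Longrightarrow> e \<in> star v \<Longrightarrow> star v - {e} \<subseteq> good \<Longrightarrow> e \<in> good"
    and "\<And>e. e \<in> \<Union>(star ` U) \<Longrightarrow> (\<And>v v'. v \<in> U \<Longrightarrow> v' \<in> U \<Longrightarrow> e \<in> star v \<Longrightarrow> e \<in> star v' \<Longrightarrow> v = v') \<Longrightarrow> e \<in> good"
  shows "\<Union>(star ` U) \<subseteq> good"
  using assms
proof (induction rule: tree_built.induct)
  case (insert U v e0)
  have only: "e \<in> good" if "e \<in> star v" "e \<notin> \<Union>(star ` U)" for e
    using that by (intro insert.prems(2)) blast+
  have v: "star v \<subseteq> good"
  proof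
    fix e assume e: "e \<in> star v"
    show "e \<in> good"
    proof (cases "e \<in> \<Union>(star ` U)")
      case True
      then have "e = e0" using insert.hyps(3) e by blast
      have "star v - {e} \<subseteq> good" using only insert.hyps(3) \<open>e = e0\<close> by blast
      then show ?thesis using insert.prems(1)[OF _ e] by simp
    next
      case False
      then show ?thesis using only e by auto
    qed
  qed
  have "\<Union>(star ` U) \<subseteq> good"
  proof (rule insert.IH)
    show "e \<in> good" if "u \<in> U" "e \<in> star u" "star u - {e} \<subseteq> good" for u e
      using insert.prems(1)[OF _ that(2,3)] that(1) by simp
    show "e \<in> good" if "e \<in> \<Union>(star ` U)" "\<And>u u'. u \<in> U \<Longrightarrow> u' \<in> U \<Longrightarrow> e \<in> star u \<Longrightarrow> e \<in> star u' \<Longrightarrow> u = u'" for e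
    proof (cases "e \<in> star v")
      case True then show ?thesis using v by auto
    next
      case False
      then show ?thesis using that by (intro insert.prems(2)) blast+
    qed
  qed
  then show ?case using v by auto
qed auto

section \<open>Tree-like graphs\<close>

lemma count_incident:
  "finite (edges G) \<Longrightarrow> count (incident G v) e = (if e \<in> edges G then count (ends G e) v else 0)"
  by (simp add: incident_def count_sum)

lemma size3_mset:
  assumes "size M = 3" shows "\<exists>a b c. M = {#a, b, c#}"
proof -
  obtain a N where N: "M = add_mset a N" using assms by (metis numeral_3_eq_3 size_eq_Suc_imp_eq_union)
  then have "size N = Suc 1" using assms by simp
  then obtain b K where K: "N = add_mset b K" by (metis size_eq_Suc_imp_eq_union)
  then obtain c where "K = {#c#}" using N assms size_1_singleton_mset[of K] by auto
  then show ?thesis using N K by auto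
qed

text \<open>Acyclicity of \<open>T\<close> is expressed by the Euler characteristic.\<close>

locale tree_with_loops =
  fixes G T :: "('v, 'e) mgraph" and S :: "'v set" and l :: "'v \<Rightarrow> 'e"
  assumes triv: "trivalent G" and T: "graph T" "card (edges T) + 1 \<le> card (verts T)"
    and S: "S \<subseteq> verts G" and inj_l: "inj_on l S" and disj: "l ` S \<inter> edges T = {}"
    and verts: "verts G = verts T" and edges: "edges G = edges T \<union> l ` S"
    and ends_T: "\<And>e. e \<in> edges T \<Longrightarrow> ends G e = ends T e" and ends_l: "\<And>v. v \<in> S \<Longrightarrow> ends G (l v) = {#v, v#}"
begin

definition star :: "'v \<Rightarrow> 'e set" where
  "star v = {e \<in> edges G. v \<in># ends G e}"

lemma fin: "finite (verts G)" "finite (edges G)"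
  using triv by (auto simp: trivalent_def graph_def)

lemma set_incident: "set_mset (incident G v) = star v"
  by (auto simp: star_def count_incident[OF fin(2)] simp flip: count_greater_zero_iff split: if_splits)

lemma ends_tree:
  assumes "e \<in> edges T"
  shows "\<exists>u w. u \<noteq> w \<and> u \<in> verts G \<and> w \<in> verts G \<and> ends G e = {#u, w#}"
proof -
  have e: "size (ends T e) = 2" "set_mset (ends T e) \<subseteq> verts T" using T(1) assms by (auto simp: graph_def)
  obtain u C where "ends T e = add_mset u C" using e(1) by (metis numeral_2_eq_2 size_eq_Suc_imp_eq_union)
  then obtain w where w: "ends T e = {#u, w#}" using e(1) size_1_singleton_mset[of C] by auto
  then have "u \<noteq> w" using acyclic_no_loop[OF T assms] by auto
  then show ?thesis using w e(2) ends_T[OF assms] verts by auto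
qed

lemma ends_tree_at:
  assumes "e \<in> edges T" "u \<in># ends G e" "v \<in># ends G e" "u \<noteq> v"
  shows "ends G e = {#u, v#}"
  using ends_tree[OF assms(1)] assms by (auto simp: add_mset_commute)

lemma edge_cases:
  assumes "e \<in> edges G"
  obtains "e \<in> edges T" | v where "v \<in> S" "e = l v" "e \<notin> edges T" "ends G e = {#v, v#}"
  using assms edges ends_l disj by blast

lemma star_shared:
  assumes "u \<noteq> v" "e \<in> star u" "e \<in> star v"
  shows "e \<in> edges T \<and> ends T e = {#u, v#}"
proof -
  have "e \<in> edges G" "u \<in># ends G e" "v \<in># ends G e" using assms by (auto simp: star_def)
  then show ?thesis using assms(1) ends_tree_at[of e u v] ends_T[of e] by (cases rule: edge_cases) auto
qed

lemma tree_built_star: "tree_built star (verts G)"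
  unfolding verts by (rule tree_built_acyclic[OF T]) (use star_shared in blast)

lemma Union_star: "\<Union>(star ` verts G) = edges G"
proof
  show "edges G \<subseteq> \<Union>(star ` verts G)"
  proof
    fix e assume e: "e \<in> edges G"
    then have "size (ends G e) = 2" "set_mset (ends G e) \<subseteq> verts G" using triv by (auto simp: trivalent_def graph_def)
    then obtain v where "v \<in># ends G e" "v \<in> verts G" by (metis multiset_nonemptyE size_empty subsetD zero_neq_numeral)
    then show "e \<in> \<Union>(star ` verts G)" using e by (auto simp: star_def)
  qed
qed (auto simp: star_def)

lemma size_incident: "v \<in> verts G \<Longrightarrow> v \<in> trinodes G \<and> size (incident G v) = 3 \<or> v \<in> leaves G \<and> size (incident G v) = 1"
  using triv by (auto simp: trivalent_def trinodes_def leaves_def valence_def)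

lemma leaf_not_trinode: "v \<in> leaves G \<Longrightarrow> v \<notin> trinodes G"
  by (auto simp: trinodes_def leaves_def)

lemma incident_at_loop:
  assumes v: "v \<in> S"
  shows "v \<in> trinodes G \<and> (\<exists>e\<in>edges T. incident G v = {#e, l v, l v#})"
proof -
  have lE: "l v \<in> edges G" using v edges by auto
  have c: "count (incident G v) (l v) = 2" using lE v by (simp add: count_incident[OF fin(2)] ends_l)
  have "count (incident G v) (l v) \<le> size (incident G v)" by (rule count_le_size)
  then have tri: "v \<in> trinodes G" "size (incident G v) = 3" using size_incident[of v] c v S by auto
  have "{#l v, l v#} \<subseteq># incident G v" using c by (auto simp: subseteq_mset_def)
  then obtain C where C: "incident G v = {#l v, l v#} + C" by (auto simp: mset_subset_eq_exists_conv)
  then obtain e where "C = {#e#}" using tri(2) size_1_singleton_mset[of C] by auto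
  then have e: "incident G v = {#e, l v, l v#}" using C by (simp add: add_mset_commute)
  then have ne: "e \<noteq> l v" using c by auto
  have "e \<in> star v" using set_incident[of v] e by auto
  then have eG: "e \<in> edges G" "v \<in># ends G e" by (auto simp: star_def)
  then have "e \<in> edges T" using ne by (cases rule: edge_cases) auto
  then show ?thesis using e tri by auto
qed

lemma incident_off_loop:
  assumes v: "v \<in> verts G" "v \<notin> S" and e: "e \<in># incident G v"
  shows "e \<in> edges T" "count (incident G v) e = 1"
proof -
  have "e \<in> star v" using set_incident e by auto
  then have eG: "e \<in> edges G" "v \<in># ends G e" by (auto simp: star_def)
  then show eT: "e \<in> edges T" using v by (cases rule: edge_cases) auto
  from ends_tree[OF eT] show "count (incident G v) e = 1" using eG by (auto simp: count_incident[OF fin(2)])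
qed

lemma incident_at_leaf:
  assumes v: "v \<in> leaves G"
  shows "\<exists>e\<in>edges T. incident G v = {#e#}"
proof -
  have "v \<in> verts G" "size (incident G v) = 1" "v \<notin> S"
    using v leaf_not_trinode[OF v] incident_at_loop by (auto simp: leaves_def valence_def)
  then obtain e where e: "incident G v = {#e#}" using size_1_singleton_mset by metis
  then show ?thesis using incident_off_loop(1)[of v e] \<open>v \<in> verts G\<close> \<open>v \<notin> S\<close> by auto
qed

lemma incident_at_branch:
  assumes v: "v \<in> trinodes G" "v \<notin> S"
  shows "\<exists>a b c. a \<in> edges T \<and> b \<in> edges T \<and> c \<in> edges T \<and> a \<noteq> b \<and> a \<noteq> c \<and> b \<noteq> c \<and> incident G v = {#a, b, c#}"
proof -
  have vG: "v \<in> verts G" and "size (incident G v) = 3" using v by (auto simp: trinodes_def valence_def)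
  then obtain a b c where abc: "incident G v = {#a, b, c#}" using size3_mset by blast
  note i = incident_off_loop[OF vG v(2), unfolded abc]
  have "a \<noteq> b" "a \<noteq> c" "b \<noteq> c" using i(2)[of a] i(2)[of b] by (auto split: if_splits)
  then show ?thesis using i(1)[of a] i(1)[of b] i(1)[of c] abc by auto
qed

lemma vertex_cases [consumes 1, case_names leaf loop branch]:
  assumes "v \<in> verts G"
  obtains e where "v \<in> leaves G" "e \<in> edges T" "incident G v = {#e#}" "star v = {e}"
  | e where "v \<in> S" "v \<in> trinodes G" "e \<in> edges T" "l v \<notin> edges T" "l v \<in> edges G" "incident G v = {#e, l v, l v#}" "star v = {e, l v}"
  | a b c where "v \<notin> S" "v \<in> trinodes G" "a \<in> edges T" "b \<in> edges T" "c \<in> edges T" "a \<noteq> b" "a \<noteq> c" "b \<noteq> c" 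
     "incident G v = {#a, b, c#}" "star v = {a, b, c}"
proof (cases "v \<in> leaves G")
  case True
  then show ?thesis using that(1) incident_at_leaf[of v] set_incident[of v] by auto
next
  case False
  then have tri: "v \<in> trinodes G" using size_incident[OF assms] by auto
  show ?thesis
  proof (cases "v \<in> S")
    case True
    have "l v \<notin> edges T" "l v \<in> edges G" using True disj edges by auto
    then show ?thesis using that(2) incident_at_loop[OF True] set_incident[of v] True by auto
  next
    case False
    then show ?thesis using that(3) incident_at_branch[OF tri False] set_incident[of v] tri by auto
  qed
qed

lemma leaf_edge:
  assumes v: "v \<in> leaves G"
  shows "star v = {leaf_edge G v}" "leaf_edge G v \<in> edges T" "v \<in># ends G (leaf_edge G v)"
proof -
  obtain e where e: "e \<in> edges T" "incident G v = {#e#}" using incident_at_leaf[OF v] by auto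
  have star: "star v = {e}" using set_incident[of v] e by auto
  then have "leaf_edge G v = e" unfolding leaf_edge_def star_def by (intro the_equality) auto
  then show "star v = {leaf_edge G v}" "leaf_edge G v \<in> edges T" "v \<in># ends G (leaf_edge G v)"
    using star e by (auto simp: star_def)
qed

end

locale weighted_tree_with_loops = tree_with_loops +
  fixes n :: nat and lab :: "nat \<Rightarrow> 'a" and r :: "nat \<Rightarrow> nat" and L :: nat
  assumes lab: "leaf_labeling G n lab" and L: "L > 1" and compat: "compatible G n lab r"
begin

abbreviation LE :: "nat \<Rightarrow> 'b" where "LE i \<equiv> leaf_edge G (lab i)"

definition odd_edges :: "'b set" where
  "odd_edges = {LE i | i. i \<in> {1..n} \<and> odd (r i)}"

definition odd_indicator :: "'b \<Rightarrow> int" where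
  "odd_indicator e = (if e \<in> odd_edges then 1 else 0)"

lemma lab_leaf: "i \<in> {1..n} \<Longrightarrow> lab i \<in> leaves G"
  using lab unfolding leaf_labeling_def by (rule bij_betw_apply)

lemma lab_inj: "i \<in> {1..n} \<Longrightarrow> j \<in> {1..n} \<Longrightarrow> lab i = lab j \<Longrightarrow> i = j"
  using lab unfolding leaf_labeling_def bij_betw_def inj_on_def by blast

lemma odd_edges_tree: "odd_edges \<subseteq> edges T"
  using leaf_edge(2)[OF lab_leaf] unfolding odd_edges_def by blast

lemma LE_eqI:
  assumes "i \<in> {1..n}" "e \<in> edges G" "lab i \<in># ends G e" shows "LE i = e"
proof -
  have "e \<in> star (lab i)" using assms by (simp add: star_def)
  then show ?thesis unfolding leaf_edge(1)[OF lab_leaf[OF assms(1)]] by simp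
qed

lemma LE_edge: "i \<in> {1..n} \<Longrightarrow> LE i \<in> edges G \<and> LE i \<in> edges T \<and> lab i \<in># ends G (LE i)"
  unfolding edges using leaf_edge(2,3)[OF lab_leaf, of i] by blast

lemma partner:
  assumes "i \<in> {1..n}" "odd (r i)"
  obtains j where "j \<in> {1..n}" "j \<noteq> i" "odd (r j)" "set_mset (ends G (LE i)) \<inter> set_mset (ends G (LE j)) \<noteq> {}"
    "\<forall>k. k \<in> {1..n} \<and> k \<noteq> i \<and> odd (r k) \<and> set_mset (ends G (LE i)) \<inter> set_mset (ends G (LE k)) \<noteq> {} \<longrightarrow> k = j"
proof -
  define P where "P j \<longleftrightarrow> j \<in> {1..n} \<and> j \<noteq> i \<and> odd (r j) \<and> set_mset (ends G (LE i)) \<inter> set_mset (ends G (LE j)) \<noteq> {}" for j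
  have "\<exists>!j. P j"
    unfolding P_def using compat[unfolded compatible_def, THEN bspec, OF assms(1), THEN mp, OF assms(2)] .
  then obtain j where j: "P j" and u: "\<forall>k. P k \<longrightarrow> k = j" by blast
  show ?thesis by (rule that[OF _ _ _ _ u[unfolded P_def]]) (use j[unfolded P_def] in blast)+
qed

text \<open>The partner of an odd leaf edge shares its inner vertex, since an edge that shares the leaf would be
  the same edge. By uniqueness of the partner no third odd edge meets this vertex.\<close>

lemma odd_partner:
  assumes v: "v \<in> trinodes G" and e: "e \<in> odd_edges" "e \<in> star v"
  shows "\<exists>e'. e' \<noteq> e \<and> star v \<inter> odd_edges = {e, e'}"
proof -
  obtain i where i: "i \<in> {1..n}" "odd (r i)" "e = LE i" using e(1) unfolding odd_edges_def by blast
  have iv: "lab j \<noteq> v" if "j \<in> {1..n}" for j using leaf_not_trinode[OF lab_leaf[OF that]] v by blast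
  have ends: "ends G e = {#lab i, v#}" 
  proof (intro ends_tree_at)
    show "e \<in> edges T" "lab i \<in># ends G e" unfolding i(3) using LE_edge[OF i(1)] by blast+
    show "v \<in># ends G e" using e(2) by (simp add: star_def)
    show "lab i \<noteq> v" by (rule iv[OF i(1)])
  qed
  have key: "LE k \<in> star v \<and> LE k \<noteq> e" if k: "k \<in> {1..n}" "k \<noteq> i" "set_mset (ends G e) \<inter> set_mset (ends G (LE k)) \<noteq> {}" for k
  proof -
    have ne: "LE k \<noteq> e"
    proof
      assume "LE k = e"
      moreover have "lab k \<in># ends G (LE k)" using LE_edge[OF k(1)] by blast
      ultimately have "lab k \<in># {#lab i, v#}" using ends by simp
      then have "lab k \<in> {lab i, v}" by simp
      then show False using iv[OF k(1)] lab_inj[OF k(1) i(1)] k(2) by blast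
    qed
    have "LE k \<in> edges G" using LE_edge[OF k(1)] by blast
    then have "lab i \<notin># ends G (LE k)" using LE_eqI[OF i(1), of "LE k"] ne i(3) by argo
    moreover obtain x where "x \<in># ends G e" "x \<in># ends G (LE k)" using k(3) by blast
    ultimately have "v \<in># ends G (LE k)" unfolding ends by auto
    then show ?thesis using ne \<open>LE k \<in> edges G\<close> by (simp add: star_def)
  qed
  obtain j where j: "j \<in> {1..n}" "j \<noteq> i" "odd (r j)" "set_mset (ends G e) \<inter> set_mset (ends G (LE j)) \<noteq> {}"
    "\<forall>k. k \<in> {1..n} \<and> k \<noteq> i \<and> odd (r k) \<and> set_mset (ends G e) \<inter> set_mset (ends G (LE k)) \<noteq> {} \<longrightarrow> k = j"
    by (rule partner[OF i(1,2), folded i(3)]) blast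
  have "x \<in> {e, LE j}" if x: "x \<in> star v" "x \<in> odd_edges" for x
  proof (cases "x = e")
    case False
    obtain k where k: "k \<in> {1..n}" "odd (r k)" "x = LE k" using x(2) unfolding odd_edges_def by blast
    have "v \<in># ends G (LE k)" using x(1) k(3) by (simp add: star_def)
    then have "set_mset (ends G e) \<inter> set_mset (ends G (LE k)) \<noteq> {}" using ends by auto
    moreover have "k \<noteq> i" using False k(3) i(3) by auto
    ultimately have "k = j" using j(5) k(1,2) by blast
    then show ?thesis using k by auto
  qed auto
  moreover have "LE j \<in> odd_edges" using j(1,3) unfolding odd_edges_def by blast
  moreover have k: "LE j \<in> star v" "LE j \<noteq> e" using key[OF j(1,2,4)] by blast+
  ultimately have "star v \<inter> odd_edges = {e, LE j}" using e by blast
  then show ?thesis using k(2) by blast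
qed

text \<open>Two labels belong to the same leaf edge only if the graph is a single edge. In that case the partner
  of an odd label is the other label.\<close>

lemma leaf_parity:
  assumes i: "i \<in> {1..n}" shows "odd (r i) \<longleftrightarrow> LE i \<in> odd_edges"
proof
  assume "LE i \<in> odd_edges"
  then obtain j where j: "j \<in> {1..n}" "odd (r j)" "LE i = LE j" unfolding odd_edges_def by blast
  show "odd (r i)"
  proof (cases "i = j")
    case False
    then have "lab i \<noteq> lab j" using lab_inj i j by blast
    then have ends: "ends G (LE j) = {#lab i, lab j#}" 
      using LE_edge[OF i] LE_edge[OF j(1)] unfolding j(3) by (intro ends_tree_at) blast+
    obtain k where k: "k \<in> {1..n}" "k \<noteq> j" "odd (r k)" "set_mset (ends G (LE j)) \<inter> set_mset (ends G (LE k)) \<noteq> {}"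
      by (rule partner[OF j(1,2)])
    have kG: "LE k \<in> edges G" "lab k \<in># ends G (LE k)" using LE_edge[OF k(1)] by blast+
    have "lab i \<in># ends G (LE k) \<or> lab j \<in># ends G (LE k)" using k(4) ends by auto
    then have "LE k = LE j" using LE_eqI[OF i kG(1)] LE_eqI[OF j(1) kG(1)] j(3) by argo
    then have "lab k \<in># ends G (LE j)" using kG(2) by simp
    then have "lab k = lab i \<or> lab k = lab j" unfolding ends by simp
    then have "k = i" using lab_inj[OF k(1) i] lab_inj[OF k(1) j(1)] k(2) by blast
    then show ?thesis using k(3) by simp
  qed (use j in simp)
qed (use i in \<open>unfold odd_edges_def, blast\<close>)

lemma loop_not_odd:
  assumes "v \<in> S" "e \<in> star v" shows "e \<notin> odd_edges"
proof
  assume e: "e \<in> odd_edges"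
  have v: "v \<in> trinodes G" "v \<in> verts G" using incident_at_loop[OF assms(1)] by (auto simp: trinodes_def)
  obtain e' where e': "e' \<noteq> e" "star v \<inter> odd_edges = {e, e'}" using odd_partner[OF v(1) e assms(2)] by auto
  obtain x where x: "star v = {x, l v}" using v(2)
    by (cases rule: vertex_cases) (use leaf_not_trinode v(1) assms(1) in auto)
  have "l v \<notin> odd_edges" using odd_edges_tree disj assms(1) by auto
  then show False using e' x by auto
qed

lemma branch_parity:
  assumes v: "v \<in> trinodes G" and star: "star v = {a, b, c}" "a \<noteq> b" "a \<noteq> c" "b \<noteq> c"
  shows "odd_indicator a + odd_indicator b + odd_indicator c = 0 \<or> odd_indicator a + odd_indicator b + odd_indicator c = 2"
proof (cases "star v \<inter> odd_edges = {}")
  case True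
  then show ?thesis using star by (auto simp: odd_indicator_def)
next
  case False
  then obtain e e' where ne: "e' \<noteq> e" and eq: "star v \<inter> odd_edges = {e, e'}" using odd_partner[OF v] by blast
  have odd_indicator: "odd_indicator x = (if x = e \<or> x = e' then 1 else 0)" if "x \<in> {a, b, c}" for x
    using eq that unfolding star(1) odd_indicator_def by (intro if_cong) blast+
  have "e \<in> {a, b, c}" "e' \<in> {a, b, c}" using eq unfolding star(1) by blast+
  then show ?thesis using star(2-4) ne odd_indicator[of a] odd_indicator[of b] odd_indicator[of c] by (elim insertE emptyE) simp_all
qed

end

section \<open>Half-weights\<close>

lemma triangle_perm:
  assumes "{#a, b, c#} = {#a', b', c'#}" "triangle K (h a) (h b) (h c)"
  shows "triangle K (h a') (h b') (h c')"
proof -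
  have pair: "x' = x \<and> y' = y \<or> x' = y \<and> y' = x" if "{#x', y'#} = {#x, y#}" for x y x' y' :: 'a
    using that by (metis add_mset_eq_single add_mset_remove_trivial insert_noteq_member diff_union_swap add_mset_eq_singleton_iff)
  have "a' \<in># {#a, b, c#}" unfolding assms(1) by simp
  then consider "a' = a" | "a' = b" | "a' = c" by auto
  then show ?thesis
  proof cases
    case 1
    then have "{#b', c'#} = {#b, c#}" using assms(1) by simp
    from pair[OF this] show ?thesis using assms(2) 1 unfolding triangle_def by (elim disjE conjE) simp_all
  next
    case 2
    have "{#a, b, c#} = add_mset b {#a, c#}" by (rule add_mset_commute)
    then have "{#b', c'#} = {#a, c#}" using assms(1) 2 by simp
    from pair[OF this] show ?thesis using assms(2) 2 unfolding triangle_def by (elim disjE conjE) simp_all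
  next
    case 3
    have "{#a, b, c#} = add_mset c {#a, b#}" by (simp add: add_mset_commute)
    then have "{#b', c'#} = {#a, b#}" using assms(1) 3 by simp
    from pair[OF this] show ?thesis using assms(2) 3 unfolding triangle_def by (elim disjE conjE) simp_all
  qed
qed

context weighted_tree_with_loops
begin

text \<open>The weight at level \<open>m\<close> that belongs to the coordinates \<open>z\<close>. On an odd leaf edge the parity of the
  weight is that of \<open>m\<close>; loops are not halved.\<close>

definition edge_weight :: "nat \<Rightarrow> ('b \<Rightarrow> int) \<Rightarrow> 'b \<Rightarrow> int" where
  "edge_weight m z e = (if e \<in> edges T then 2 * z e + int m * odd_indicator e else z e)"

definition admissible :: "'a \<Rightarrow> nat \<Rightarrow> ('b \<Rightarrow> int) \<Rightarrow> bool" where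
  "admissible v m z \<longleftrightarrow> (\<forall>a b c. incident G v = {#a, b, c#} \<longrightarrow> triangle (4 * int L * int m) (edge_weight m z a) (edge_weight m z b) (edge_weight m z c)) \<and>
     (\<forall>i\<in>{1..n}. LE i \<in> star v \<longrightarrow> edge_weight m z (LE i) = int m * int (r i))"

lemma admissibleI:
  assumes "incident G v = {#a, b, c#}" "triangle (4 * int L * int m) (edge_weight m z a) (edge_weight m z b) (edge_weight m z c)"
    "\<And>i. i \<in> {1..n} \<Longrightarrow> LE i \<in> star v \<Longrightarrow> edge_weight m z (LE i) = int m * int (r i)"
  shows "admissible v m z"
  unfolding admissible_def
proof (intro conjI allI impI ballI)
  fix a' b' c' assume "incident G v = {#a', b', c'#}"
  then show "triangle (4 * int L * int m) (edge_weight m z a') (edge_weight m z b') (edge_weight m z c')"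
    using triangle_perm[where h = "edge_weight m z", OF _ assms(2)] assms(1) by simp
qed (use assms(3) in blast)

lemma admissible_triangle: "admissible v m z \<Longrightarrow> incident G v = {#a, b, c#} \<Longrightarrow> triangle (4 * int L * int m) (edge_weight m z a) (edge_weight m z b) (edge_weight m z c)"
  and admissible_leaf: "admissible v m z \<Longrightarrow> i \<in> {1..n} \<Longrightarrow> LE i \<in> star v \<Longrightarrow> edge_weight m z (LE i) = int m * int (r i)"
  by (simp_all add: admissible_def)

lemma edge_weight_add: "edge_weight (a + b) (y + z) e = edge_weight a y e + edge_weight b z e"
  by (simp add: edge_weight_def algebra_simps)

lemma incident_in_star: "incident G v = {#a, b, c#} \<Longrightarrow> a \<in> star v \<and> b \<in> star v \<and> c \<in> star v"
  using set_incident[of v] by auto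

lemma admissible_local:
  assumes "\<And>e. e \<in> star v \<Longrightarrow> z e = z' e" "admissible v m z"
  shows "admissible v m z'"
proof -
  have e: "edge_weight m z' e = edge_weight m z e" if "e \<in> star v" for e using assms(1)[OF that] by (simp add: edge_weight_def)
  show ?thesis
    unfolding admissible_def
  proof (intro conjI allI impI ballI)
    fix a b c assume i: "incident G v = {#a, b, c#}"
    then show "triangle (4 * int L * int m) (edge_weight m z' a) (edge_weight m z' b) (edge_weight m z' c)"
      using admissible_triangle[OF assms(2) i] e incident_in_star[OF i] by simp
  next
    fix i assume "i \<in> {1..n}" "LE i \<in> star v"
    then show "edge_weight m z' (LE i) = int m * int (r i)" using admissible_leaf[OF assms(2)] e by simp
  qed
qed

lemma admissible_add:
  assumes "admissible v a y" "admissible v b z" shows "admissible v (a + b) (y + z)"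
  unfolding admissible_def edge_weight_add
proof (intro conjI allI impI ballI)
  fix e1 e2 e3 assume i: "incident G v = {#e1, e2, e3#}"
  show "triangle (4 * int L * int (a + b)) (edge_weight a y e1 + edge_weight b z e1) (edge_weight a y e2 + edge_weight b z e2) (edge_weight a y e3 + edge_weight b z e3)"
    using admissible_triangle[OF assms(1) i] admissible_triangle[OF assms(2) i] unfolding triangle_def by (simp add: algebra_simps)
next
  fix i assume "i \<in> {1..n}" "LE i \<in> star v"
  then show "edge_weight a y (LE i) + edge_weight b z (LE i) = int (a + b) * int (r i)"
    using admissible_leaf[OF assms(1)] admissible_leaf[OF assms(2)] by (simp add: algebra_simps)
qed

lemma star_three:
  assumes "v \<in> verts G" shows "\<exists>e1 e2 e3. star v = {e1, e2, e3}"
  using assms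
proof (cases rule: vertex_cases)
  case (leaf e)
  then have "star v = {e, e, e}" by simp
  then show ?thesis by blast
next
  case (loop e)
  then have "star v = {e, l v, l v}" by simp
  then show ?thesis by blast
next
  case (branch a b c)
  then show ?thesis by blast
qed

lemma leaf_weight: 
  assumes "i \<in> {1..n}" shows "\<exists>k. int (r i) = 2 * k + odd_indicator (LE i)"
proof (cases "odd (r i)")
  case True
  then have "odd_indicator (LE i) = 1" using leaf_parity[OF assms] by (simp add: odd_indicator_def)
  then show ?thesis using True by (intro exI[of _ "int (r i) div 2"]) simp
next
  case False
  then have "odd_indicator (LE i) = 0" using leaf_parity[OF assms] by (simp add: odd_indicator_def)
  then show ?thesis using False by (intro exI[of _ "int (r i) div 2"]) simp
qed

text \<open>Leaf weights are fixed multiples of the level, so every summand of a balanced decomposition has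
  the correct leaf weights.\<close>

lemma admissible_leaf_rounding:
  assumes M: "size M = m" "set_mset M \<subseteq> boxed (\<lambda>e. z e div int m) (star v)" "\<Sum>\<^sub># M = restr (star v) z"
    and m: "m > 0" and admissible: "admissible v m z" and y: "y \<in># M" and i: "i \<in> {1..n}" "LE i \<in> star v"
  shows "edge_weight 1 y (LE i) = int (r i)"
proof -
  have T: "LE i \<in> edges T" using LE_edge[OF i(1)] by blast
  obtain k where k: "int (r i) = 2 * k + odd_indicator (LE i)" using leaf_weight[OF i(1)] by blast
  have "2 * z (LE i) + int m * odd_indicator (LE i) = int m * (2 * k + odd_indicator (LE i))"
    using admissible_leaf[OF admissible i] T k by (simp add: edge_weight_def)
  then have "z (LE i) = int m * k" by (simp add: algebra_simps)
  then have "y (LE i) = k" using rounding_bounds[OF M m i(2) y, of k k] by simp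
  then show ?thesis using k T by (simp add: edge_weight_def)
qed

text \<open>Four kinds of nodes: at a leaf any balanced decomposition will do; a loop and a trinode without odd
  edges are \<open>loop_decomposition\<close> and \<open>triangle_decomposition\<close>; at a trinode with two odd leaf edges
  the conditions bound the third edge by integer multiples of the level.\<close>

lemma admissible_decomp:
  assumes v: "v \<in> verts G" and m: "m > 0" and admissible: "admissible v m z"
  shows "\<exists>M. size M = m \<and> set_mset M \<subseteq> {y \<in> boxed (\<lambda>e. z e div int m) (star v). admissible v 1 y} \<and> \<Sum>\<^sub># M = restr (star v) z"
proof -
  let ?f = "\<lambda>e. z e div int m"
  have fin: ?thesis if M: "size M = m" "set_mset M \<subseteq> boxed ?f (star v)" "\<Sum>\<^sub># M = restr (star v) z"
    and i: "incident G v = {#a, b, c#}" and tri: "\<And>y. y \<in># M \<Longrightarrow> triangle (4 * int L) (edge_weight 1 y a) (edge_weight 1 y b) (edge_weight 1 y c)" for M a b c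
  proof -
    have "admissible v 1 y" if "y \<in># M" for y
      using tri[OF that] admissible_leaf_rounding[OF M m admissible that] by (intro admissibleI[OF i]) simp_all
    then show ?thesis using M by blast
  qed
  show ?thesis
    using v
  proof (cases rule: vertex_cases)
    case (leaf e)
    obtain M where M: "size M = m" "set_mset M \<subseteq> boxed ?f (star v)" "\<Sum>\<^sub># M = restr (star v) z"
      using free_decomposition[OF m] by blast
    have "admissible v 1 y" if "y \<in># M" for y
      unfolding admissible_def using admissible_leaf_rounding[OF M m admissible that] leaf(3) by simp
    then show ?thesis using M by blast
  next
    case (loop e)
    have odd_indicator: "odd_indicator e = 0" using loop_not_odd[OF loop(1), of e] loop(7) by (simp add: odd_indicator_def)
    have ne: "e \<noteq> l v" using loop(3,4) by auto
    have edge_weight: "edge_weight k y e = 2 * y e" "edge_weight k y (l v) = y (l v)" for k y using odd_indicator loop(3,4) by (simp_all add: edge_weight_def)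
    have "triangle (4 * int L * int m) (2 * z e) (z (l v)) (z (l v))" using admissible_triangle[OF admissible loop(6)] unfolding edge_weight .
    then have "0 \<le> z e" "z e \<le> z (l v)" "z e + z (l v) \<le> 2 * int L * int m" by (simp_all add: triangle_def)
    from loop_decomposition[OF ne m this]
    obtain M where M: "size M = m" "set_mset M \<subseteq> {y \<in> boxed ?f {e, l v}. 0 \<le> y e \<and> y e \<le> y (l v) \<and> y e + y (l v) \<le> 2 * int L}"
      "\<Sum>\<^sub># M = restr {e, l v} z" by blast
    show ?thesis
    proof (rule fin[OF M(1) _ _ loop(6)])
      show "set_mset M \<subseteq> boxed ?f (star v)" "\<Sum>\<^sub># M = restr (star v) z" using M(2,3) loop(7) by auto
      show "triangle (4 * int L) (edge_weight 1 y e) (edge_weight 1 y (l v)) (edge_weight 1 y (l v))" if "y \<in># M" for y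
        unfolding edge_weight triangle_def using M(2) that by fastforce
    qed
  next
    case (branch a b c)
    have p01: "odd_indicator x = 0 \<or> odd_indicator x = 1" for x by (simp add: odd_indicator_def)
    have odd: ?thesis if i: "incident G v = {#x, y, w#}" and p: "odd_indicator x = 1" "odd_indicator y = 1" "odd_indicator w = 0" for x y w
    proof -
      obtain M where M: "size M = m" "set_mset M \<subseteq> boxed ?f (star v)" "\<Sum>\<^sub># M = restr (star v) z"
        using free_decomposition[OF m] by blast
      have star: "x \<in> star v" "y \<in> star v" "w \<in> star v" using incident_in_star[OF i] by auto
      have wT: "w \<in> edges T" using star(3) branch by auto
      have "x \<in> odd_edges" "y \<in> odd_edges" using p by (auto simp: odd_indicator_def split: if_splits)
      then obtain i1 i2 where i12: "i1 \<in> {1..n}" "x = LE i1" "odd (r i1)" "i2 \<in> {1..n}" "y = LE i2" "odd (r i2)"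
        unfolding odd_edges_def by blast
      obtain p q where pq: "r i1 = 2 * p + 1" "r i2 = 2 * q + 1" using i12(3,6) by (meson oddE)
      have ew: "edge_weight k u w = 2 * u w" for k u using wT p(3) by (simp add: edge_weight_def)
      have "triangle (4 * int L * int m) (int m * int (r i1)) (int m * int (r i2)) (2 * z w)"
        using admissible_triangle[OF admissible i] admissible_leaf[OF admissible i12(1)] admissible_leaf[OF admissible i12(4)] star i12(2,5) ew by simp
      \<comment> \<open>With the odd leaf weights \<open>2p + 1\<close> and \<open>2q + 1\<close> all bounds on \<open>z w\<close> are integers at level one.\<close>
      then have b: "int m * (int p - int q) \<le> z w" "int m * (int q - int p) \<le> z w" "z w \<le> int m * (int p + int q + 1)"
        "z w \<le> int m * (2 * int L - int p - int q - 1)"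
        unfolding pq triangle_def by (simp_all add: algebra_simps)
      show ?thesis
      proof (rule fin[OF M i])
        fix u assume u: "u \<in># M"
        have lo: "k \<le> u w" if "int m * k \<le> z w" for k
          by (rule rounding_bounds(1)[OF M m star(3) u that b(3)])
        have hi: "u w \<le> k" if "z w \<le> int m * k" for k
          by (rule rounding_bounds(2)[OF M m star(3) u b(1) that])
        have e12: "edge_weight 1 u x = int (r i1)" "edge_weight 1 u y = int (r i2)"
          using admissible_leaf_rounding[OF M m admissible u i12(1)] admissible_leaf_rounding[OF M m admissible u i12(4)] star i12(2,5) by simp_all
        show "triangle (4 * int L) (edge_weight 1 u x) (edge_weight 1 u y) (edge_weight 1 u w)"
          unfolding e12 ew pq triangle_def using lo[OF b(1)] lo[OF b(2)] hi[OF b(3)] hi[OF b(4)] by simp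
      qed
    qed
    have "odd_indicator a + odd_indicator b + odd_indicator c = 0 \<or> odd_indicator a + odd_indicator b + odd_indicator c = 2"
      by (rule branch_parity[OF branch(2,10,6,7,8)])
    then consider "odd_indicator a = 0" "odd_indicator b = 0" "odd_indicator c = 0" | "odd_indicator a = 1" "odd_indicator b = 1" "odd_indicator c = 0" 
      | "odd_indicator a = 1" "odd_indicator c = 1" "odd_indicator b = 0" | "odd_indicator b = 1" "odd_indicator c = 1" "odd_indicator a = 0"
      using p01[of a] p01[of b] p01[of c] by auto
    then show ?thesis
    proof cases
      case 1
      have edge_weight: "edge_weight k y a = 2 * y a" "edge_weight k y b = 2 * y b" "edge_weight k y c = 2 * y c" for k y using 1 branch(3-5) by (simp_all add: edge_weight_def)
      have "triangle (4 * int L * int m) (2 * z a) (2 * z b) (2 * z c)" using admissible_triangle[OF admissible branch(9)] unfolding edge_weight .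
      then have tri: "triangle (2 * int L * int m) (z a) (z b) (z c)" by (simp add: triangle_def)
      have "int L \<ge> 2" using L by simp
      from triangle_decomposition[OF branch(6-8) m this tri]
      obtain M where M: "size M = m" "set_mset M \<subseteq> {y \<in> boxed ?f {a, b, c}. triangle (2 * int L) (y a) (y b) (y c)}"
        "\<Sum>\<^sub># M = restr {a, b, c} z" by blast
      show ?thesis
      proof (rule fin[OF M(1) _ _ branch(9)])
        show "set_mset M \<subseteq> boxed ?f (star v)" "\<Sum>\<^sub># M = restr (star v) z" using M(2,3) branch(10) by auto
        fix y assume "y \<in># M"
        then have "triangle (2 * int L) (y a) (y b) (y c)" using M(2) by blast
        then show "triangle (4 * int L) (edge_weight 1 y a) (edge_weight 1 y b) (edge_weight 1 y c)" unfolding edge_weight triangle_def by simp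
      qed
    next
      case 2 then show ?thesis using odd[OF branch(9)] by simp
    next
      case 3 
      have "incident G v = {#a, c, b#}" using branch(9) by (simp add: add_mset_commute)
      then show ?thesis using odd 3 by blast
    next
      case 4
      have "incident G v = {#b, c, a#}" using branch(9) by (simp add: add_mset_commute)
      then show ?thesis using odd 4 by blast
    qed
  qed
qed

sublocale constraints "verts G" star admissible
proof
  show "admissible v m z'" if "\<And>e. e \<in> star v \<Longrightarrow> z e = z' e" "admissible v m z" for v m z z' using admissible_local[OF that] .
  show "admissible v (a + b) (y + z)" if "admissible v a y" "admissible v b z" for v a b y z using admissible_add[OF that] .
qed (fact star_three, fact admissible_decomp)

end

section \<open>Lattice points of the polytope\<close>

lemma even_if_0_or_2: "s = 0 \<or> s = 2 \<Longrightarrow> even s" for s :: int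
  by auto

text \<open>Meant for an affine map \<open>\<phi>\<close>, for which the sum of an image also depends on the size of the
  multiset.\<close>

lemma exchange_connected_image:
  assumes conn: "exchange_connected Z"
    and sums: "\<And>M. \<Sum>\<^sub># (image_mset \<phi> M) = \<Phi> (size M) (\<Sum>\<^sub># M)"
    and inj: "\<And>M M'. set_mset M \<subseteq> Z \<Longrightarrow> set_mset M' \<subseteq> Z \<Longrightarrow> size M = size M' \<Longrightarrow> 
        \<Phi> (size M) (\<Sum>\<^sub># M) = \<Phi> (size M) (\<Sum>\<^sub># M') \<Longrightarrow> \<Sum>\<^sub># M = \<Sum>\<^sub># M'"
  shows "exchange_connected (\<phi> ` Z)"
  unfolding exchange_connected_def
proof (intro allI impI)
  fix M M' assume M: "set_mset M \<subseteq> \<phi> ` Z" "set_mset M' \<subseteq> \<phi> ` Z" "size M = size M'" "\<Sum>\<^sub># M = \<Sum>\<^sub># M'"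
  have pre: "\<exists>N. image_mset \<phi> N = M \<and> set_mset N \<subseteq> Z" if "set_mset M \<subseteq> \<phi> ` Z" for M
  proof -
    let ?g = "inv_into Z \<phi>"
    have "image_mset \<phi> (image_mset ?g M) = image_mset id M"
      unfolding multiset.map_comp using that by (intro image_mset_cong) (auto intro: f_inv_into_f)
    moreover have "set_mset (image_mset ?g M) \<subseteq> Z" using that by (auto intro: inv_into_into)
    ultimately show ?thesis by (intro exI[of _ "image_mset ?g M"]) simp
  qed
  obtain N where N: "M = image_mset \<phi> N" "set_mset N \<subseteq> Z" using pre[OF M(1)] by blast
  obtain N' where N': "M' = image_mset \<phi> N'" "set_mset N' \<subseteq> Z" using pre[OF M(2)] by blast
  have size: "size N = size N'" using M(3) N N' by simp
  have "\<Sum>\<^sub># N = \<Sum>\<^sub># N'"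
    using M(4) unfolding N(1) N'(1) sums by (intro inj[OF N(2) N'(2) size]) (simp add: size)
  then have "(exchange Z)\<^sup>*\<^sup>* N N'" using conn N(2) N'(2) size unfolding exchange_connected_def by blast
  then have "(exchange (\<phi> ` Z))\<^sup>*\<^sup>* (image_mset \<phi> N) (image_mset \<phi> N')"
  proof induction
    case (step K K')
    obtain A B D where D: "K = A + D" "K' = B + D" "size A = size B" "size A \<le> 3" "\<Sum>\<^sub># A = \<Sum>\<^sub># B"
      "set_mset K \<subseteq> Z" "set_mset K' \<subseteq> Z" using step.hyps(2) unfolding exchange_def by metis
    have "exchange (\<phi> ` Z) (image_mset \<phi> A + image_mset \<phi> D) (image_mset \<phi> B + image_mset \<phi> D)"
      using D by (intro exchangeI) (auto simp: sums)
    then show ?case using step.IH D(1,2) by simp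
  qed simp
  then show "(exchange (\<phi> ` Z))\<^sup>*\<^sup>* M M'" using N N' by simp
qed

context weighted_tree_with_loops
begin

abbreviation "polytope \<equiv> graph_polytope G n lab r (2 * L)"
abbreviation "lattice \<equiv> graph_lattice G"

text \<open>A solution of level \<open>m\<close> as a point of the \<open>m\<close>-th dilate.\<close>

definition real_weighting :: "nat \<Rightarrow> ('b \<Rightarrow> int) \<Rightarrow> 'b \<Rightarrow> real" where
  "real_weighting m z = (\<lambda>e. if e \<in> edges G then real_of_int (edge_weight m z e) else 0)"

lemma real_weighting_sum: "\<Sum>\<^sub># (image_mset (real_weighting 1) M) = real_weighting (size M) (\<Sum>\<^sub># M)"
proof (induction M)
  case empty
  have "real_weighting 0 0 = 0" by (intro ext) (simp add: real_weighting_def edge_weight_def)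
  then show ?case by (simp only: image_mset_empty sum_mset.empty size_empty)
next
  case (add z M)
  have "real_weighting 1 z + real_weighting (size M) (\<Sum>\<^sub># M) = real_weighting (1 + size M) (z + \<Sum>\<^sub># M)"
  proof
    fix e show "(real_weighting 1 z + real_weighting (size M) (\<Sum>\<^sub># M)) e = real_weighting (1 + size M) (z + \<Sum>\<^sub># M) e"
      unfolding real_weighting_def plus_fun_apply edge_weight_add by simp
  qed
  then show ?case using add.IH by (simp only: image_mset_add_mset sum_mset.add_mset size_add_mset plus_1_eq_Suc)
qed

lemma level_off: "z \<in> level (verts G) m \<Longrightarrow> e \<notin> edges G \<Longrightarrow> z e = 0"
  unfolding level_def Union_star by blast

lemma real_weighting_inject:
  assumes "z \<in> level (verts G) a" "z' \<in> level (verts G) b" "real_weighting m z = real_weighting m z'"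
  shows "z = z'"
proof
  fix e
  show "z e = z' e"
  proof (cases "e \<in> edges G")
    case True
    then have "edge_weight m z e = edge_weight m z' e" using fun_cong[OF assms(3), of e] by (simp add: real_weighting_def)
    then show ?thesis by (simp add: edge_weight_def split: if_splits)
  next
    case False
    then show ?thesis using level_off assms by metis
  qed
qed

lemma level_triangle:
  assumes z: "z \<in> level (verts G) m" and v: "v \<in> verts G" and i: "incident G v = {#a, b, c#}"
  shows "triangle (4 * int L * int m) (edge_weight m z a) (edge_weight m z b) (edge_weight m z c)"
  using z v by (intro admissible_triangle[OF _ i]) (simp add: level_def)

lemma level_leaf:
  assumes z: "z \<in> level (verts G) m" and i: "i \<in> {1..n}"
  shows "edge_weight m z (LE i) = int m * int (r i)"
proof (rule admissible_leaf[OF _ i])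
  have "lab i \<in> verts G" using lab_leaf[OF i] by (simp add: leaves_def)
  then show "admissible (lab i) m z" using z by (simp add: level_def)
  show "LE i \<in> star (lab i)" using leaf_edge(1)[OF lab_leaf[OF i]] by simp
qed

lemma leaf_label: "v \<in> leaves G \<Longrightarrow> \<exists>i\<in>{1..n}. v = lab i"
  using lab unfolding leaf_labeling_def bij_betw_def by blast

lemma incident_edges: "incident G v = {#a, b, c#} \<Longrightarrow> a \<in> edges G \<and> b \<in> edges G \<and> c \<in> edges G"
  using incident_in_star[of v a b c] by (auto simp: star_def)

lemma level_nonneg:
  assumes z: "z \<in> level (verts G) m" and e: "e \<in> edges G" shows "0 \<le> edge_weight m z e"
proof -
  obtain v where v: "v \<in> verts G" "e \<in> star v" using e Union_star by blast
  show ?thesis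
    using v(1)
  proof (cases rule: vertex_cases)
    case (leaf x)
    obtain i where i: "i \<in> {1..n}" "v = lab i" using leaf_label[OF leaf(1)] by blast
    then have "e = LE i" using leaf_edge(1)[OF lab_leaf[OF i(1)]] v(2) by simp
    then show ?thesis using level_leaf[OF z i(1)] by simp
  next
    case (loop x)
    from level_triangle[OF z v(1) loop(6)] show ?thesis using v(2) loop(7) by (auto simp: triangle_def)
  next
    case (branch a b c)
    from level_triangle[OF z v(1) branch(9)] show ?thesis using v(2) branch(10) by (auto simp: triangle_def)
  qed
qed

lemma sum_incident: "incident G v = {#a, b, c#} \<Longrightarrow> g a + g b + g c = (\<Sum>e\<in>#incident G v. g e)" for g :: "'b \<Rightarrow> int"
  by simp

lemma even_edge_weight:
  assumes v: "v \<in> trinodes G" and i: "incident G v = {#a, b, c#}" 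
  shows "even (edge_weight 1 z a + edge_weight 1 z b + edge_weight 1 z c)"
proof -
  have vG: "v \<in> verts G" using v by (simp add: trinodes_def)
  have "even (\<Sum>e\<in>#incident G v. edge_weight 1 z e)"
    using vG
  proof (cases rule: vertex_cases)
    case (leaf e)
    then show ?thesis using leaf_not_trinode v by blast
  next
    case (loop e)
    have "odd_indicator e = 0" using loop_not_odd[OF loop(1), of e] loop(7) by (simp add: odd_indicator_def)
    then show ?thesis using loop by (simp add: edge_weight_def)
  next
    case (branch a b c)
    have "even (odd_indicator a + odd_indicator b + odd_indicator c)" by (rule even_if_0_or_2[OF branch_parity[OF v branch(10,6,7,8)]])
    moreover have "(\<Sum>e\<in>#incident G v. edge_weight 1 z e) = 2 * (z a + z b + z c) + (odd_indicator a + odd_indicator b + odd_indicator c)"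
      using branch by (simp add: edge_weight_def)
    ultimately show ?thesis by simp
  qed
  then show ?thesis unfolding sum_incident[OF i] .
qed

lemma real_weighting_in_polytope:
  assumes z: "z \<in> level (verts G) 1"
  shows "real_weighting 1 z \<in> polytope \<inter> lattice"
proof
  have w: "real_weighting 1 z \<in> weightings G" by (simp add: weightings_def real_weighting_def)
  show "real_weighting 1 z \<in> polytope"
    unfolding graph_polytope_def mem_Collect_eq
  proof (intro conjI ballI allI impI w)
    show "0 \<le> real_weighting 1 z e" if "e \<in> edges G" for e using level_nonneg[OF z that] that by (simp add: real_weighting_def)
    show "real_weighting 1 z (LE i) = real (r i)" if "i \<in> {1..n}" for i
      using level_leaf[OF z that] LE_edge[OF that] by (simp add: real_weighting_def)
    fix v a b c assume v: "v \<in> trinodes G" and i: "incident G v = {#a, b, c#}"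
    have "v \<in> verts G" using v by (simp add: trinodes_def)
    from level_triangle[OF z this i] have "triangle (4 * int L) (edge_weight 1 z a) (edge_weight 1 z b) (edge_weight 1 z c)" by simp
    then show "\<bar>real_weighting 1 z a - real_weighting 1 z b\<bar> \<le> real_weighting 1 z c" "real_weighting 1 z c \<le> real_weighting 1 z a + real_weighting 1 z b" 
      "real_weighting 1 z a + real_weighting 1 z b + real_weighting 1 z c \<le> 2 * real (2 * L)"
      using incident_edges[OF i] unfolding real_weighting_def triangle_def by (simp_all, linarith+)
  qed
  show "real_weighting 1 z \<in> lattice"
    unfolding graph_lattice_def mem_Collect_eq
  proof (intro conjI ballI allI impI w)
    show "real_weighting 1 z e \<in> \<int>" for e by (simp add: real_weighting_def)
    fix v a b c assume v: "v \<in> trinodes G" and i: "incident G v = {#a, b, c#}"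
    obtain k where "edge_weight 1 z a + edge_weight 1 z b + edge_weight 1 z c = 2 * k" using even_edge_weight[OF v i, of z] by blast
    then have "real_of_int (edge_weight 1 z a + edge_weight 1 z b + edge_weight 1 z c) = real_of_int (2 * k)" by (rule arg_cong)
    then show "\<exists>k::int. real_weighting 1 z a + real_weighting 1 z b + real_weighting 1 z c = 2 * of_int k"
      using incident_edges[OF i] by (intro exI[of _ k]) (simp add: real_weighting_def)
  qed
qed

text \<open>The excess of the weight over the expected parity is even at the leaves and next to loops. At a
  trinode without a loop it is even on an edge if it is even on the other two, so \<open>tree_built_propagate\<close> applies.\<close>

lemma parity_of_lattice_point:
  fixes k :: "'b \<Rightarrow> int"
  assumes kleaf: "\<And>i. i \<in> {1..n} \<Longrightarrow> k (LE i) = int m * int (r i)"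
    and keven: "\<And>v a b c. v \<in> trinodes G \<Longrightarrow> incident G v = {#a, b, c#} \<Longrightarrow> even (k a + k b + k c)"
    and e: "e \<in> edges T"
  shows "even (k e - int m * odd_indicator e)"
proof -
  let ?d = "\<lambda>e. k e - int m * odd_indicator e"
  let ?good = "{e. e \<in> edges T \<longrightarrow> even (?d e)}"
  have "\<Union>(star ` verts G) \<subseteq> ?good"
  proof (rule tree_built_propagate[OF tree_built_star])
    fix v e assume v: "v \<in> verts G" and e: "e \<in> star v" "star v - {e} \<subseteq> ?good"
    show "e \<in> ?good"
      using v
    proof (cases rule: vertex_cases)
      case (leaf x)
      obtain i where i: "i \<in> {1..n}" "v = lab i" using leaf_label[OF leaf(1)] by blast
      then have eL: "e = LE i" using leaf_edge(1)[OF lab_leaf[OF i(1)]] e(1) by simp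
      obtain h where "int (r i) = 2 * h + odd_indicator (LE i)" using leaf_weight[OF i(1)] by blast
      then have "?d e = 2 * (int m * h)" unfolding eL kleaf[OF i(1)] by (simp add: algebra_simps)
      then have "even (?d e)" unfolding dvd_def by blast
      then show ?thesis by blast
    next
      case (loop x)
      have "odd_indicator x = 0" using loop_not_odd[OF loop(1), of x] loop(7) by (simp add: odd_indicator_def)
      moreover have "even (k x + k (l v) + k (l v))" using keven[OF loop(2,6)] .
      ultimately have "even (?d x)" by simp
      then show ?thesis using e(1) loop(4,7) by auto
    next
      case (branch a b c)
      have "even (odd_indicator a + odd_indicator b + odd_indicator c)" by (rule even_if_0_or_2[OF branch_parity[OF branch(2,10,6,7,8)]])
      then have "even (int m * (odd_indicator a + odd_indicator b + odd_indicator c))" by simp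
      then have "even ((k a + k b + k c) - int m * (odd_indicator a + odd_indicator b + odd_indicator c))" using keven[OF branch(2,9)] by simp
      moreover have "(k a + k b + k c) - int m * (odd_indicator a + odd_indicator b + odd_indicator c) = ?d a + ?d b + ?d c" by (simp add: algebra_simps)
      ultimately have s: "even (?d a + ?d b + ?d c)" by simp
      have "x \<noteq> e \<Longrightarrow> x \<in> {a, b, c} \<Longrightarrow> even (?d x)" for x using e(2) branch(3-5,10) by auto
      then have g: "a \<noteq> e \<Longrightarrow> even (?d a)" "b \<noteq> e \<Longrightarrow> even (?d b)" "c \<noteq> e \<Longrightarrow> even (?d c)" by simp_all
      have "e = a \<or> e = b \<or> e = c" using e(1) branch(10) by auto
      then have "even (?d e)"
      proof (elim disjE)
        assume "e = a" then show ?thesis using s g(2,3) branch(6-8) by auto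
      next
        assume "e = b" then show ?thesis using s g(1,3) branch(6-8) by auto
      next
        assume "e = c" then show ?thesis using s g(1,2) branch(6-8) by auto
      qed
      then show ?thesis by simp
    qed
  next
    fix e assume "e \<in> \<Union>(star ` verts G)" 
      and u: "\<And>v v'. v \<in> verts G \<Longrightarrow> v' \<in> verts G \<Longrightarrow> e \<in> star v \<Longrightarrow> e \<in> star v' \<Longrightarrow> v = v'"
    have "e \<notin> edges T"
    proof
      assume eT: "e \<in> edges T"
      obtain x y where xy: "x \<noteq> y" "x \<in> verts G" "y \<in> verts G" "ends G e = {#x, y#}" using ends_tree[OF eT] by blast
      have "e \<in> star x" "e \<in> star y" using xy eT by (simp_all add: star_def edges)
      then show False using u[OF xy(2,3)] xy(1) by blast
    qed
    then show "e \<in> ?good" by simp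
  qed
  then show ?thesis using e edges unfolding Union_star by blast
qed

text \<open>The inequalities of the polytope add up over the summands of a Minkowski sum, and parity permits
  halving.\<close>

lemma lattice_point_level:
  assumes mw: "(m, w) \<in> graded_points lattice polytope"
  shows "\<exists>z\<in>level (verts G) m. w = real_weighting m z"
proof -
  obtain p where p: "\<And>i. i < m \<Longrightarrow> p i \<in> polytope" "w = sum p {..<m}" and wL: "w \<in> lattice"
    using mw unfolding graded_points_iff by blast
  have wsum: "w e = (\<Sum>i<m. p i e)" for e unfolding p(2) by (induction m) auto
  define k where "k e = \<lfloor>w e\<rfloor>" for e
  have k: "real_of_int (k e) = w e" if "e \<in> edges G" for e
    using wL that unfolding graph_lattice_def k_def by auto
  have ptri: "p j a \<le> p j b + p j c \<and> p j b \<le> p j a + p j c \<and> p j c \<le> p j a + p j b \<and> p j a + p j b + p j c \<le> 4 * real L"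
    if "j < m" "v \<in> trinodes G" "incident G v = {#a, b, c#}" for j v a b c
  proof -
    have "\<bar>p j a - p j b\<bar> \<le> p j c \<and> p j c \<le> p j a + p j b \<and> p j a + p j b + p j c \<le> 2 * real (2 * L)"
      using p(1)[OF that(1)] that(2,3) unfolding graph_polytope_def by blast
    then show ?thesis by auto
  qed
  have ktri: "triangle (4 * int L * int m) (k a) (k b) (k c)" if v: "v \<in> trinodes G" "incident G v = {#a, b, c#}" for v a b c
  proof -
    note E = incident_edges[OF v(2)]
    have "w a \<le> w b + w c" "w b \<le> w a + w c" "w c \<le> w a + w b"
      unfolding wsum sum.distrib[symmetric] by (intro sum_mono; use ptri[OF _ v] in auto)+
    moreover have "w a + w b + w c \<le> (\<Sum>i<m. 4 * real L)"
      unfolding wsum sum.distrib[symmetric] by (intro sum_mono; use ptri[OF _ v] in auto)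
    ultimately have "real_of_int (k a) \<le> real_of_int (k b + k c)" "real_of_int (k b) \<le> real_of_int (k a + k c)"
      "real_of_int (k c) \<le> real_of_int (k a + k b)" "real_of_int (k a + k b + k c) \<le> real_of_int (4 * int L * int m)"
      using k E by (simp_all add: algebra_simps)
    then show ?thesis unfolding triangle_def of_int_le_iff by blast
  qed
  have kleaf: "k (LE i) = int m * int (r i)" if i: "i \<in> {1..n}" for i
  proof -
    have "p j (LE i) = real (r i)" if "j < m" for j using p(1)[OF that] i unfolding graph_polytope_def by blast
    then have wi: "w (LE i) = real_of_int (int m * int (r i))" unfolding wsum by simp
    show ?thesis unfolding k_def wi by (rule floor_of_int)
  qed
  have keven: "even (k a + k b + k c)" if v: "v \<in> trinodes G" "incident G v = {#a, b, c#}" for v a b c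
  proof -
    obtain h :: int where "w a + w b + w c = 2 * of_int h" using wL v unfolding graph_lattice_def by blast
    then have "real_of_int (k a + k b + k c) = real_of_int (2 * h)" using k incident_edges[OF v(2)] by simp
    then show ?thesis unfolding of_int_eq_iff by simp
  qed
  define z where "z e = (if e \<in> edges T then (k e - int m * odd_indicator e) div 2 else if e \<in> edges G then k e else 0)" for e
  have kpar: "even (k e - int m * odd_indicator e)" if "e \<in> edges T" for e
    by (rule parity_of_lattice_point[OF kleaf keven that])
  have edge_weight: "edge_weight m z e = k e" if "e \<in> edges G" for e
  proof (cases "e \<in> edges T")
    case True
    have "2 * ((k e - int m * odd_indicator e) div 2) = k e - int m * odd_indicator e" by (rule dvd_mult_div_cancel[OF kpar[OF True]])
    then show ?thesis using True by (simp add: edge_weight_def z_def)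
  qed (use that in \<open>simp add: edge_weight_def z_def\<close>)
  have "admissible v m z" if v: "v \<in> verts G" for v
    unfolding admissible_def
  proof (intro conjI allI impI ballI)
    fix a b c assume i: "incident G v = {#a, b, c#}"
    then have "v \<in> trinodes G" using v by (simp add: trinodes_def valence_def)
    then show "triangle (4 * int L * int m) (edge_weight m z a) (edge_weight m z b) (edge_weight m z c)"
      using ktri[OF _ i] incident_edges[OF i] edge_weight by simp
  next
    fix i assume "i \<in> {1..n}"
    then show "edge_weight m z (LE i) = int m * int (r i)" using edge_weight LE_edge kleaf by simp
  qed
  moreover have "z e = 0" if "e \<notin> edges G" for e using that edges by (simp add: z_def)
  ultimately have "z \<in> level (verts G) m" unfolding level_def Union_star by blast
  moreover have "w = real_weighting m z"
  proof
    fix e show "w e = real_weighting m z e"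
      using edge_weight[of e] k[of e] wL by (simp add: real_weighting_def graph_lattice_def weightings_def)
  qed
  ultimately show ?thesis by blast
qed

lemma lattice_points_eq: "polytope \<inter> lattice = real_weighting 1 ` level (verts G) 1"
proof
  show "real_weighting 1 ` level (verts G) 1 \<subseteq> polytope \<inter> lattice" using real_weighting_in_polytope by blast
  show "polytope \<inter> lattice \<subseteq> real_weighting 1 ` level (verts G) 1"
  proof
    fix w assume "w \<in> polytope \<inter> lattice"
    then have "(1, w) \<in> graded_points lattice polytope"
      unfolding graded_points_iff by (auto intro!: exI[of _ "\<lambda>_. w"])
    then show "w \<in> real_weighting 1 ` level (verts G) 1" using lattice_point_level by blast
  qed
qed

lemma lattice_closed: "x \<in> lattice \<Longrightarrow> y \<in> lattice \<Longrightarrow> x + y \<in> lattice" "0 \<in> lattice"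
proof -
  assume x: "x \<in> lattice" and y: "y \<in> lattice"
  show "x + y \<in> lattice"
    unfolding graph_lattice_def mem_Collect_eq
  proof (intro conjI ballI allI impI)
    show "x + y \<in> weightings G" "\<And>e. e \<in> edges G \<Longrightarrow> (x + y) e \<in> \<int>"
      using x y by (simp_all add: graph_lattice_def weightings_def)
    fix v a b c assume v: "v \<in> trinodes G" "incident G v = {#a, b, c#}"
    obtain h k :: int where "x a + x b + x c = 2 * of_int h" "y a + y b + y c = 2 * of_int k"
      using x y v unfolding graph_lattice_def by blast
    then show "\<exists>k::int. (x + y) a + (x + y) b + (x + y) c = 2 * of_int k"
      by (intro exI[of _ "h + k"]) simp
  qed
next
  show "0 \<in> lattice" by (simp add: graph_lattice_def weightings_def)
qed

theorem generated: "generated_in_degree_one lattice polytope"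
proof (rule generated_if_decomposable[OF lattice_closed])
  fix m w assume mw: "(m, w) \<in> graded_points lattice polytope"
  show "\<exists>M. size M = m \<and> set_mset M \<subseteq> polytope \<inter> lattice \<and> \<Sum>\<^sub># M = w"
  proof (cases "m = 0")
    case True
    then have "w = 0" using mw by (simp add: graded_points_iff)
    then show ?thesis using True by (intro exI[of _ "{#}"]) simp
  next
    case False
    obtain z where z: "z \<in> level (verts G) m" "w = real_weighting m z" using lattice_point_level[OF mw] by blast
    obtain M where M: "size M = m" "set_mset M \<subseteq> balanced_level (\<lambda>e. z e div int m) (verts G)" "\<Sum>\<^sub># M = z"
      using balanced_decomposition[OF tree_built_star subset_refl _ z(1)] False by blast
    have "set_mset (image_mset (real_weighting 1) M) \<subseteq> polytope \<inter> lattice"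
      using M(2) unfolding lattice_points_eq balanced_level_def by auto
    moreover have "\<Sum>\<^sub># (image_mset (real_weighting 1) M) = w" unfolding real_weighting_sum M z(2) ..
    ultimately show ?thesis using M(1) by (intro exI[of _ "image_mset (real_weighting 1) M"]) simp
  qed
qed

theorem relations: "relations_generated_in_degree_le 3 lattice polytope"
proof (rule relations_generated_if_connected)
  have lev: "\<Sum>\<^sub># M \<in> level (verts G) (size M)" if "set_mset M \<subseteq> level (verts G) 1" for M
    using that
  proof (induction M)
    case empty
    have "admissible v 0 0" if "v \<in> verts G" for v by (simp add: admissible_def edge_weight_def triangle_def)
    then have "0 \<in> level (verts G) 0" unfolding level_def by (intro CollectI conjI) (simp, blast)
    then show ?case by (simp only: sum_mset.empty size_empty)
  next
    case (add z M)
    then have "z \<in> level (verts G) 1" "\<Sum>\<^sub># M \<in> level (verts G) (size M)" by simp_all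
    from level_add[OF subset_refl this] show ?case by (simp only: sum_mset.add_mset size_add_mset plus_1_eq_Suc)
  qed
  show "exchange_connected (polytope \<inter> lattice)"
    unfolding lattice_points_eq
    by (rule exchange_connected_image[OF level_connected[OF tree_built_star fin(1)] real_weighting_sum])
      (use real_weighting_inject lev in blast)
qed

end

theorem theorem1p9:
  fixes G :: "('v, 'e) mgraph" and n L :: nat
    and lab :: "nat \<Rightarrow> 'v" and r :: "nat \<Rightarrow> nat"
  assumes "tree_like G"
    and "leaf_labeling G n lab"
    and "L > 1"
    and "compatible G n lab r"
  shows "generated_in_degree_one (graph_lattice G) (graph_polytope G n lab r (2 * L)) \<and>
         relations_generated_in_degree_le 3 (graph_lattice G) (graph_polytope G n lab r (2 * L))"
proof -
  obtain T :: "('v, 'e) mgraph" and S l where T: "trivalent G" "trivalent T" "tree T" 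
      "S \<subseteq> leaves T" "card S = genus G" "inj_on l S" "l ` S \<inter> edges T = {}" 
      "verts G = verts T" "edges G = edges T \<union> l ` S" "\<forall>e\<in>edges T. ends G e = ends T e" "\<forall>v\<in>S. ends G (l v) = {#v, v#}"
    using assms(1) unfolding tree_like_def by (elim conjE exE) (rule that; assumption)
  have gT: "graph T" using T(3) by (simp add: tree_def)
  have SV: "S \<subseteq> verts T" using T(4) unfolding leaves_def by blast
  have "finite (verts T)" and fE: "finite (edges T)" using gT by (simp_all add: graph_def)
  then have "finite (l ` S)" using SV finite_subset by blast
  then have "card (edges G) = card (edges T) + card (l ` S)"
    unfolding T(9) using T(7) fE by (intro card_Un_disjoint) auto
  then have cE: "card (edges G) = card (edges T) + card S" using card_image[OF T(6)] by simp
  \<comment> \<open>Each of the \<open>genus G\<close> loops adds one to the Betti number, so none is left for \<open>T\<close>.\<close>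
  have "card (edges T) + 1 \<le> card (verts T)"
    using T(5) unfolding genus_def cE T(8) by arith
  note cT = this
  interpret weighted_tree_with_loops G T S l n lab r L
  proof
    show "ends G e = ends T e" if "e \<in> edges T" for e using T(10) that by blast
    show "ends G (l v) = {#v, v#}" if "v \<in> S" for v using T(11) that by blast
    show "S \<subseteq> verts G" unfolding T(8) by (rule SV)
  qed (fact T gT cT assms)+
  show ?thesis using generated relations by blast
qed

end
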